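(* Consider the problem $\min_{x\in\mathbb{R}^{d_x}}\{F(x):=\max_{y\in\mathcal{Y}}\phi(x,y)-\max_{z\in\mathcal{Z}}\psi(x,z)\}$ under the standing assumptions (i)–(v) listed in the context, and let $\epsilon>0$. Suppose that the parameters $\gamma,\eta_0,\eta_1$ of the SMAG algorithm (described in the context) are chosen as follows: $$0<\gamma<\min\{\delta_\phi^{-1},\delta_\psi^{-1}\},\qquad \alpha=\min\Big\{\tfrac{1/\gamma-\delta_\phi}{4},\tfrac{1/\gamma-\delta_\psi}{4},\mu_\phi,\mu_\psi\Big\},$$ $$\tau=\min\Big\{\tfrac{\gamma^2\alpha^2}{4},\tfrac{\mu_\phi^{1.5}\gamma^2\alpha^{1.5}}{4L_{\phi,yx}},\tfrac{\mu_\psi^{1.5}\gamma^2\alpha^{1.5}}{4L_{\psi,zx}}\Big\},\qquad \nu=\min\Big\{1,\tfrac{2\tau}{\gamma^2\alpha}\Big\},\qquad L_F=\frac{2}{\gamma-\gamma^2\min\{\delta_\psi,\delta_\phi\}},$$ $$\eta_1=\min\Big\{\tfrac{\gamma^2(1/\gamma-\delta_\phi)}{2},\tfrac{\gamma^2(1/\gamma-\delta_\psi)}{2},\tfrac{1}{2L_F\tau},\tfrac{\min\{1,\gamma^2\}\min\{\alpha,\tau\}\nu\alpha}{768\,\tau M^2}\epsilon^2\Big\},\qquad \eta_0=\tau\eta_1.$$ Let $$P_0=\frac{2\eta_0}{\eta_1\gamma^2\alpha}\Big(\mathbb{E}\|x_\phi^{1}-\mathrm{prox}_{\gamma\Phi}(x_0)\|^2+\mathbb{E}\|y_1-y_0^*\|^2+\mathbb{E}\|x_\psi^{1}-\mathrm{prox}_{\gamma\Psi}(x_0)\|^2+\mathbb{E}\|z_1-z_0^*\|^2\Big),$$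 where $y_0^*=y^*(\mathrm{prox}_{\gamma\Phi}(x_0))$ and $z_0^*=z^*(\mathrm{prox}_{\gamma\Psi}(x_0))$. Then, whenever $$T\ge\frac{16\,(F_\gamma(x_0)-F_\gamma^*+P_0)}{\min\{1,\gamma^{-2}\}\min\{\alpha,\tau\}\,\nu\,\epsilon^2}\max\Big\{\tfrac{2}{\gamma^2(1/\gamma-\delta_\phi)},\tfrac{2}{\gamma^2(1/\gamma-\delta_\psi)},2L_F\tau,\tfrac{768\,\tau M^2}{\min\{1,\gamma^2\}\min\{\alpha,\tau\}\nu\alpha\epsilon^2}\Big\},$$ we have $$\frac1T\sum_{t=0}^{T-1}\Big(\mathbb{E}\|x_\phi^{t+1}-\mathrm{prox}_{\gamma\Phi}(x_t)\|^2+\mathbb{E}\|x_\psi^{t+1}-\mathrm{prox}_{\gamma\Psi}(x_t)\|^2+\mathbb{E}\|\nabla F_\gamma(x_t)\|^2\Big)\le\min\{1,\gamma^{-2}\}\frac{\epsilon^2}{4},$$ and consequently, with $\bar t$ sampled uniformly from $\{1,\dots,T\}$, the outputs $x_\phi^{\bar t}$ and $x_\psi^{\bar t}$ are both nearly $\epsilon$-critical points of the problem.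
   Context: Setting. $\mathcal{Y}\subset\mathbb{R}^{d_y}$ and $\mathcal{Z}\subset\mathbb{R}^{d_z}$ are convex and compact; $\phi(x,y)=\mathbb{E}_{\xi}[\phi(x,y;\xi)]$, $\psi(x,z)=\mathbb{E}_{\zeta}[\psi(x,z;\zeta)]$. Write $\Phi(x)=\max_{y\in\mathcal{Y}}\phi(x,y)$, $\Psi(x)=\max_{z\in\mathcal{Z}}\psi(x,z)$, $y^*(x)=\arg\max_{y\in\mathcal{Y}}\phi(x,y)$, $z^*(x)=\arg\max_{z\in\mathcal{Z}}\psi(x,z)$. $\|\cdot\|$ is the Euclidean norm and $P_{\mathcal{C}}$ is Euclidean projection onto a closed convex set $\mathcal{C}$. Definitions. A vector $v$ is a subgradient of $f$ at $x$ (with $f(x)$ finite) if $f(y)\ge f(x)+\langle v,y-x\rangle+o(\|y-x\|)$ as $y\to x$; $\partial f(x)$ is the set of all subgradients. $f$ is $\delta$-weakly convex if $f(\cdot)+\frac{\delta}{2}\|\cdot\|^2$ is convex. For a $\delta$-weakly convex $f$ and $\gamma\in(0,\delta^{-1})$, the Moreau envelope and proximal map are $f_\gamma(x)=\min_{x'}\{f(x')+\frac1{2\gamma}\|x'-x\|^2\}$ and $\mathrm{prox}_{\gamma f}(x)=\arg\min_{x'}\{f(x')+\frac1{2\gamma}\|x'-x\|^2\}$. Set $F_\gamma(x)=\Phi_\gamma(x)-\Psi_\gamma(x)$. A (random) vector $x$ is a nearly $\epsilon$-critical point of $\min_x\{\Phi(x)-\Psi(x)\}$ if there exist (random) $v,x',x''$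 with $v\in\partial\Phi(x')-\partial\Psi(x'')$ and $\max\{\mathbb{E}\|v\|,\mathbb{E}\|x-x'\|,\mathbb{E}\|x-x''\|\}\le\epsilon$. Standing assumptions. (i) $\phi(\cdot,y)$ is $\delta_\phi$-weakly convex for each $y\in\mathcal Y$ and $\psi(\cdot,z)$ is $\delta_\psi$-weakly convex for each $z\in\mathcal Z$. (ii) $\phi(x,\cdot)$ is $\mu_\phi$-strongly concave and $\psi(x,\cdot)$ is $\mu_\psi$-strongly concave for each $x$. (iii) $\phi(x,y)$ and $\psi(x,z)$ are differentiable in $y$ and $z$ respectively; $\nabla_y\phi(\cdot,y)$ is $L_{\phi,yx}$-Lipschitz continuous and $\nabla_z\psi(\cdot,z)$ is $L_{\psi,zx}$-Lipschitz continuous. (iv) There is a constant $F_\gamma^*>-\infty$ with $F_\gamma^*\le F_\gamma(x)$ for all $x$. (v) There is a finite constant $M$ such that $\mathbb{E}\|\tilde\partial_x\phi(x,y)\|^2\le M^2$, $\mathbb{E}\|\tilde\nabla_y\phi(x,y)\|^2\le M^2$, $\mathbb{E}\|\tilde\partial_x\psi(x,z)\|^2\le M^2$, $\mathbb{E}\|\tilde\nabla_z\psi(x,z)\|^2\le M^2$ for all $x\in\mathbb{R}^{d_x}$, $y\in\mathcal{Y}$, $z\in\mathcal{Z}$. Here $\tilde\partial_x\phi(x,y)$, $\tilde\partial_x\psi(x,z)$ denote unbiased stochastic estimators of a subgradient of $\phi(\cdot,y)$, $\psi(\cdot,z)$ at $x$, and $\tilde\nabla_y\phi$, $\tilde\nabla_z\psi$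 denote unbiased stochastic estimators of the partial gradients (in the algorithm, unbiasedness and moment bounds hold conditionally on the past iterates). SMAG algorithm. Given initial points $x_\phi^0,x_\psi^0,x_0\in\mathbb{R}^{d_x}$, $y_0\in\mathcal Y$, $z_0\in\mathcal Z$ and parameters $\gamma,\eta_0,\eta_1>0$, for $t=0,\dots,T-1$: $x_\phi^{t+1}=x_\phi^t-\eta_1\big(\tilde\partial_x\phi(x_\phi^t,y_t)+\frac1\gamma(x_\phi^t-x_t)\big)$; $y_{t+1}=P_{\mathcal{Y}}\big(y_t+\eta_1\tilde\nabla_y\phi(x_\phi^t,y_t)\big)$; $x_\psi^{t+1}=x_\psi^t-\eta_1\big(\tilde\partial_x\psi(x_\psi^t,z_t)+\frac1\gamma(x_\psi^t-x_t)\big)$; $z_{t+1}=P_{\mathcal{Z}}\big(z_t+\eta_1\tilde\nabla_z\psi(x_\psi^t,z_t)\big)$; $G_{t+1}=\frac1\gamma(x_t-x_\phi^{t+1})-\frac1\gamma(x_t-x_\psi^{t+1})$; $x_{t+1}=x_t-\eta_0G_{t+1}$. It returns $x_\phi^{\bar t}$ or $x_\psi^{\bar t}$ with $\bar t$ uniformly sampled from $\{1,\dots,T\}$. *)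

theory Defs
  imports "HOL-Probability.Probability" "HOL-Library.Landau_Symbols"
begin

definition gradient :: "('a::real_inner \<Rightarrow> real) \<Rightarrow> 'a \<Rightarrow> 'a" where
  "gradient f x = (THE D. GDERIV f x :> D)"

definition weakly_convex :: "real \<Rightarrow> ('a::real_inner \<Rightarrow> real) \<Rightarrow> bool" where
  "weakly_convex \<delta> f \<longleftrightarrow> convex_on UNIV (\<lambda>x. f x + \<delta> / 2 * (norm x)\<^sup>2)"

definition strongly_concave_on :: "real \<Rightarrow> 'a::real_inner set \<Rightarrow> ('a \<Rightarrow> real) \<Rightarrow> bool" where
  "strongly_concave_on \<mu> S f \<longleftrightarrow> concave_on S (\<lambda>y. f y + \<mu> / 2 * (norm y)\<^sup>2)"

definition subdifferential :: "('a::real_inner \<Rightarrow> real) \<Rightarrow> 'a \<Rightarrow> 'a set" where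
  "subdifferential f x =
     {v. \<exists>r. r \<in> o[at x](\<lambda>y. norm (y - x)) \<and>
             (\<forall>\<^sub>F y in at x. f y \<ge> f x + v \<bullet> (y - x) + r y)}"

definition max_over :: "'b set \<Rightarrow> ('a \<Rightarrow> 'b \<Rightarrow> real) \<Rightarrow> 'a \<Rightarrow> real" where
  "max_over Y \<phi> x = (SUP y\<in>Y. \<phi> x y)"

definition argmax_over :: "'b set \<Rightarrow> ('a \<Rightarrow> 'b \<Rightarrow> real) \<Rightarrow> 'a \<Rightarrow> 'b" where
  "argmax_over Y \<phi> x = (ARG_MAX (\<phi> x) y. y \<in> Y)"

definition moreau_env :: "real \<Rightarrow> ('a::real_inner \<Rightarrow> real) \<Rightarrow> 'a \<Rightarrow> real" where
  "moreau_env \<gamma> f x = (INF x'. f x' + 1 / (2 * \<gamma>) * (norm (x' - x))\<^sup>2)"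

definition prox :: "real \<Rightarrow> ('a::real_inner \<Rightarrow> real) \<Rightarrow> 'a \<Rightarrow> 'a" where
  "prox \<gamma> f x = (ARG_MIN (\<lambda>x'. f x' + 1 / (2 * \<gamma>) * (norm (x' - x))\<^sup>2) x'. True)"

text \<open>Conditional expectation of a vector-valued random variable, taken coordinatewise.\<close>

definition vec_cond_exp ::
  "'w measure \<Rightarrow> 'w measure \<Rightarrow> ('w \<Rightarrow> 'a::euclidean_space) \<Rightarrow> 'w \<Rightarrow> 'a" where
  "vec_cond_exp P G U \<omega> = (\<Sum>b\<in>Basis. real_cond_exp P G (\<lambda>\<omega>'. U \<omega>' \<bullet> b) \<omega> *\<^sub>R b)"

text \<open>
  \<open>U\<close> estimates some element of \<open>S\<close> without bias and has second moment at most \<open>K\<close>.  For an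
  estimator of a subgradient \<open>S\<close> is a subdifferential, for an estimator of a gradient it is
  a singleton.
\<close>

definition unbiased_estimator ::
  "'w measure \<Rightarrow> real \<Rightarrow> 'a::euclidean_space set \<Rightarrow> ('w \<Rightarrow> 'a) \<Rightarrow> bool" where
  "unbiased_estimator P K S U \<longleftrightarrow>
     U \<in> borel_measurable P \<and>
     integral\<^sup>L P U \<in> S \<and>
     integrable P (\<lambda>\<omega>. (norm (U \<omega>))\<^sup>2) \<and>
     (\<integral>\<omega>. (norm (U \<omega>))\<^sup>2 \<partial>P) \<le> K"

text \<open>
  The same conditionally on a sub-\<open>\<sigma>\<close>-algebra \<open>G\<close>; the target \<open>S\<close> is then random, since it
  depends on the current iterates.
\<close>

definition cond_unbiased_estimator ::
  "'w measure \<Rightarrow> 'w measure \<Rightarrow> real \<Rightarrow> ('w \<Rightarrow> 'a::euclidean_space set) \<Rightarrow> ('w \<Rightarrow> 'a) \<Rightarrow> bool" where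
  "cond_unbiased_estimator P G K S U \<longleftrightarrow>
     U \<in> borel_measurable P \<and>
     (AE \<omega> in P. vec_cond_exp P G U \<omega> \<in> S \<omega>) \<and>
     integrable P (\<lambda>\<omega>. (norm (U \<omega>))\<^sup>2) \<and>
     (AE \<omega> in P. real_cond_exp P G (\<lambda>\<omega>'. (norm (U \<omega>'))\<^sup>2) \<omega> \<le> K)"

text \<open>
  \<open>Q\<close> is the probability space carrying the random vector \<open>X\<close>.  Integrability is required
  explicitly because the Bochner integral of a non-integrable function is \<open>0\<close>.
\<close>

definition nearly_critical ::
  "'w measure \<Rightarrow> ('a::euclidean_space \<Rightarrow> real) \<Rightarrow> ('a \<Rightarrow> real) \<Rightarrow> real \<Rightarrow> ('w \<Rightarrow> 'a) \<Rightarrow> bool" where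
  "nearly_critical Q \<Phi> \<Psi> \<epsilon> X \<longleftrightarrow>
     X \<in> borel_measurable Q \<and>
     (\<exists>V X' X''.
        V \<in> borel_measurable Q \<and> X' \<in> borel_measurable Q \<and> X'' \<in> borel_measurable Q \<and>
        (AE \<omega> in Q. V \<omega> \<in> {a - b | a b. a \<in> subdifferential \<Phi> (X' \<omega>) \<and>
                                         b \<in> subdifferential \<Psi> (X'' \<omega>)}) \<and>
        integrable Q (\<lambda>\<omega>. norm (V \<omega>)) \<and>
        integrable Q (\<lambda>\<omega>. norm (X \<omega> - X' \<omega>)) \<and>
        integrable Q (\<lambda>\<omega>. norm (X \<omega> - X'' \<omega>)) \<and>
        Max {\<integral>\<omega>. norm (V \<omega>) \<partial>Q, \<integral>\<omega>. norm (X \<omega> - X' \<omega>) \<partial>Q, \<integral>\<omega>. norm (X \<omega> - X'' \<omega>) \<partial>Q} \<le> \<epsilon>)"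

text \<open>
  The iterates \<open>(x\<^sub>\<phi>\<^sup>t, y\<^sub>t, x\<^sub>\<psi>\<^sup>t, z\<^sub>t, x\<^sub>t)\<close>, \<open>t \<le> T\<close>, of SMAG along the outcome \<open>\<omega>\<close>.  The
  estimators \<open>gx t x y\<close>, \<open>gy t x y\<close>, \<open>hx t x z\<close>, \<open>hz t x z\<close> are the ones queried at
  iteration \<open>t\<close>; they stand for the stochastic estimators of a partial subgradient of
  \<open>\<phi>\<close>, the partial gradient of \<open>\<phi>\<close>, and the same for \<open>\<psi>\<close>.
\<close>

definition smag_path ::
  "'y::euclidean_space set \<Rightarrow> 'z::euclidean_space set \<Rightarrow> real \<Rightarrow> real \<Rightarrow> real \<Rightarrow> nat \<Rightarrow>
   (nat \<Rightarrow> 'x::euclidean_space \<Rightarrow> 'y \<Rightarrow> 'w \<Rightarrow> 'x) \<Rightarrow> (nat \<Rightarrow> 'x \<Rightarrow> 'y \<Rightarrow> 'w \<Rightarrow> 'y) \<Rightarrow>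
   (nat \<Rightarrow> 'x \<Rightarrow> 'z \<Rightarrow> 'w \<Rightarrow> 'x) \<Rightarrow> (nat \<Rightarrow> 'x \<Rightarrow> 'z \<Rightarrow> 'w \<Rightarrow> 'z) \<Rightarrow>
   'x \<Rightarrow> 'y \<Rightarrow> 'x \<Rightarrow> 'z \<Rightarrow> 'x \<Rightarrow>
   (nat \<Rightarrow> 'w \<Rightarrow> 'x) \<Rightarrow> (nat \<Rightarrow> 'w \<Rightarrow> 'y) \<Rightarrow> (nat \<Rightarrow> 'w \<Rightarrow> 'x) \<Rightarrow> (nat \<Rightarrow> 'w \<Rightarrow> 'z) \<Rightarrow>
   (nat \<Rightarrow> 'w \<Rightarrow> 'x) \<Rightarrow> 'w \<Rightarrow> bool" where
  "smag_path Y Z \<gamma> \<eta>\<^sub>0 \<eta>\<^sub>1 T gx gy hx hz x\<phi>0 y0 x\<psi>0 z0 x0 x\<phi> y x\<psi> z x \<omega> \<longleftrightarrow>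
     x\<phi> 0 \<omega> = x\<phi>0 \<and> y 0 \<omega> = y0 \<and> x\<psi> 0 \<omega> = x\<psi>0 \<and> z 0 \<omega> = z0 \<and> x 0 \<omega> = x0 \<and>
     (\<forall>t<T.
        x\<phi> (t + 1) \<omega> = x\<phi> t \<omega> - \<eta>\<^sub>1 *\<^sub>R (gx t (x\<phi> t \<omega>) (y t \<omega>) \<omega> + (1 / \<gamma>) *\<^sub>R (x\<phi> t \<omega> - x t \<omega>)) \<and>
        y (t + 1) \<omega> = closest_point Y (y t \<omega> + \<eta>\<^sub>1 *\<^sub>R gy t (x\<phi> t \<omega>) (y t \<omega>) \<omega>) \<and>
        x\<psi> (t + 1) \<omega> = x\<psi> t \<omega> - \<eta>\<^sub>1 *\<^sub>R (hx t (x\<psi> t \<omega>) (z t \<omega>) \<omega> + (1 / \<gamma>) *\<^sub>R (x\<psi> t \<omega> - x t \<omega>)) \<and>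
        z (t + 1) \<omega> = closest_point Z (z t \<omega> + \<eta>\<^sub>1 *\<^sub>R hz t (x\<psi> t \<omega>) (z t \<omega>) \<omega>) \<and>
        (let G = (1 / \<gamma>) *\<^sub>R (x t \<omega> - x\<phi> (t + 1) \<omega>) - (1 / \<gamma>) *\<^sub>R (x t \<omega> - x\<psi> (t + 1) \<omega>)
         in x (t + 1) \<omega> = x t \<omega> - \<eta>\<^sub>0 *\<^sub>R G))"

end

theory Submission
  imports Defs
begin

text \<open>
The iterates of SMAG follow two moving saddle points while the centre \<open>x\<^sub>t\<close> descends on the
difference \<open>F\<^sub>\<gamma>\<close> of two Moreau envelopes.  Two quantities
are played against each other: the expectation of \<open>F\<^sub>\<gamma>(x\<^sub>t)\<close> and the distance of the iterates from the saddle
points.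

Adding the proximal term \<open>1/(2\<gamma>) \<bar>u - x\<^sub>t\<bar>\<^sup>2\<close> makes \<open>\<phi>(u, v)\<close> strongly convex in \<open>u\<close> and strongly
concave in \<open>v\<close>, so it has a unique saddle point, and its first component is
\<open>prox\<^sub>\<gamma>\<^sub>\<Phi>(x\<^sub>t)\<close> (\<open>saddle_point\<close>).  A stochastic gradient descent ascent step contracts the expected
squared distance to this saddle point, up to a variance term of order \<open>\<eta>\<^sub>1\<^sup>2 M\<^sup>2\<close>
(\<open>gradient_step_expectation\<close>).  When the centre moves, the saddle point moves by at most a
constant times as much, because the saddle point is a Lipschitz function of the centre: this follows
from strong monotonicity (\<open>saddle_map_monotone\<close>, \<open>saddle_map_drift\<close>).  Together they give a
recursion for the tracking error \<open>D\<^sub>t\<close> (\<open>tracking_step\<close>, \<open>tracking_error_recursion\<close>):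
\<open>D\<^sub>t\<^sub>+\<^sub>1 \<le> (1 - \<alpha> \<eta>\<^sub>1) D\<^sub>t + c\<^sub>1 \<bar>x\<^sub>t\<^sub>+\<^sub>1 - x\<^sub>t\<bar>\<^sup>2 + 18 \<eta>\<^sub>1\<^sup>2 M\<^sup>2\<close>.

Moreau envelopes have quadratic upper and lower bounds, so \<open>F\<^sub>\<gamma>\<close> is differentiable with
\<open>\<nabla>F\<^sub>\<gamma>(x) = (prox\<^sub>\<gamma>\<^sub>\<Psi>(x) - prox\<^sub>\<gamma>\<^sub>\<Phi>(x)) / \<gamma>\<close> and obeys a descent lemma.  The direction
\<open>G\<^sub>t\<^sub>+\<^sub>1\<close> used by the algorithm is this gradient with the proximal points replaced by the iterates;
its error is therefore controlled by \<open>D\<^sub>t\<close> (\<open>descent_step\<close>).  The descent lemma also yields a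
negative multiple of \<open>\<bar>G\<^sub>t\<^sub>+\<^sub>1\<bar>\<^sup>2\<close>, which pays for the drift \<open>\<bar>x\<^sub>t\<^sub>+\<^sub>1 - x\<^sub>t\<bar>\<^sup>2\<close> in the recursion
above as soon as \<open>\<tau> = \<eta>\<^sub>0 / \<eta>\<^sub>1\<close> is small.

Hence \<open>F\<^sub>\<gamma>(x\<^sub>t) + 2\<tau>/(\<gamma>\<^sup>2\<alpha>) D\<^sub>t\<close> decreases in expectation by a multiple of
\<open>\<bar>\<nabla>F\<^sub>\<gamma>(x\<^sub>t)\<bar>\<^sup>2 + D\<^sub>t\<close> up to noise, and telescoping (\<open>coupled_descent_telescope\<close>) with the chosen
parameters (\<open>averaged_bound\<close>) bounds the average.  Finally \<open>(x - prox\<^sub>\<gamma>\<^sub>\<Phi>(x)) / \<gamma>\<close> is a subgradient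
of \<open>\<Phi>\<close> at \<open>prox\<^sub>\<gamma>\<^sub>\<Phi>(x)\<close>, so \<open>\<nabla>F\<^sub>\<gamma>(x)\<close> itself is the vector that witnesses near criticality, with the
two proximal points as base points (\<open>nearly_criticalI\<close>).
\<close>

section \<open>Subgradients of weakly convex functions\<close>

lemma norm_sq_convex_combination:
  fixes a b :: "'a::real_inner"
  shows "(1 - s) * (norm a)\<^sup>2 + s * (norm b)\<^sup>2 - (norm ((1 - s) *\<^sub>R a + s *\<^sub>R b))\<^sup>2
       = s * (1 - s) * (norm (b - a))\<^sup>2"
  unfolding power2_norm_eq_inner
  by (simp add: inner_simps inner_commute[of b a]) (simp add: algebra_simps power2_eq_square)

lemma convex_on_chord:
  fixes f :: "'a::real_inner \<Rightarrow> real"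
  assumes cv: "convex_on S (\<lambda>x. f x + \<delta> / 2 * (norm x)\<^sup>2)"
    and "x \<in> S" "z \<in> S" "0 \<le> s" "s \<le> 1"
  shows "f (x + s *\<^sub>R (z - x)) \<le> (1 - s) * f x + s * f z + \<delta> / 2 * (s * (1 - s) * (norm (z - x))\<^sup>2)"
proof -
  have e: "x + s *\<^sub>R (z - x) = (1 - s) *\<^sub>R x + s *\<^sub>R z"
    by (simp add: algebra_simps)
  have "f ((1 - s) *\<^sub>R x + s *\<^sub>R z) + \<delta> / 2 * (norm ((1 - s) *\<^sub>R x + s *\<^sub>R z))\<^sup>2
      \<le> (1 - s) * (f x + \<delta> / 2 * (norm x)\<^sup>2) + s * (f z + \<delta> / 2 * (norm z)\<^sup>2)"
    using convex_onD[OF cv assms(4,5,2,3)] .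
  moreover have "\<delta> / 2 * (s * (1 - s) * (norm (z - x))\<^sup>2)
      = (1 - s) * (\<delta> / 2 * (norm x)\<^sup>2) + s * (\<delta> / 2 * (norm z)\<^sup>2)
        - \<delta> / 2 * (norm ((1 - s) *\<^sub>R x + s *\<^sub>R z))\<^sup>2"
    unfolding norm_sq_convex_combination[symmetric] by (simp add: field_simps)
  ultimately show ?thesis
    unfolding e by (simp only: distrib_left)
qed

text \<open>
The common core of all first-order inequalities below.  Dividing the chord inequality
by the step length and letting the step tend to zero turns a lower bound for the slope at
\<open>x\<close> in the direction of \<open>z\<close> into a bound for the value at \<open>z\<close>.  The modulus \<open>\<delta>\<close> may have either sign,
so that weakly convex and (negated) strongly concave functions are both covered.
\<close>

lemma directional_lower_bound:
  fixes f :: "'a::real_inner \<Rightarrow> real"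
  assumes cv: "convex_on S (\<lambda>x. f x + \<delta> / 2 * (norm x)\<^sup>2)" and "x \<in> S" "z \<in> S"
    and slope: "\<And>e. e > 0 \<Longrightarrow> \<forall>\<^sub>F s in at_right 0. f (x + s *\<^sub>R (z - x)) \<ge> f x + s * (c - e)"
  shows "f z \<ge> f x + c - \<delta> / 2 * (norm (z - x))\<^sup>2"
proof -
  have bound: "c \<le> f z - f x + \<delta> / 2 * (norm (z - x))\<^sup>2 + e" if e: "e > 0" for e
  proof -
    have "\<forall>\<^sub>F s in at_right 0. c - e \<le> f z - f x + \<delta> / 2 * ((1 - s) * (norm (z - x))\<^sup>2)"
      using slope[OF e] eventually_at_right_less[of 0]
        eventually_at_right_real[of 0 "1::real", simplified]
    proof eventually_elim
      case (elim s)
      then have s: "0 < s" "s < 1" by auto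
      have "f x + s * (c - e) \<le> (1 - s) * f x + s * f z + \<delta> / 2 * (s * (1 - s) * (norm (z - x))\<^sup>2)"
        using convex_on_chord[OF assms(1-3), of s] elim s by linarith
      then have "s * (c - e) \<le> s * (f z - f x + \<delta> / 2 * ((1 - s) * (norm (z - x))\<^sup>2))"
        by (simp add: algebra_simps)
      then show ?case using s by simp
    qed
    moreover have "((\<lambda>s. f z - f x + \<delta> / 2 * ((1 - s) * (norm (z - x))\<^sup>2)) \<longlongrightarrow>
        f z - f x + \<delta> / 2 * ((1 - 0) * (norm (z - x))\<^sup>2)) (at_right 0)"
      by (intro tendsto_intros)
    ultimately have "c - e \<le> f z - f x + \<delta> / 2 * ((1 - 0) * (norm (z - x))\<^sup>2)"
      by (intro tendsto_lowerbound) auto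
    then show ?thesis by simp
  qed
  have "c \<le> f z - f x + \<delta> / 2 * (norm (z - x))\<^sup>2"
    by (rule field_le_epsilon) (use bound in simp)
  then show ?thesis by simp
qed

lemma subgradient_inequality:
  fixes f :: "'a::real_inner \<Rightarrow> real"
  assumes cv: "convex_on S (\<lambda>x. f x + \<delta> / 2 * (norm x)\<^sup>2)" and "x \<in> S" "z \<in> S"
    and v: "v \<in> subdifferential f x"
  shows "f z \<ge> f x + v \<bullet> (z - x) - \<delta> / 2 * (norm (z - x))\<^sup>2"
proof (cases "z = x")
  case False
  obtain r where r: "r \<in> o[at x](\<lambda>y. norm (y - x))"
    and ge: "\<forall>\<^sub>F y in at x. f y \<ge> f x + v \<bullet> (y - x) + r y"
    using v unfolding subdifferential_def by blast
  show ?thesis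
  proof (rule directional_lower_bound[OF assms(1-3)])
    fix e :: real assume e: "e > 0"
    let ?e = "e / norm (z - x)"
    have "\<forall>\<^sub>F y in at x. norm (r y) \<le> ?e * norm (norm (y - x))"
      using landau_o.smallD[OF r, of ?e] e False by simp
    with ge have ev: "\<forall>\<^sub>F y in at x. f y \<ge> f x + v \<bullet> (y - x) - ?e * norm (y - x)"
      by eventually_elim (auto simp: abs_le_iff)
    have "filterlim (\<lambda>s. x + s *\<^sub>R (z - x)) (at x) (at_right 0)"
    proof (rule filterlim_atI)
      have "((\<lambda>s. x + s *\<^sub>R (z - x)) \<longlongrightarrow> x + 0 *\<^sub>R (z - x)) (at_right 0)"
        by (intro tendsto_intros)
      then show "((\<lambda>s. x + s *\<^sub>R (z - x)) \<longlongrightarrow> x) (at_right 0)" by simp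
      show "\<forall>\<^sub>F s in at_right 0. x + s *\<^sub>R (z - x) \<noteq> x"
        using eventually_at_right_less[of 0] by eventually_elim (use False in auto)
    qed
    then have "\<forall>\<^sub>F s in at_right 0. f (x + s *\<^sub>R (z - x)) \<ge> f x + v \<bullet> (s *\<^sub>R (z - x)) - ?e * norm (s *\<^sub>R (z - x))"
      using ev by (auto simp: filterlim_iff)
    then show "\<forall>\<^sub>F s in at_right 0. f (x + s *\<^sub>R (z - x)) \<ge> f x + s * (v \<bullet> (z - x) - e)"
      using eventually_at_right_less[of 0]
    proof eventually_elim
      case (elim s)
      have "?e * norm (s *\<^sub>R (z - x)) = s * e" using elim(2) False by simp
      with elim(1) show ?case by (simp add: right_diff_distrib)
    qed
  qed
qed simp

text \<open>
At a minimizer over a convex set the slope is nonnegative in every feasible direction.  There need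
not be any gradient or subgradient that vanishes, as the minimizer may lie on the boundary.
\<close>

lemma constrained_minimum_growth:
  fixes f :: "'a::real_inner \<Rightarrow> real"
  assumes cv: "convex_on S (\<lambda>x. f x + \<delta> / 2 * (norm x)\<^sup>2)" and "x \<in> S" "z \<in> S"
    and min: "\<And>y. y \<in> S \<Longrightarrow> f x \<le> f y"
  shows "f z \<ge> f x - \<delta> / 2 * (norm (z - x))\<^sup>2"
proof -
  have "f z \<ge> f x + 0 - \<delta> / 2 * (norm (z - x))\<^sup>2"
  proof (rule directional_lower_bound[OF assms(1-3)])
    fix e :: real assume e: "e > 0"
    show "\<forall>\<^sub>F s in at_right 0. f (x + s *\<^sub>R (z - x)) \<ge> f x + s * (0 - e)"
      using eventually_at_right_real[of 0 "1::real", simplified]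
    proof eventually_elim
      case (elim s)
      have "(1 - s) *\<^sub>R x + s *\<^sub>R z \<in> S"
        using elim assms(2,3) convex_on_imp_convex[OF cv] by (intro convexD_alt) auto
      then have "f x \<le> f (x + s *\<^sub>R (z - x))"
        by (intro min) (simp add: algebra_simps)
      moreover have "s * (0 - e) \<le> 0" using elim e by (simp add: mult_nonneg_nonpos)
      ultimately show ?case by linarith
    qed
  qed
  then show ?thesis by simp
qed

text \<open>
The coordinates of the gradient are the values of the derivative on the basis vectors; uniqueness of
the derivative then determines the definite description.
\<close>

lemma gradient_GDERIV:
  fixes f :: "'a::euclidean_space \<Rightarrow> real"
  assumes "f differentiable (at x)"
  shows "GDERIV f x :> gradient f x"
proof -
  obtain f' where f': "(f has_derivative f') (at x)"
    using assms unfolding differentiable_def by blast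
  define D where "D = (\<Sum>b\<in>Basis. f' b *\<^sub>R b)"
  have lin: "linear f'" using f' by (rule has_derivative_linear)
  have "f' h = h \<bullet> D" for h
  proof -
    have "f' h = f' (\<Sum>b\<in>Basis. (h \<bullet> b) *\<^sub>R b)" by (simp add: euclidean_representation)
    also have "\<dots> = (\<Sum>b\<in>Basis. (h \<bullet> b) * f' b)"
      by (simp add: linear_sum[OF lin] linear_scale[OF lin])
    also have "\<dots> = h \<bullet> D" by (simp add: D_def inner_sum_right mult.commute)
    finally show ?thesis .
  qed
  then have "f' = (\<lambda>h. h \<bullet> D)" by (rule ext)
  with f' have D: "GDERIV f x :> D" unfolding gderiv_def by simp
  moreover have "D' = D" if "GDERIV f x :> D'" for D'
  proof -
    have "(\<lambda>h. h \<bullet> D') = (\<lambda>h. h \<bullet> D)"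
      using that D unfolding gderiv_def by (rule has_derivative_unique)
    then show ?thesis by (metis vector_eq_ldot)
  qed
  ultimately show ?thesis unfolding gradient_def by (rule theI)
qed

lemma GDERIV_imp_gradient:
  fixes f :: "'a::euclidean_space \<Rightarrow> real"
  assumes "GDERIV f x :> D"
  shows "gradient f x = D"
proof -
  have "GDERIV f x :> gradient f x"
    using assms by (intro gradient_GDERIV) (auto simp: gderiv_def differentiable_def)
  then have "(\<lambda>h. h \<bullet> gradient f x) = (\<lambda>h. h \<bullet> D)"
    using assms unfolding gderiv_def by (rule has_derivative_unique)
  then show ?thesis by (metis vector_eq_ldot)
qed

lemma GDERIV_imp_subgradient:
  fixes f :: "'a::real_inner \<Rightarrow> real"
  assumes "GDERIV f x :> D"
  shows "D \<in> subdifferential f x"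
proof -
  have "((\<lambda>y. norm (f y - f x - (y - x) \<bullet> D) / norm (y - x)) \<longlongrightarrow> 0) (at x)"
    using assms unfolding gderiv_def has_derivative_iff_norm by blast
  then have "((\<lambda>y. norm ((f y - f x - (y - x) \<bullet> D) / norm (y - x))) \<longlongrightarrow> 0) (at x)"
    by simp
  then have "((\<lambda>y. (f y - f x - (y - x) \<bullet> D) / norm (y - x)) \<longlongrightarrow> 0) (at x)"
    by (rule tendsto_norm_zero_cancel)
  then have "(\<lambda>y. f y - f x - (y - x) \<bullet> D) \<in> o[at x](\<lambda>y. norm (y - x))"
    by (rule smalloI_tendsto) (auto simp: eventually_at_filter)
  then show ?thesis
    unfolding subdifferential_def by (auto simp: inner_commute intro!: exI always_eventually)
qed

lemma strongly_concave_gradient_inequality: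
  fixes f :: "'a::euclidean_space \<Rightarrow> real"
  assumes "strongly_concave_on \<mu> S f" "y \<in> S" "z \<in> S" "f differentiable (at y)"
  shows "f z \<le> f y + gradient f y \<bullet> (z - y) - \<mu> / 2 * (norm (z - y))\<^sup>2"
proof -
  have cv: "convex_on S (\<lambda>y. - f y + - \<mu> / 2 * (norm y)\<^sup>2)"
    using assms(1) unfolding strongly_concave_on_def concave_on_def by simp
  have "- gradient f y \<in> subdifferential (\<lambda>y. - f y) y"
    by (intro GDERIV_imp_subgradient GDERIV_minus gradient_GDERIV assms)
  from subgradient_inequality[OF cv assms(2,3) this] show ?thesis by simp
qed

lemma strongly_concave_maximum_growth:
  fixes f :: "'a::real_inner \<Rightarrow> real"
  assumes "strongly_concave_on \<mu> S f" "y \<in> S" "z \<in> S" "\<And>u. u \<in> S \<Longrightarrow> f u \<le> f y"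
  shows "f z \<le> f y - \<mu> / 2 * (norm (z - y))\<^sup>2"
proof -
  have cv: "convex_on S (\<lambda>y. - f y + - \<mu> / 2 * (norm y)\<^sup>2)"
    using assms(1) unfolding strongly_concave_on_def concave_on_def by simp
  from constrained_minimum_growth[OF cv assms(2,3)] assms(4) show ?thesis by simp
qed

text \<open>
The subgradient inequality gives the Lipschitz estimate up to an error quadratic in the distance.
Splitting the segment into \<open>n\<close> equal pieces reduces the total error by the factor \<open>n\<close>.
\<close>

lemma weakly_convex_bounded_subgradients_lipschitz:
  fixes f :: "'a::real_inner \<Rightarrow> real"
  assumes wc: "weakly_convex \<delta> f"
    and sub: "\<And>x. \<exists>v\<in>subdifferential f x. norm v \<le> M"
  shows "\<bar>f z - f x\<bar> \<le> M * norm (z - x)"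
proof -
  have step: "f z \<ge> f x - M * norm (z - x) - \<bar>\<delta>\<bar> / 2 * (norm (z - x))\<^sup>2" for x z
  proof -
    obtain v where v: "v \<in> subdifferential f x" "norm v \<le> M" using sub by blast
    have "\<bar>v \<bullet> (z - x)\<bar> \<le> norm v * norm (z - x)" by (rule Cauchy_Schwarz_ineq2)
    also have "\<dots> \<le> M * norm (z - x)" using v(2) by (rule mult_right_mono) simp
    finally have "v \<bullet> (z - x) \<ge> - (M * norm (z - x))" by linarith
    moreover have "\<delta> / 2 * (norm (z - x))\<^sup>2 \<le> \<bar>\<delta>\<bar> / 2 * (norm (z - x))\<^sup>2"
      by (intro mult_right_mono) auto
    ultimately show ?thesis
      using subgradient_inequality[OF wc[unfolded weakly_convex_def] _ _ v(1), of z] by simp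
  qed
  have one_sided: "f z \<ge> f x - M * norm (z - x)" for x z
  proof -
    let ?d = "norm (z - x)"
    have pieces: "f z \<ge> f x - M * ?d - (\<bar>\<delta>\<bar> / 2 * ?d\<^sup>2) / real (Suc n)" for n
    proof -
      define N where "N = real (Suc n)"
      have N: "N > 0" by (simp add: N_def)
      have "f (x + (real k / N) *\<^sub>R (z - x)) \<ge> f x - real k * (M * (?d / N) + \<bar>\<delta>\<bar> / 2 * (?d / N)\<^sup>2)" for k
      proof (induction k)
        case (Suc k)
        have eq: "x + (real (Suc k) / N) *\<^sub>R (z - x) - (x + (real k / N) *\<^sub>R (z - x)) = (1 / N) *\<^sub>R (z - x)"
          by (simp add: add_divide_distrib algebra_simps)
        have "norm ((1 / N) *\<^sub>R (z - x)) = ?d / N" using N by simp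
        with step[of "x + (real k / N) *\<^sub>R (z - x)" "x + (real (Suc k) / N) *\<^sub>R (z - x)", unfolded eq] Suc
        have "f (x + (real (Suc k) / N) *\<^sub>R (z - x))
            \<ge> f x - real k * (M * (?d / N) + \<bar>\<delta>\<bar> / 2 * (?d / N)\<^sup>2) - M * (?d / N) - \<bar>\<delta>\<bar> / 2 * (?d / N)\<^sup>2"
          by (simp only:)
        moreover have "real (Suc k) * (M * (?d / N) + \<bar>\<delta>\<bar> / 2 * (?d / N)\<^sup>2)
            = real k * (M * (?d / N) + \<bar>\<delta>\<bar> / 2 * (?d / N)\<^sup>2) + (M * (?d / N) + \<bar>\<delta>\<bar> / 2 * (?d / N)\<^sup>2)"
          by (simp only: of_nat_Suc distrib_right mult_1_left add.commute)
        ultimately show ?case by linarith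
      qed simp
      from this[of "Suc n"] have "f z \<ge> f x - N * (M * (?d / N) + \<bar>\<delta>\<bar> / 2 * (?d / N)\<^sup>2)"
        using N unfolding N_def[symmetric] by simp
      also have "N * (M * (?d / N) + \<bar>\<delta>\<bar> / 2 * (?d / N)\<^sup>2) = M * ?d + (\<bar>\<delta>\<bar> / 2 * ?d\<^sup>2) / N"
        using N by (simp add: field_simps power2_eq_square)
      finally show ?thesis unfolding N_def by simp
    qed
    have "(\<lambda>n. f x - M * ?d - (\<bar>\<delta>\<bar> / 2 * ?d\<^sup>2) / real (Suc n)) \<longlonglongrightarrow> f x - M * ?d - 0"
      by (intro tendsto_intros LIMSEQ_Suc lim_const_over_n)
    then have "f x - M * ?d - 0 \<le> f z"
      by (rule LIMSEQ_le_const2) (use pieces in auto)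
    then show ?thesis by simp
  qed
  from one_sided[of x z] one_sided[of z x] show ?thesis by (simp add: norm_minus_commute)
qed

section \<open>Proximal points\<close>

lemma norm_sq_about:
  fixes u p x :: "'a::real_inner"
  shows "(norm (u - x))\<^sup>2 = (norm (p - x))\<^sup>2 + 2 * ((p - x) \<bullet> (u - p)) + (norm (u - p))\<^sup>2"
  unfolding power2_norm_eq_inner
  by (simp add: inner_diff_left inner_diff_right inner_commute)

text \<open>
Expanding the squares, the minimality of \<open>p\<close> is a subgradient inequality with error
\<open>- 1/(2\<gamma>) \<bar>u - p\<bar>\<^sup>2\<close>.
\<close>

lemma prox_point_subgradient:
  fixes f :: "'a::real_inner \<Rightarrow> real"
  assumes "\<gamma> > 0"
    and min: "\<And>u. f p + 1 / (2 * \<gamma>) * (norm (p - x))\<^sup>2 \<le> f u + 1 / (2 * \<gamma>) * (norm (u - x))\<^sup>2"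
  shows "(1 / \<gamma>) *\<^sub>R (x - p) \<in> subdifferential f p"
proof -
  let ?r = "\<lambda>u. - (1 / (2 * \<gamma>)) * (norm (u - p))\<^sup>2"
  have "((\<lambda>u. - (1 / (2 * \<gamma>)) * norm (u - p)) \<longlongrightarrow> - (1 / (2 * \<gamma>)) * norm (p - p)) (at p)"
    by (intro tendsto_intros)
  then have "((\<lambda>u. - (1 / (2 * \<gamma>)) * norm (u - p)) \<longlongrightarrow> 0) (at p)" by simp
  moreover have "\<forall>\<^sub>F u in at p. - (1 / (2 * \<gamma>)) * norm (u - p) = ?r u / norm (u - p)"
    by (auto simp: eventually_at_filter power2_eq_square)
  ultimately have "((\<lambda>u. ?r u / norm (u - p)) \<longlongrightarrow> 0) (at p)"
    by (rule Lim_transform_eventually)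
  then have "?r \<in> o[at p](\<lambda>u. norm (u - p))"
    by (rule smalloI_tendsto) (auto simp: eventually_at_filter)
  moreover have "f u \<ge> f p + ((1 / \<gamma>) *\<^sub>R (x - p)) \<bullet> (u - p) + ?r u" for u
  proof -
    have "1 / (2 * \<gamma>) * (norm (u - x))\<^sup>2 = 1 / (2 * \<gamma>) * (norm (p - x))\<^sup>2
        - ((1 / \<gamma>) *\<^sub>R (x - p)) \<bullet> (u - p) - ?r u"
      unfolding norm_sq_about[of u x p] using assms(1)
      by (simp add: field_simps inner_diff_left)
    then show ?thesis using min[of u] by linarith
  qed
  ultimately show ?thesis
    unfolding subdifferential_def by (blast intro: always_eventually)
qed

lemma prox_point_growth:
  fixes f :: "'a::real_inner \<Rightarrow> real"
  assumes "\<gamma> > 0" "weakly_convex \<delta> f"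
    and min: "\<And>u. f p + 1 / (2 * \<gamma>) * (norm (p - x))\<^sup>2 \<le> f u + 1 / (2 * \<gamma>) * (norm (u - x))\<^sup>2"
  shows "f u + 1 / (2 * \<gamma>) * (norm (u - x))\<^sup>2
      \<ge> f p + 1 / (2 * \<gamma>) * (norm (p - x))\<^sup>2 + (1 / \<gamma> - \<delta>) / 2 * (norm (u - p))\<^sup>2"
proof -
  have "f u \<ge> f p + ((1 / \<gamma>) *\<^sub>R (x - p)) \<bullet> (u - p) - \<delta> / 2 * (norm (u - p))\<^sup>2"
    using assms(2) unfolding weakly_convex_def
    by (rule subgradient_inequality) (auto intro: prox_point_subgradient[OF assms(1) min])
  moreover have "1 / (2 * \<gamma>) * (norm (u - x))\<^sup>2 = 1 / (2 * \<gamma>) * (norm (p - x))\<^sup>2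
        - ((1 / \<gamma>) *\<^sub>R (x - p)) \<bullet> (u - p) + (1 / \<gamma>) / 2 * (norm (u - p))\<^sup>2"
    unfolding norm_sq_about[of u x p] using assms(1)
    by (simp add: field_simps inner_diff_left)
  ultimately show ?thesis by (simp add: diff_divide_distrib left_diff_distrib)
qed

text \<open>
A Lipschitz function grows at most linearly and is dominated by the quadratic term outside
a ball of radius \<open>2 \<gamma> M\<close>, so that the minimum over this compact ball is global.
\<close>

lemma prox_minimizes:
  fixes f :: "'a::euclidean_space \<Rightarrow> real"
  assumes "\<gamma> > 0" "M \<ge> 0" and lip: "\<And>x z. \<bar>f z - f x\<bar> \<le> M * norm (z - x)"
  shows "f (prox \<gamma> f x) + 1 / (2 * \<gamma>) * (norm (prox \<gamma> f x - x))\<^sup>2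
       \<le> f u + 1 / (2 * \<gamma>) * (norm (u - x))\<^sup>2"
proof -
  define k where "k = (\<lambda>u. f u + 1 / (2 * \<gamma>) * (norm (u - x))\<^sup>2)"
  have "M-lipschitz_on UNIV f"
    using assms(2) lip by (intro lipschitz_onI) (auto simp: dist_norm)
  then have "continuous_on UNIV f" by (rule lipschitz_on_continuous_on)
  then have "continuous_on (cball x (2 * \<gamma> * M)) k"
    unfolding k_def by (intro continuous_intros) (auto intro: continuous_on_subset)
  then obtain p where p: "\<And>u. u \<in> cball x (2 * \<gamma> * M) \<Longrightarrow> k p \<le> k u"
    using continuous_attains_inf[OF compact_cball, of x "2 * \<gamma> * M" k] that assms(1,2)
    by (metis centre_in_cball empty_iff mult_nonneg_nonneg order_less_imp_le zero_le_numeral)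
  have le: "k p \<le> k u" for u
  proof (cases "u \<in> cball x (2 * \<gamma> * M)")
    case False
    then have far: "norm (u - x) > 2 * \<gamma> * M" by (simp add: dist_norm norm_minus_commute)
    have "M * norm (u - x) \<le> 1 / (2 * \<gamma>) * (norm (u - x))\<^sup>2"
    proof -
      have "2 * \<gamma> * M * norm (u - x) \<le> norm (u - x) * norm (u - x)"
        using far by (intro mult_right_mono) auto
      then show ?thesis using assms(1) by (simp add: field_simps power2_eq_square)
    qed
    then have "k x \<le> k u" using lip[of x u] by (simp add: k_def norm_minus_commute)
    moreover have "k p \<le> k x" using assms(1,2) by (intro p) auto
    ultimately show ?thesis by linarith
  qed (rule p)
  have "is_arg_min k (\<lambda>_. True) (prox \<gamma> f x)"
    unfolding prox_def k_def[symmetric] arg_min_def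
    by (rule someI[of _ p]) (auto simp: is_arg_min_def not_less le)
  then show ?thesis by (auto simp: is_arg_min_def not_less k_def)
qed

section \<open>Saddle points of strongly concave maxima\<close>

text \<open>
One of the two max-structured functions.  Everything in this locale is used once for
\<open>\<phi>\<close> and once for \<open>\<psi>\<close>.  The last assumption is what a stochastic subgradient estimator with second
moment at most \<open>M\<^sup>2\<close> implies.
\<close>

locale strongly_concave_max =
  fixes Y :: "'y::euclidean_space set" and \<phi> :: "'x::euclidean_space \<Rightarrow> 'y \<Rightarrow> real"
    and \<delta> \<mu> \<gamma> M :: real
  assumes Y: "convex Y" "compact Y" "Y \<noteq> {}"
    and constants: "0 < \<delta>" "0 < \<mu>" "0 < \<gamma>" "\<gamma> * \<delta> < 1" "0 < M"
    and wconvex: "v \<in> Y \<Longrightarrow> weakly_convex \<delta> (\<lambda>u. \<phi> u v)"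
    and sconcave: "strongly_concave_on \<mu> Y (\<phi> u)"
    and diff: "v \<in> Y \<Longrightarrow> \<phi> u differentiable (at v)"
    and subgr: "v \<in> Y \<Longrightarrow> \<exists>w\<in>subdifferential (\<lambda>u. \<phi> u v) u. norm w \<le> M"
begin

abbreviation "\<Phi> \<equiv> max_over Y \<phi>"
abbreviation "prx \<equiv> prox \<gamma> \<Phi>"
abbreviation "ymax \<equiv> argmax_over Y \<phi>"

lemma modulus_pos: "1 / \<gamma> - \<delta> > 0"
  using constants by (simp add: field_simps)

lemma lipschitz: "v \<in> Y \<Longrightarrow> \<bar>\<phi> u v - \<phi> u' v\<bar> \<le> M * norm (u - u')"
  using weakly_convex_bounded_subgradients_lipschitz[OF wconvex subgr] .

lemma ymax_in: "ymax u \<in> Y" and ymax_ge: "v \<in> Y \<Longrightarrow> \<phi> u v \<le> \<phi> u (ymax u)"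
proof -
  have "continuous_on Y (\<phi> u)"
    by (intro continuous_at_imp_continuous_on ballI differentiable_imp_continuous_within diff)
  then obtain p where p: "p \<in> Y" "\<And>v. v \<in> Y \<Longrightarrow> \<phi> u v \<le> \<phi> u p"
    using continuous_attains_sup[OF Y(2,3)] by blast
  then have "is_arg_max (\<phi> u) (\<lambda>v. v \<in> Y) p" by (auto simp: is_arg_max_def not_less)
  then have "is_arg_max (\<phi> u) (\<lambda>v. v \<in> Y) (ymax u)"
    unfolding argmax_over_def arg_max_def by (rule someI)
  then show "ymax u \<in> Y" "v \<in> Y \<Longrightarrow> \<phi> u v \<le> \<phi> u (ymax u)"
    by (auto simp: is_arg_max_def not_less)
qed

lemma max_eq: "\<Phi> u = \<phi> u (ymax u)"
  unfolding max_over_def by (rule cSup_eq_maximum) (auto simp: ymax_in ymax_ge)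

lemma max_ge: "v \<in> Y \<Longrightarrow> \<phi> u v \<le> \<Phi> u"
  unfolding max_eq by (rule ymax_ge)

lemma ymax_growth: "v \<in> Y \<Longrightarrow> \<phi> u v \<le> \<phi> u (ymax u) - \<mu> / 2 * (norm (v - ymax u))\<^sup>2"
  by (rule strongly_concave_maximum_growth[OF sconcave]) (auto simp: ymax_in ymax_ge)

lemma max_lipschitz: "\<bar>\<Phi> u - \<Phi> u'\<bar> \<le> M * norm (u - u')"
proof -
  have "\<Phi> u - \<Phi> u' \<le> M * norm (u - u')" for u u'
    using lipschitz[OF ymax_in, of u u u'] max_ge[OF ymax_in, of u' u] by (simp add: max_eq[of u])
  from this[of u u'] this[of u' u] show ?thesis by (simp add: norm_minus_commute)
qed

lemma prx_minimizes:
  "\<Phi> (prx x) + 1 / (2 * \<gamma>) * (norm (prx x - x))\<^sup>2 \<le> \<Phi> u + 1 / (2 * \<gamma>) * (norm (u - x))\<^sup>2"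
  by (rule prox_minimizes[OF _ _ max_lipschitz]) (use constants in auto)

lemma prx_subgradient: "(1 / \<gamma>) *\<^sub>R (x - prx x) \<in> subdifferential \<Phi> (prx x)"
  using constants(3) prx_minimizes by (rule prox_point_subgradient)

text \<open>
Comparing \<open>prx x\<close> with the points of the line through \<open>prx x\<close> and \<open>x\<close>: moving by a fraction \<open>s\<close>
costs at most \<open>M s\<close> times the distance in \<open>\<Phi>\<close> and gains, to first order, \<open>s\<close> times the squared distance
over \<open>\<gamma>\<close>.  Letting \<open>s\<close> tend to zero gives the sharp constant; comparing with \<open>x\<close> alone would lose a
factor \<open>2\<close>.
\<close>

lemma prx_distance: "norm (x - prx x) \<le> \<gamma> * M"
proof (rule field_le_mult_one_interval)
  fix r :: real assume r: "0 < r" "r < 1"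
  let ?d = "norm (x - prx x)"
  \<comment> \<open>With this \<open>s\<close>, dividing \<open>1 - (1 - s)\<^sup>2\<close> by \<open>2 s\<close> leaves exactly the factor \<open>r\<close>.\<close>
  define s where "s = 2 * (1 - r)"
  have s: "0 < s" using r by (simp add: s_def)
  let ?u = "prx x + s *\<^sub>R (x - prx x)"
  have "?u - x = (s - 1) *\<^sub>R (x - prx x)" by (simp add: algebra_simps)
  then have "(norm (?u - x))\<^sup>2 = (s - 1)\<^sup>2 * ?d\<^sup>2"
    by (simp add: power_mult_distrib)
  moreover have "\<Phi> ?u \<le> \<Phi> (prx x) + M * (s * ?d)"
    using max_lipschitz[of ?u "prx x"] s by simp
  ultimately have "1 / (2 * \<gamma>) * ?d\<^sup>2 \<le> M * (s * ?d) + 1 / (2 * \<gamma>) * ((s - 1)\<^sup>2 * ?d\<^sup>2)"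
    using prx_minimizes[of x ?u] by (simp add: norm_minus_commute)
  then have "?d\<^sup>2 \<le> 2 * \<gamma> * (M * (s * ?d)) + (s - 1)\<^sup>2 * ?d\<^sup>2"
    using constants(3) by (simp add: field_simps)
  then have "(2 * s * ?d) * (r * ?d) \<le> (2 * s * ?d) * (\<gamma> * M)"
    by (simp add: s_def power2_eq_square algebra_simps)
  then show "r * ?d \<le> \<gamma> * M"
    using s constants by (cases "?d = 0") simp_all
qed

text \<open>
Strong concavity bounds the squared distance of two maximizers by the loss of value, and the
Lipschitz bound in the first argument bounds this loss.
\<close>

lemma continuous_ymax: "continuous_on UNIV ymax"
proof -
  have le: "\<mu> / 2 * (norm (ymax u' - ymax u))\<^sup>2 \<le> 2 * M * norm (u' - u)" for u u'
    using ymax_growth[OF ymax_in[of u'], of u] ymax_ge[OF ymax_in[of u], of u']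
      lipschitz[OF ymax_in[of u], of u' u] lipschitz[OF ymax_in[of u'], of u' u]
    by (simp add: abs_le_iff)
  have "(ymax \<longlongrightarrow> ymax u) (at u)" for u
  proof -
    have "((\<lambda>u'. sqrt (4 * M * norm (u' - u) / \<mu>)) \<longlongrightarrow> sqrt (4 * M * norm (u - u) / \<mu>)) (at u)"
      using constants by (intro tendsto_intros) auto
    then have "((\<lambda>u'. sqrt (4 * M * norm (u' - u) / \<mu>)) \<longlongrightarrow> 0) (at u)" by simp
    moreover have "norm (ymax u' - ymax u) \<le> sqrt (4 * M * norm (u' - u) / \<mu>)" for u'
      using le[of u' u] constants by (intro real_le_rsqrt) (simp add: field_simps)
    ultimately show ?thesis
      by (metis (mono_tags, lifting) LIM_zero_cancel Lim_null_comparison always_eventually)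
  qed
  then show ?thesis by (simp add: continuous_on_def)
qed

lemma prox_objective_convex:
  assumes "v \<in> Y" "0 \<le> s" "s \<le> 1"
  shows "\<phi> (p + s *\<^sub>R (u - p)) v + 1 / (2 * \<gamma>) * (norm (p + s *\<^sub>R (u - p) - x))\<^sup>2
    \<le> (1 - s) * (\<phi> p v + 1 / (2 * \<gamma>) * (norm (p - x))\<^sup>2) + s * (\<phi> u v + 1 / (2 * \<gamma>) * (norm (u - x))\<^sup>2)"
proof -
  define c where "c = 1 / (2 * \<gamma>)"
  let ?d = "s * (1 - s) * (norm (u - p))\<^sup>2"
  have "\<phi> (p + s *\<^sub>R (u - p)) v \<le> (1 - s) * \<phi> p v + s * \<phi> u v + \<delta> / 2 * ?d"
    using wconvex[OF assms(1), unfolded weakly_convex_def] assms by (intro convex_on_chord) auto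
  moreover have "c * (norm (p + s *\<^sub>R (u - p) - x))\<^sup>2
      = (1 - s) * (c * (norm (p - x))\<^sup>2) + s * (c * (norm (u - x))\<^sup>2) - c * ?d"
  proof -
    have "(norm (p + s *\<^sub>R (u - p) - x))\<^sup>2 = (1 - s) * (norm (p - x))\<^sup>2 + s * (norm (u - x))\<^sup>2 - ?d"
    proof -
      have "p + s *\<^sub>R (u - p) - x = (1 - s) *\<^sub>R (p - x) + s *\<^sub>R (u - x)" by (simp add: algebra_simps)
      then show ?thesis using norm_sq_convex_combination[of s "p - x" "u - x"] by simp
    qed
    then show ?thesis
      by (simp only: right_diff_distrib distrib_left mult.left_commute[of c])
  qed
  moreover have "\<delta> / 2 * ?d \<le> c * ?d"
    unfolding c_def
  proof (rule mult_right_mono)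
    show "\<delta> / 2 \<le> 1 / (2 * \<gamma>)" using modulus_pos constants by (simp add: field_simps)
    show "0 \<le> ?d" using assms by (intro mult_nonneg_nonneg) auto
  qed
  ultimately show ?thesis unfolding c_def[symmetric] by (simp only: distrib_left)
qed

text \<open>
The minimax property of \<open>(prx x, ymax (prx x))\<close>.  Let \<open>u\<^sub>s\<close> move from \<open>prx x\<close> towards \<open>u\<close> and let
\<open>v\<^sub>s\<close> be the maximizer at \<open>u\<^sub>s\<close>.  Minimality of \<open>prx x\<close> for the maximum and convexity in the first
argument show that the value at \<open>(u, v\<^sub>s)\<close> is at least the saddle value; then \<open>v\<^sub>s\<close> converges to
\<open>ymax (prx x)\<close> by continuity.
\<close>

lemma saddle_point:
  "\<phi> u (ymax (prx x)) + 1 / (2 * \<gamma>) * (norm (u - x))\<^sup>2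
    \<ge> \<phi> (prx x) (ymax (prx x)) + 1 / (2 * \<gamma>) * (norm (prx x - x))\<^sup>2"
proof -
  let ?p = "prx x"
  let ?us = "\<lambda>s. ?p + s *\<^sub>R (u - ?p)"
  let ?q = "\<lambda>u. 1 / (2 * \<gamma>) * (norm (u - x))\<^sup>2"
  have "\<forall>\<^sub>F s in at_right 0. \<phi> ?p (ymax ?p) + ?q ?p \<le> \<phi> u (ymax (?us s)) + ?q u"
    using eventually_at_right_real[of 0 "1::real", simplified]
  proof eventually_elim
    case (elim s)
    let ?v = "ymax (?us s)"
    have "\<phi> ?p (ymax ?p) + ?q ?p \<le> \<phi> (?us s) ?v + ?q (?us s)"
      using prx_minimizes[of x "?us s"] by (simp add: max_eq)
    also have "\<dots> \<le> (1 - s) * (\<phi> ?p ?v + ?q ?p) + s * (\<phi> u ?v + ?q u)"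
      using elim by (intro prox_objective_convex ymax_in) auto
    also have "\<dots> \<le> (1 - s) * (\<phi> ?p (ymax ?p) + ?q ?p) + s * (\<phi> u ?v + ?q u)"
      using elim by (intro add_mono mult_left_mono order_refl ymax_ge ymax_in) auto
    finally have *: "\<phi> ?p (ymax ?p) + ?q ?p \<le> (1 - s) * (\<phi> ?p (ymax ?p) + ?q ?p) + s * (\<phi> u ?v + ?q u)" .
    have "s * k \<le> s * m" if "k \<le> (1 - s) * k + s * m" for k m
      using that by (simp add: algebra_simps)
    from this[OF *] have "s * (\<phi> ?p (ymax ?p) + ?q ?p) \<le> s * (\<phi> u ?v + ?q u)" .
    then show ?case using elim by simp
  qed
  moreover have "((\<lambda>s. \<phi> u (ymax (?us s)) + ?q u) \<longlongrightarrow> \<phi> u (ymax ?p) + ?q u) (at_right 0)"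
  proof (intro tendsto_add tendsto_const)
    have "isCont (\<phi> u) (ymax ?p)"
      using differentiable_imp_continuous_within[OF diff[OF ymax_in]] by simp
    moreover have "isCont ymax ?p" 
      using continuous_ymax by (simp add: continuous_on_eq_continuous_at)
    moreover have "((\<lambda>s. ?us s) \<longlongrightarrow> ?p + 0 *\<^sub>R (u - ?p)) (at_right 0)"
      by (intro tendsto_intros)
    ultimately show "((\<lambda>s. \<phi> u (ymax (?us s))) \<longlongrightarrow> \<phi> u (ymax ?p)) (at_right 0)"
      by (intro isCont_tendsto_compose[of _ "\<phi> u"] isCont_tendsto_compose[of _ ymax]) auto
  qed
  ultimately show ?thesis
    by (intro tendsto_lowerbound) auto
qed

lemma saddle_point_growth:
  "\<phi> u (ymax (prx x)) + 1 / (2 * \<gamma>) * (norm (u - x))\<^sup>2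
    \<ge> \<phi> (prx x) (ymax (prx x)) + 1 / (2 * \<gamma>) * (norm (prx x - x))\<^sup>2
      + (1 / \<gamma> - \<delta>) / 2 * (norm (u - prx x))\<^sup>2"
  using constants(3) wconvex[OF ymax_in] saddle_point by (rule prox_point_growth)

text \<open>
Adding the four growth inequalities of the two saddle points, each tested at the components of the
other one: all values of \<open>\<phi>\<close> cancel.
\<close>

lemma saddle_map_monotone:
  fixes x x' :: 'x
  defines "p \<equiv> prx x" and "p' \<equiv> prx x'"
  shows "(1 / \<gamma> - \<delta>) * (norm (p' - p))\<^sup>2 + \<mu> * (norm (ymax p' - ymax p))\<^sup>2
    \<le> 1 / \<gamma> * ((p' - p) \<bullet> (x' - x))"
proof -
  let ?N = "(norm (p' - p))\<^sup>2" and ?B = "(norm (ymax p' - ymax p))\<^sup>2"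
  define c where "c = 1 / (2 * \<gamma>)"
  have "2 * ((p' - p) \<bullet> (x' - x)) = (norm (p' - x))\<^sup>2 + (norm (p - x'))\<^sup>2 - (norm (p - x))\<^sup>2 - (norm (p' - x'))\<^sup>2"
    unfolding power2_norm_eq_inner
    by (simp add: inner_diff_left inner_diff_right inner_commute)
  from arg_cong[OF this, of "(*) c"]
  have "2 * c * ((p' - p) \<bullet> (x' - x)) = c * (norm (p' - x))\<^sup>2 + c * (norm (p - x'))\<^sup>2
      - c * (norm (p - x))\<^sup>2 - c * (norm (p' - x'))\<^sup>2"
    by (simp only: right_diff_distrib distrib_left mult.assoc mult.left_commute[of c 2])
  moreover have "\<phi> p' (ymax p) + c * (norm (p' - x))\<^sup>2
      \<ge> \<phi> p (ymax p) + c * (norm (p - x))\<^sup>2 + (1 / \<gamma> - \<delta>) / 2 * ?N"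
    using saddle_point_growth[of x p', folded p_def] by (simp only: c_def)
  moreover have "\<phi> p (ymax p') + c * (norm (p - x'))\<^sup>2
      \<ge> \<phi> p' (ymax p') + c * (norm (p' - x'))\<^sup>2 + (1 / \<gamma> - \<delta>) / 2 * ?N"
    using saddle_point_growth[of x' p, folded p'_def] by (simp only: c_def norm_minus_commute[of p p'])
  moreover have "\<phi> p (ymax p') \<le> \<phi> p (ymax p) - \<mu> / 2 * ?B"
    by (rule ymax_growth[OF ymax_in])
  moreover have "\<phi> p' (ymax p) \<le> \<phi> p' (ymax p') - \<mu> / 2 * ?B"
    using ymax_growth[OF ymax_in, of p' p] by (simp only: norm_minus_commute[of "ymax p"])
  moreover have "1 / \<gamma> = 2 * c" using constants by (simp add: c_def)
  ultimately show ?thesis by (simp only:)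
qed

lemma prx_lipschitz: "(1 / \<gamma> - \<delta>) * norm (prx x' - prx x) \<le> 1 / \<gamma> * norm (x' - x)"
proof (cases "prx x' = prx x")
  case False
  let ?d = "norm (prx x' - prx x)"
  have "(1 / \<gamma> - \<delta>) * ?d\<^sup>2 \<le> 1 / \<gamma> * ((prx x' - prx x) \<bullet> (x' - x))"
    using saddle_map_monotone[of x' x] constants
    by (smt (verit) mult_nonneg_nonneg zero_le_power2)
  also have "\<dots> \<le> 1 / \<gamma> * (?d * norm (x' - x))"
    using constants by (intro mult_left_mono norm_cauchy_schwarz) auto
  finally have "?d * ((1 / \<gamma> - \<delta>) * ?d) \<le> ?d * (1 / \<gamma> * norm (x' - x))"
    by (simp add: power2_eq_square algebra_simps)
  moreover have "?d > 0" using False by simp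
  ultimately show ?thesis by (simp only: mult_le_cancel_left_pos)
next
  case True
  then show ?thesis using constants by simp
qed

text \<open>
By \<open>saddle_map_monotone\<close>, the left-hand side is at most \<open>(a d - 3 \<alpha> a\<^sup>2) / \<alpha>\<close>, where \<open>a\<close> is the displacement
of the proximal point and \<open>d\<close> that of the centre over \<open>\<gamma>\<close>.  The constant \<open>12\<close> comes from maximizing over \<open>a\<close>.
\<close>

lemma saddle_map_drift:
  assumes "0 < \<alpha>" "4 * \<alpha> \<le> 1 / \<gamma> - \<delta>" "\<alpha> \<le> \<mu>"
  shows "(norm (prx x' - prx x))\<^sup>2 + (norm (ymax (prx x') - ymax (prx x)))\<^sup>2
    \<le> (norm (x' - x))\<^sup>2 / (12 * \<alpha>\<^sup>2 * \<gamma>\<^sup>2)"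
proof -
  let ?a = "norm (prx x' - prx x)" and ?b = "norm (ymax (prx x') - ymax (prx x))"
  let ?d = "norm (x' - x) / \<gamma>"
  have "4 * \<alpha> * ?a\<^sup>2 + \<alpha> * ?b\<^sup>2 \<le> (1 / \<gamma> - \<delta>) * ?a\<^sup>2 + \<mu> * ?b\<^sup>2"
    using assms by (intro add_mono mult_right_mono) auto
  also have "\<dots> \<le> 1 / \<gamma> * ((prx x' - prx x) \<bullet> (x' - x))"
    by (rule saddle_map_monotone)
  also have "\<dots> \<le> 1 / \<gamma> * (?a * norm (x' - x))"
    using constants by (intro mult_left_mono norm_cauchy_schwarz) auto
  finally have "4 * \<alpha> * ?a\<^sup>2 + \<alpha> * ?b\<^sup>2 \<le> ?a * ?d" by simp
  then have *: "12 * \<alpha> * (\<alpha> * (?a\<^sup>2 + ?b\<^sup>2)) \<le> 12 * \<alpha> * (?a * ?d - 3 * \<alpha> * ?a\<^sup>2)"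
    using assms(1) by (intro mult_left_mono) (auto simp: algebra_simps)
  have "0 \<le> (6 * \<alpha> * ?a - ?d)\<^sup>2" by simp
  then have "12 * \<alpha> * (?a * ?d - 3 * \<alpha> * ?a\<^sup>2) \<le> ?d\<^sup>2"
    by (simp add: power2_eq_square algebra_simps)
  with * have "12 * \<alpha>\<^sup>2 * (?a\<^sup>2 + ?b\<^sup>2) \<le> ?d\<^sup>2"
    by (simp add: power2_eq_square algebra_simps)
  then show ?thesis using assms(1) constants by (simp add: field_simps)
qed

lemma moreau_env_eq: "moreau_env \<gamma> \<Phi> x = \<Phi> (prx x) + 1 / (2 * \<gamma>) * (norm (prx x - x))\<^sup>2"
  unfolding moreau_env_def by (rule cInf_eq_minimum) (use prx_minimizes[of x] in auto)

lemma moreau_env_upper: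
  "moreau_env \<gamma> \<Phi> x' \<le> moreau_env \<gamma> \<Phi> x + ((1 / \<gamma>) *\<^sub>R (x - prx x)) \<bullet> (x' - x)
      + 1 / (2 * \<gamma>) * (norm (x' - x))\<^sup>2"
proof -
  have "1 / (2 * \<gamma>) * (norm (prx x - x'))\<^sup>2 = 1 / (2 * \<gamma>) * (norm (prx x - x))\<^sup>2
      + ((1 / \<gamma>) *\<^sub>R (x - prx x)) \<bullet> (x' - x) + 1 / (2 * \<gamma>) * (norm (x' - x))\<^sup>2"
    unfolding power2_norm_eq_inner using constants
    by (simp add: field_simps inner_diff_left inner_diff_right inner_commute)
  then show ?thesis using prx_minimizes[of x' "prx x"] by (simp add: moreau_env_eq)
qed

text \<open>
The upper bound at \<open>x'\<close> with the roles of the two points exchanged.  The change of the gradient is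
controlled by the Lipschitz continuity of the proximal map.
\<close>

lemma moreau_env_lower:
  "moreau_env \<gamma> \<Phi> x' \<ge> moreau_env \<gamma> \<Phi> x + ((1 / \<gamma>) *\<^sub>R (x - prx x)) \<bullet> (x' - x)
      - (1 / (\<gamma>\<^sup>2 * (1 / \<gamma> - \<delta>)) - 1 / (2 * \<gamma>)) * (norm (x' - x))\<^sup>2"
proof -
  let ?d = "x' - x"
  have "(1 / \<gamma>) * ((prx x' - prx x) \<bullet> ?d) \<le> (1 / \<gamma>) * (norm (prx x' - prx x) * norm ?d)"
    using constants by (intro mult_left_mono norm_cauchy_schwarz) auto
  also have "norm (prx x' - prx x) \<le> norm ?d / \<gamma> / (1 / \<gamma> - \<delta>)"
    using prx_lipschitz[of x' x] modulus_pos by (subst pos_le_divide_eq) (auto simp: mult.commute)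
  then have "(1 / \<gamma>) * (norm (prx x' - prx x) * norm ?d) \<le> (1 / \<gamma>) * (norm ?d / \<gamma> / (1 / \<gamma> - \<delta>) * norm ?d)"
    using constants by (intro mult_left_mono mult_right_mono) auto
  also have "\<dots> = 1 / (\<gamma>\<^sup>2 * (1 / \<gamma> - \<delta>)) * (norm ?d)\<^sup>2"
    by (simp add: power2_eq_square)
  finally have "(1 / \<gamma>) * ((prx x' - prx x) \<bullet> ?d) \<le> 1 / (\<gamma>\<^sup>2 * (1 / \<gamma> - \<delta>)) * (norm ?d)\<^sup>2" .
  moreover have "((1 / \<gamma>) *\<^sub>R (x' - prx x')) \<bullet> (x - x') = - (((1 / \<gamma>) *\<^sub>R (x - prx x)) \<bullet> ?d)
      - 1 / \<gamma> * (norm ?d)\<^sup>2 + (1 / \<gamma>) * ((prx x' - prx x) \<bullet> ?d)"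
    unfolding power2_norm_eq_inner
    by (simp add: algebra_simps inner_diff_left inner_diff_right inner_commute)
  moreover have "1 / \<gamma> * (norm ?d)\<^sup>2 = 2 * (1 / (2 * \<gamma>) * (norm ?d)\<^sup>2)" by simp
  moreover note moreau_env_upper[of x x']
  ultimately show ?thesis
    unfolding left_diff_distrib norm_minus_commute[of x x'] by linarith
qed

end

lemma quadratic_error_imp_GDERIV:
  fixes f :: "'a::real_inner \<Rightarrow> real"
  assumes "\<And>x'. \<bar>f x' - f x - D \<bullet> (x' - x)\<bar> \<le> K * (norm (x' - x))\<^sup>2"
  shows "GDERIV f x :> D"
  unfolding gderiv_def has_derivative_iff_norm
proof (intro conjI bounded_linear_inner_left)
  have "((\<lambda>y. K * norm (y - x)) \<longlongrightarrow> K * norm (x - x)) (at x)"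
    by (intro tendsto_intros)
  then have "((\<lambda>y. K * norm (y - x)) \<longlongrightarrow> 0) (at x)" by simp
  moreover have "\<forall>\<^sub>F y in at x. norm (norm (f y - f x - (y - x) \<bullet> D) / norm (y - x)) \<le> K * norm (y - x)"
    unfolding eventually_at_filter
  proof (intro always_eventually allI impI)
    fix y assume "y \<noteq> x"
    then show "norm (norm (f y - f x - (y - x) \<bullet> D) / norm (y - x)) \<le> K * norm (y - x)"
      using assms[of y] by (simp add: field_simps power2_eq_square inner_commute)
  qed
  ultimately show "((\<lambda>y. norm (f y - f x - (y - x) \<bullet> D) / norm (y - x)) \<longlongrightarrow> 0) (at x)"
    by (rule Lim_null_comparison[rotated])
qed

section \<open>Square integrable random vectors and conditional expectations\<close>

definition square_integrable :: "'w measure \<Rightarrow> ('w \<Rightarrow> 'a::euclidean_space) \<Rightarrow> bool" where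
  "square_integrable P X \<longleftrightarrow> X \<in> borel_measurable P \<and> integrable P (\<lambda>\<omega>. (norm (X \<omega>))\<^sup>2)"

lemma square_integrable_measurable:
  "square_integrable P X \<Longrightarrow> X \<in> borel_measurable P"
  by (simp add: square_integrable_def)

lemma square_integrable_norm_sq: "square_integrable P X \<Longrightarrow> integrable P (\<lambda>\<omega>. (norm (X \<omega>))\<^sup>2)"
  by (simp add: square_integrable_def)

lemma norm_add_sq_le: "(norm (a + b))\<^sup>2 \<le> 2 * (norm a)\<^sup>2 + 2 * (norm (b::'a::real_inner))\<^sup>2"
proof -
  have "0 \<le> (norm (a - b))\<^sup>2" by simp
  then show ?thesis
    unfolding power2_norm_eq_inner by (simp add: inner_simps inner_commute)
qed

lemma square_integrable_add:
  assumes "square_integrable P X" "square_integrable P Z"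
  shows "square_integrable P (\<lambda>\<omega>. X \<omega> + Z \<omega>)"
proof -
  note [measurable] = assms[THEN square_integrable_measurable]
  have "integrable P (\<lambda>\<omega>. 2 * (norm (X \<omega>))\<^sup>2 + 2 * (norm (Z \<omega>))\<^sup>2)"
    using assms by (simp add: square_integrable_norm_sq)
  then have "integrable P (\<lambda>\<omega>. (norm (X \<omega> + Z \<omega>))\<^sup>2)"
    by (rule Bochner_Integration.integrable_bound) (auto simp: norm_add_sq_le)
  then show ?thesis by (simp add: square_integrable_def)
qed

lemma square_integrable_scaleR:
  assumes "square_integrable P X" shows "square_integrable P (\<lambda>\<omega>. c *\<^sub>R X \<omega>)"
  using assms by (auto simp: square_integrable_def power_mult_distrib)

lemma square_integrable_diff:
  assumes "square_integrable P X" "square_integrable P Z"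
  shows "square_integrable P (\<lambda>\<omega>. X \<omega> - Z \<omega>)"
  using square_integrable_add[OF assms(1) square_integrable_scaleR[OF assms(2), of "-1"]] by simp

lemma square_integrable_cong:
  assumes "square_integrable P X" "\<And>\<omega>. \<omega> \<in> space P \<Longrightarrow> Z \<omega> = X \<omega>"
  shows "square_integrable P Z"
proof -
  have "Z \<in> borel_measurable P \<longleftrightarrow> X \<in> borel_measurable P"
    using assms(2) by (rule measurable_cong)
  moreover have "integrable P (\<lambda>\<omega>. (norm (Z \<omega>))\<^sup>2) \<longleftrightarrow> integrable P (\<lambda>\<omega>. (norm (X \<omega>))\<^sup>2)"
    using assms(2) by (intro Bochner_Integration.integrable_cong) auto
  ultimately show ?thesis using assms(1) by (simp add: square_integrable_def)
qed

lemma (in prob_space) square_integrable_const: "square_integrable M (\<lambda>\<omega>. c)"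
  by (simp add: square_integrable_def)

lemma (in prob_space) square_integrable_bounded:
  assumes [measurable]: "X \<in> borel_measurable M" and "\<And>\<omega>. \<omega> \<in> space M \<Longrightarrow> norm (X \<omega>) \<le> K"
  shows "square_integrable M X"
  unfolding square_integrable_def
proof
  show "integrable M (\<lambda>\<omega>. (norm (X \<omega>))\<^sup>2)"
    using assms(2) by (intro integrable_const_bound[of _ "K\<^sup>2"]) (auto intro!: AE_I2 power_mono)
qed simp

lemma square_integrable_inner:
  assumes "square_integrable P X" "square_integrable P Z"
  shows "integrable P (\<lambda>\<omega>. X \<omega> \<bullet> Z \<omega>)"
proof -
  note [measurable] = assms[THEN square_integrable_measurable]
  have le: "\<bar>a \<bullet> b\<bar> \<le> (norm a)\<^sup>2 + (norm b)\<^sup>2" for a b :: 'b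
  proof -
    have "\<bar>a \<bullet> b\<bar> \<le> norm a * norm b" by (rule Cauchy_Schwarz_ineq2)
    moreover have "0 \<le> (norm a - norm b)\<^sup>2" by simp
    moreover have "0 \<le> norm a * norm b" by simp
    ultimately show ?thesis by (simp add: power2_diff)
  qed
  have "integrable P (\<lambda>\<omega>. (norm (X \<omega>))\<^sup>2 + (norm (Z \<omega>))\<^sup>2)"
    using assms by (simp add: square_integrable_norm_sq)
  then show ?thesis
    by (rule Bochner_Integration.integrable_bound) (auto simp: le)
qed

lemma (in prob_space) integrable_square_integrable:
  assumes "square_integrable M X"
  shows "integrable M X"
proof -
  note [measurable] = assms[THEN square_integrable_measurable]
  have le: "norm a \<le> 1 + (norm a)\<^sup>2" for a :: 'b
  proof -
    have "0 \<le> (norm a - 1)\<^sup>2" by simp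
    then have "2 * norm a \<le> 1 + (norm a)\<^sup>2" by (simp add: power2_diff)
    then show ?thesis using norm_ge_zero[of a] by linarith
  qed
  have "integrable M (\<lambda>\<omega>. 1 + (norm (X \<omega>))\<^sup>2)"
    using assms by (simp add: square_integrable_norm_sq)
  then show ?thesis
  proof (rule Bochner_Integration.integrable_bound)
    show "AE \<omega> in M. norm (X \<omega>) \<le> norm (1 + (norm (X \<omega>))\<^sup>2)"
      by (intro AE_I2 order_trans[OF le]) simp
  qed measurable
qed

lemma (in prob_space) expectation_norm_sq_le:
  assumes "square_integrable M X"
  shows "(expectation (\<lambda>\<omega>. norm (X \<omega>)))\<^sup>2 \<le> expectation (\<lambda>\<omega>. (norm (X \<omega>))\<^sup>2)"
proof -
  have "variance (\<lambda>\<omega>. norm (X \<omega>)) = expectation (\<lambda>\<omega>. (norm (X \<omega>))\<^sup>2) - (expectation (\<lambda>\<omega>. norm (X \<omega>)))\<^sup>2"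
    using assms by (intro variance_eq integrable_norm integrable_square_integrable square_integrable_norm_sq)
  then show ?thesis using variance_positive[of "\<lambda>\<omega>. norm (X \<omega>)"] by linarith
qed

lemma unbiased_estimator_bound:
  assumes "prob_space P" "unbiased_estimator P (K\<^sup>2) S U" "0 \<le> K"
  shows "\<exists>w\<in>S. norm w \<le> K"
proof -
  interpret prob_space P by fact
  have sq: "square_integrable P U" and mean: "integral\<^sup>L P U \<in> S"
    and le: "expectation (\<lambda>\<omega>. (norm (U \<omega>))\<^sup>2) \<le> K\<^sup>2"
    using assms(2) by (auto simp: unbiased_estimator_def square_integrable_def)
  have "expectation (\<lambda>\<omega>. norm (U \<omega>)) \<le> K"
    by (rule power2_le_imp_le[OF order_trans[OF expectation_norm_sq_le[OF sq] le] assms(3)])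
  then have "norm (integral\<^sup>L P U) \<le> K"
    using integral_norm_bound[of P U] by linarith
  with mean show ?thesis by blast
qed

text \<open>
The tower property in each coordinate: this is how conditional unbiasedness
enters the recursion.
\<close>

lemma inner_vec_cond_exp:
  assumes "prob_space P" "subalgebra P F"
    and [measurable]: "W \<in> borel_measurable F"
    and W: "square_integrable P W" and U: "square_integrable P U"
  shows "integrable P (\<lambda>\<omega>. W \<omega> \<bullet> vec_cond_exp P F U \<omega>)"
    and "(\<integral>\<omega>. W \<omega> \<bullet> vec_cond_exp P F U \<omega> \<partial>P) = (\<integral>\<omega>. W \<omega> \<bullet> U \<omega> \<partial>P)"
proof -
  interpret prob_space P by fact
  interpret finite_measure_subalgebra P F
    by standard fact
  note [measurable] = square_integrable_measurable[OF U]
  have int: "integrable P (\<lambda>\<omega>. (W \<omega> \<bullet> b) * (U \<omega> \<bullet> b))" if "b \<in> Basis" for b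
  proof -
    have "square_integrable P (\<lambda>\<omega>. X \<omega> \<bullet> b)" if X: "square_integrable P X" for X :: "'a \<Rightarrow> 'b"
    proof -
      note [measurable] = square_integrable_measurable[OF X]
      have "(X \<omega> \<bullet> b)\<^sup>2 \<le> (norm (X \<omega>))\<^sup>2" for \<omega>
        using Basis_le_norm[OF \<open>b \<in> Basis\<close>, of "X \<omega>"] by (simp add: abs_le_square_iff[symmetric])
      then have "integrable P (\<lambda>\<omega>. (X \<omega> \<bullet> b)\<^sup>2)"
        by (intro Bochner_Integration.integrable_bound[OF square_integrable_norm_sq[OF X]]) auto
      then show ?thesis by (simp add: square_integrable_def)
    qed
    from square_integrable_inner[OF this[OF W] this[OF U]] show ?thesis by simp
  qed
  have eq: "W \<omega> \<bullet> vec_cond_exp P F U \<omega>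
      = (\<Sum>b\<in>Basis. (W \<omega> \<bullet> b) * real_cond_exp P F (\<lambda>\<omega>. U \<omega> \<bullet> b) \<omega>)" for \<omega>
    by (simp add: vec_cond_exp_def inner_sum_right mult.commute)
  show "integrable P (\<lambda>\<omega>. W \<omega> \<bullet> vec_cond_exp P F U \<omega>)"
    unfolding eq by (intro Bochner_Integration.integrable_sum real_cond_exp_intg(1) int) measurable
  have "(\<integral>\<omega>. W \<omega> \<bullet> vec_cond_exp P F U \<omega> \<partial>P)
      = (\<Sum>b\<in>Basis. \<integral>\<omega>. (W \<omega> \<bullet> b) * real_cond_exp P F (\<lambda>\<omega>. U \<omega> \<bullet> b) \<omega> \<partial>P)"
    unfolding eq by (intro Bochner_Integration.integral_sum real_cond_exp_intg(1) int) measurable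
  also have "\<dots> = (\<Sum>b\<in>Basis. \<integral>\<omega>. (W \<omega> \<bullet> b) * (U \<omega> \<bullet> b) \<partial>P)"
    by (intro sum.cong refl real_cond_exp_intg(2) int) measurable
  also have "\<dots> = (\<integral>\<omega>. (\<Sum>b\<in>Basis. (W \<omega> \<bullet> b) * (U \<omega> \<bullet> b)) \<partial>P)"
    by (intro Bochner_Integration.integral_sum[symmetric] int)
  also have "\<dots> = (\<integral>\<omega>. W \<omega> \<bullet> U \<omega> \<partial>P)"
    by (simp add: euclidean_inner[symmetric])
  finally show "(\<integral>\<omega>. W \<omega> \<bullet> vec_cond_exp P F U \<omega> \<partial>P) = (\<integral>\<omega>. W \<omega> \<bullet> U \<omega> \<partial>P)" .
qed

lemma cond_unbiased_estimator_second_moment: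
  assumes "prob_space P" "subalgebra P F" "cond_unbiased_estimator P F K S U"
  shows "square_integrable P U" "(\<integral>\<omega>. (norm (U \<omega>))\<^sup>2 \<partial>P) \<le> K"
proof -
  interpret prob_space P by fact
  interpret finite_measure_subalgebra P F by standard fact
  show sq: "square_integrable P U"
    using assms(3) by (auto simp: cond_unbiased_estimator_def square_integrable_def)
  have "expectation (real_cond_exp P F (\<lambda>\<omega>. (norm (U \<omega>))\<^sup>2)) \<le> K"
    using assms(3) by (intro integral_le_const real_cond_exp_int(1))
      (auto simp: cond_unbiased_estimator_def)
  then show "(\<integral>\<omega>. (norm (U \<omega>))\<^sup>2 \<partial>P) \<le> K"
    using real_cond_exp_int(2)[OF square_integrable_norm_sq[OF sq]] by simp
qed

section \<open>One stochastic gradient descent ascent step\<close>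

lemma young_sq:
  fixes a b :: "'a::real_inner"
  assumes "0 < c"
  shows "(norm (a + b))\<^sup>2 \<le> (1 + c) * (norm a)\<^sup>2 + (1 + 1 / c) * (norm b)\<^sup>2"
proof -
  have "2 * (a \<bullet> b) \<le> 2 * (norm a * norm b)" using norm_cauchy_schwarz[of a b] by simp
  also have "\<dots> \<le> c * (norm a)\<^sup>2 + 1 / c * (norm b)\<^sup>2"
  proof -
    have "0 \<le> (c * norm a - norm b)\<^sup>2 / c" using assms by simp
    also have "\<dots> = c * (norm a)\<^sup>2 - 2 * (norm a * norm b) + 1 / c * (norm b)\<^sup>2"
      using assms by (simp add: field_simps power2_eq_square)
    finally show ?thesis by simp
  qed
  finally show ?thesis
    unfolding power2_norm_eq_inner by (simp add: inner_simps inner_commute algebra_simps)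
qed

lemma norm_add_scaleR_sq:
  fixes a s :: "'a::real_inner"
  shows "(norm (a + c *\<^sub>R s))\<^sup>2 = (norm a)\<^sup>2 + 2 * c * (a \<bullet> s) + c\<^sup>2 * (norm s)\<^sup>2"
  unfolding power2_norm_eq_inner
  by (simp add: inner_add_left inner_add_right inner_commute[of s a] power2_eq_square algebra_simps)

context strongly_concave_max begin

text \<open>
Strong monotonicity of the subgradient/gradient field towards the saddle point.  It combines the
first-order inequalities at the current point with the growth inequalities at the saddle point.
\<close>

lemma saddle_operator_monotone:
  assumes v: "v \<in> Y" and w: "w \<in> subdifferential (\<lambda>u. \<phi> u v) p"
  shows "(p - prx c) \<bullet> (w + (1 / \<gamma>) *\<^sub>R (p - c)) - (v - ymax (prx c)) \<bullet> gradient (\<phi> p) v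
    \<ge> (1 / \<gamma> - \<delta>) * (norm (p - prx c))\<^sup>2 + \<mu> * (norm (v - ymax (prx c)))\<^sup>2"
proof -
  let ?X = "prx c" and ?V = "ymax (prx c)"
  define k where "k = 1 / (2 * \<gamma>)"
  have k: "1 / \<gamma> = 2 * k" by (simp add: k_def)
  define N where "N = (norm (p - ?X))\<^sup>2"
  define B where "B = (norm (v - ?V))\<^sup>2"
  have half: "(1 / \<gamma> - \<delta>) / 2 * N = k * N - \<delta> / 2 * N"
    unfolding k by (simp add: left_diff_distrib diff_divide_distrib)
  have full: "(1 / \<gamma> - \<delta>) * N = 2 * (k * N) - \<delta> * N"
    unfolding k by (simp add: left_diff_distrib)
  have "\<phi> ?X v \<ge> \<phi> p v + w \<bullet> (?X - p) - \<delta> / 2 * N"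
    using subgradient_inequality[OF wconvex[OF v, unfolded weakly_convex_def] _ _ w, of ?X]
    by (simp add: N_def norm_minus_commute)
  moreover have "\<phi> p ?V \<le> \<phi> p v + gradient (\<phi> p) v \<bullet> (?V - v) - \<mu> / 2 * B"
    using strongly_concave_gradient_inequality[OF sconcave v ymax_in diff[OF v], of p ?X]
    by (simp add: B_def norm_minus_commute)
  moreover have "\<phi> p ?V + k * (norm (p - c))\<^sup>2 \<ge> \<phi> ?X ?V + k * (norm (?X - c))\<^sup>2 + (k * N - \<delta> / 2 * N)"
    using saddle_point_growth[of c p, folded k_def N_def] unfolding half .
  moreover have "\<phi> ?X v \<le> \<phi> ?X ?V - \<mu> / 2 * B"
    unfolding B_def by (rule ymax_growth[OF v])
  moreover have "k * (norm (?X - c))\<^sup>2 = k * (norm (p - c))\<^sup>2 + 2 * k * ((p - c) \<bullet> (?X - p)) + k * N"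
    unfolding norm_sq_about[of ?X c p] by (simp add: N_def norm_minus_commute algebra_simps)
  moreover have "(p - ?X) \<bullet> (w + (1 / \<gamma>) *\<^sub>R (p - c)) = - (w \<bullet> (?X - p)) - 2 * k * ((p - c) \<bullet> (?X - p))"
    unfolding k by (simp add: inner_simps inner_commute algebra_simps)
  moreover have "(v - ?V) \<bullet> gradient (\<phi> p) v = - (gradient (\<phi> p) v \<bullet> (?V - v))"
    by (simp add: inner_simps inner_commute)
  ultimately show ?thesis unfolding N_def[symmetric] B_def[symmetric] full by linarith
qed

lemma continuous_prx: "continuous_on UNIV prx"
proof -
  have "(1 / \<gamma> / (1 / \<gamma> - \<delta>))-lipschitz_on UNIV prx"
  proof (rule lipschitz_onI)
    fix x y
    have "norm (prx x - prx y) \<le> 1 / \<gamma> * norm (x - y) / (1 / \<gamma> - \<delta>)"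
      using prx_lipschitz[of x y] modulus_pos by (subst pos_le_divide_eq) (simp_all add: mult.commute)
    then show "dist (prx x) (prx y) \<le> 1 / \<gamma> / (1 / \<gamma> - \<delta>) * dist x y"
      by (simp add: dist_norm)
  qed (use modulus_pos constants in simp)
  then show ?thesis by (rule lipschitz_on_continuous_on)
qed

lemma prx_measurable: "X \<in> borel_measurable N \<Longrightarrow> (\<lambda>\<omega>. prx (X \<omega>)) \<in> borel_measurable N"
  by (rule borel_measurable_continuous_on[OF continuous_prx])

lemma ymax_measurable: "X \<in> borel_measurable N \<Longrightarrow> (\<lambda>\<omega>. ymax (X \<omega>)) \<in> borel_measurable N"
  by (rule borel_measurable_continuous_on[OF continuous_ymax])

lemma projection_measurable:
  "X \<in> borel_measurable N \<Longrightarrow> (\<lambda>\<omega>. closest_point Y (X \<omega>)) \<in> borel_measurable N"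
  using Y by (intro borel_measurable_continuous_on[OF continuous_on_closest_point])
    (auto intro: compact_imp_closed)

lemma square_integrable_prx:
  assumes "prob_space P" "square_integrable P X"
  shows "square_integrable P (\<lambda>\<omega>. prx (X \<omega>))"
proof -
  interpret prob_space P by fact
  note [measurable] = square_integrable_measurable[OF assms(2)] prx_measurable
  have "square_integrable P (\<lambda>\<omega>. X \<omega> - prx (X \<omega>))"
    by (rule square_integrable_bounded[OF _ prx_distance]) measurable
  from square_integrable_diff[OF assms(2) this] show ?thesis by simp
qed

lemma square_integrable_in_Y:
  assumes "prob_space P" "X \<in> borel_measurable P" "\<And>\<omega>. \<omega> \<in> space P \<Longrightarrow> X \<omega> \<in> Y"
  shows "square_integrable P X"
proof -
  interpret prob_space P by fact
  obtain K where "\<And>v. v \<in> Y \<Longrightarrow> norm v \<le> K"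
    using compact_imp_bounded[OF Y(2)] by (auto simp: bounded_iff)
  with assms show ?thesis by (intro square_integrable_bounded) auto
qed

lemma projection_in_Y: "closest_point Y v \<in> Y"
  using Y by (intro closest_point_in_set compact_imp_closed)

lemma projection_nonexpansive:
  assumes "v \<in> Y" shows "norm (closest_point Y u - v) \<le> norm (u - v)"
  using closest_point_lipschitz[OF Y(1) compact_imp_closed[OF Y(2)] Y(3), of u v] assms
  by (simp add: closest_point_self dist_norm)

text \<open>
Expanding the squares, the cross terms have the expectation of the inner products with the
conditional means, where \<open>saddle_operator_monotone\<close> applies.  In the quadratic term, the proximal
gradient \<open>(p - c)/\<gamma>\<close> splits into its value at the saddle point, of norm at most \<open>M\<close>, and the
deviation \<open>(p - prx c)/\<gamma>\<close>, which the bound on \<open>\<eta>\<close> absorbs into half of the contraction.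
\<close>

lemma gradient_step_expectation:
  assumes P: "prob_space P" and F: "subalgebra P F"
    and meas: "p \<in> borel_measurable F" "v \<in> borel_measurable F" "c \<in> borel_measurable F"
    and p: "square_integrable P p" and c: "square_integrable P c"
    and v: "\<And>\<omega>. \<omega> \<in> space P \<Longrightarrow> v \<omega> \<in> Y"
    and g: "cond_unbiased_estimator P F (M\<^sup>2) (\<lambda>\<omega>. subdifferential (\<lambda>u. \<phi> u (v \<omega>)) (p \<omega>)) g"
    and h: "cond_unbiased_estimator P F (M\<^sup>2) (\<lambda>\<omega>. {gradient (\<phi> (p \<omega>)) (v \<omega>)}) h"
    and \<eta>: "0 < \<eta>" "\<eta> \<le> \<gamma>\<^sup>2 * (1 / \<gamma> - \<delta>) / 2"
  shows "(\<integral>\<omega>. (norm (p \<omega> - \<eta> *\<^sub>R (g \<omega> + (1 / \<gamma>) *\<^sub>R (p \<omega> - c \<omega>)) - prx (c \<omega>)))\<^sup>2 \<partial>P)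
      + (\<integral>\<omega>. (norm (closest_point Y (v \<omega> + \<eta> *\<^sub>R h \<omega>) - ymax (prx (c \<omega>))))\<^sup>2 \<partial>P)
      \<le> (1 - \<eta> * (1 / \<gamma> - \<delta>)) * (\<integral>\<omega>. (norm (p \<omega> - prx (c \<omega>)))\<^sup>2 \<partial>P)
        + (1 - 2 * \<eta> * \<mu>) * (\<integral>\<omega>. (norm (v \<omega> - ymax (prx (c \<omega>))))\<^sup>2 \<partial>P) + 9 * \<eta>\<^sup>2 * M\<^sup>2"
proof -
  interpret prob_space P by fact
  define a where "a = (\<lambda>\<omega>. p \<omega> - prx (c \<omega>))"
  define b where "b = (\<lambda>\<omega>. v \<omega> - ymax (prx (c \<omega>)))"
  define n where "n = (\<lambda>\<omega>. (1 / \<gamma>) *\<^sub>R (p \<omega> - c \<omega>))"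
  define w where "w = vec_cond_exp P F g"
  define m where "m = vec_cond_exp P F h"
  have aF: "a \<in> borel_measurable F" and bF: "b \<in> borel_measurable F"
    unfolding a_def b_def using meas
    by (auto intro!: borel_measurable_diff prx_measurable ymax_measurable)
  note measP = measurable_from_subalg[OF F]
  have sqv: "square_integrable P v" using P measP[OF meas(2)] v by (rule square_integrable_in_Y)
  have sqa: "square_integrable P a"
    unfolding a_def by (intro square_integrable_diff square_integrable_prx p c P)
  have sqb: "square_integrable P b"
    unfolding b_def
    by (intro square_integrable_diff sqv square_integrable_in_Y P ymax_measurable prx_measurable
        measP[OF meas(3)] ymax_in)
  have sqn: "square_integrable P n"
    unfolding n_def by (intro square_integrable_scaleR square_integrable_diff p c)
  note sqg = cond_unbiased_estimator_second_moment[OF P F g]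
  note sqh = cond_unbiased_estimator_second_moment[OF P F h]
  have ag: "integrable P (\<lambda>\<omega>. a \<omega> \<bullet> w \<omega>)" "expectation (\<lambda>\<omega>. a \<omega> \<bullet> w \<omega>) = expectation (\<lambda>\<omega>. a \<omega> \<bullet> g \<omega>)"
    unfolding w_def using inner_vec_cond_exp[OF P F aF sqa sqg(1)] by auto
  have bh: "integrable P (\<lambda>\<omega>. b \<omega> \<bullet> m \<omega>)" "expectation (\<lambda>\<omega>. b \<omega> \<bullet> m \<omega>) = expectation (\<lambda>\<omega>. b \<omega> \<bullet> h \<omega>)"
    unfolding m_def using inner_vec_cond_exp[OF P F bF sqb sqh(1)] by auto
  note int = square_integrable_norm_sq[OF sqa] square_integrable_norm_sq[OF sqb]
    square_integrable_norm_sq[OF sqg(1)] square_integrable_norm_sq[OF sqh(1)]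
    square_integrable_inner[OF sqa sqg(1)] square_integrable_inner[OF sqb sqh(1)]
    square_integrable_inner[OF sqa sqn] ag(1) bh(1)

  have mono: "AE \<omega> in P. a \<omega> \<bullet> w \<omega> + a \<omega> \<bullet> n \<omega> - b \<omega> \<bullet> m \<omega>
      \<ge> (1 / \<gamma> - \<delta>) * (norm (a \<omega>))\<^sup>2 + \<mu> * (norm (b \<omega>))\<^sup>2"
  proof -
    have "AE \<omega> in P. w \<omega> \<in> subdifferential (\<lambda>u. \<phi> u (v \<omega>)) (p \<omega>)"
      "AE \<omega> in P. m \<omega> = gradient (\<phi> (p \<omega>)) (v \<omega>)"
      using g h unfolding cond_unbiased_estimator_def w_def m_def by auto
    then show ?thesis
      using AE_space
    proof eventually_elim
      case (elim \<omega>)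
      from saddle_operator_monotone[OF v[OF elim(3)] elim(1), of "c \<omega>"] elim(2)
      show ?case by (simp add: a_def b_def n_def inner_add_right)
    qed
  qed
  have gap: "(1 / \<gamma> - \<delta>) * expectation (\<lambda>\<omega>. (norm (a \<omega>))\<^sup>2) + \<mu> * expectation (\<lambda>\<omega>. (norm (b \<omega>))\<^sup>2)
      \<le> expectation (\<lambda>\<omega>. a \<omega> \<bullet> g \<omega>) + expectation (\<lambda>\<omega>. a \<omega> \<bullet> n \<omega>) - expectation (\<lambda>\<omega>. b \<omega> \<bullet> h \<omega>)"
  proof -
    have "expectation (\<lambda>\<omega>. (1 / \<gamma> - \<delta>) * (norm (a \<omega>))\<^sup>2 + \<mu> * (norm (b \<omega>))\<^sup>2)
        \<le> expectation (\<lambda>\<omega>. a \<omega> \<bullet> w \<omega> + a \<omega> \<bullet> n \<omega> - b \<omega> \<bullet> m \<omega>)"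
      using mono by (intro integral_mono_AE) (auto intro!: int Bochner_Integration.integrable_add
          Bochner_Integration.integrable_diff integrable_mult_right)
    then show ?thesis by (simp add: int ag(2) bh(2) del: inner_commute)
  qed

  define px where "px = (\<lambda>\<omega>. p \<omega> - \<eta> *\<^sub>R (g \<omega> + (1 / \<gamma>) *\<^sub>R (p \<omega> - c \<omega>)) - prx (c \<omega>))"
  define py where "py = (\<lambda>\<omega>. closest_point Y (v \<omega> + \<eta> *\<^sub>R h \<omega>) - ymax (prx (c \<omega>)))"
  have px_le: "(norm (px \<omega>))\<^sup>2 \<le> (1 + \<eta> * (1 / \<gamma> - \<delta>)) * (norm (a \<omega>))\<^sup>2 - 2 * \<eta> * (a \<omega> \<bullet> g \<omega>) - 2 * \<eta> * (a \<omega> \<bullet> n \<omega>)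
      + \<eta>\<^sup>2 * (4 * (norm (g \<omega>))\<^sup>2 + 4 * M\<^sup>2)" for \<omega>
  proof -
    let ?r = "- ((1 / \<gamma>) *\<^sub>R (c \<omega> - prx (c \<omega>)))"
    have "g \<omega> + n \<omega> = (g \<omega> + ?r) + (1 / \<gamma>) *\<^sub>R a \<omega>"
      by (simp add: a_def n_def algebra_simps)
    then have "(norm (g \<omega> + n \<omega>))\<^sup>2 \<le> 2 * (norm (g \<omega> + ?r))\<^sup>2 + 2 * (norm ((1 / \<gamma>) *\<^sub>R a \<omega>))\<^sup>2"
      by (simp only: norm_add_sq_le)
    moreover have "(norm (g \<omega> + ?r))\<^sup>2 \<le> 2 * (norm (g \<omega>))\<^sup>2 + 2 * (norm ?r)\<^sup>2"
      by (rule norm_add_sq_le)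
    moreover have "norm ?r \<le> M"
      using prx_distance[of "c \<omega>"] constants by (simp add: divide_le_eq mult.commute)
    then have "(norm ?r)\<^sup>2 \<le> M\<^sup>2" by (intro power_mono) auto
    moreover have "(norm ((1 / \<gamma>) *\<^sub>R a \<omega>))\<^sup>2 = 1 / \<gamma>\<^sup>2 * (norm (a \<omega>))\<^sup>2"
      by (simp add: power_mult_distrib power_divide)
    ultimately have "(norm (g \<omega> + n \<omega>))\<^sup>2 \<le> 4 * (norm (g \<omega>))\<^sup>2 + 4 * M\<^sup>2 + 2 * (1 / \<gamma>\<^sup>2) * (norm (a \<omega>))\<^sup>2"
      by linarith
    then have "\<eta>\<^sup>2 * (norm (g \<omega> + n \<omega>))\<^sup>2
        \<le> \<eta>\<^sup>2 * (4 * (norm (g \<omega>))\<^sup>2 + 4 * M\<^sup>2 + 2 * (1 / \<gamma>\<^sup>2) * (norm (a \<omega>))\<^sup>2)"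
      by (intro mult_left_mono) auto
    moreover have "\<eta>\<^sup>2 * (2 * (1 / \<gamma>\<^sup>2) * (norm (a \<omega>))\<^sup>2) \<le> \<eta> * (1 / \<gamma> - \<delta>) * (norm (a \<omega>))\<^sup>2"
    proof -
      have "\<eta> * (2 / \<gamma>\<^sup>2) \<le> 1 / \<gamma> - \<delta>"
        using \<eta>(2) constants by (simp add: divide_le_eq mult.commute)
      then have "\<eta> * (\<eta> * (2 / \<gamma>\<^sup>2)) * (norm (a \<omega>))\<^sup>2 \<le> \<eta> * (1 / \<gamma> - \<delta>) * (norm (a \<omega>))\<^sup>2"
        using \<eta>(1) by (intro mult_right_mono mult_left_mono) auto
      then show ?thesis by (simp add: power2_eq_square algebra_simps)
    qed
    moreover have "(norm (px \<omega>))\<^sup>2 = (norm (a \<omega>))\<^sup>2 - 2 * \<eta> * (a \<omega> \<bullet> g \<omega>) - 2 * \<eta> * (a \<omega> \<bullet> n \<omega>)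
        + \<eta>\<^sup>2 * (norm (g \<omega> + n \<omega>))\<^sup>2"
    proof -
      have "px \<omega> = a \<omega> - \<eta> *\<^sub>R (g \<omega> + n \<omega>)"
        by (simp add: px_def a_def n_def algebra_simps)
      then show ?thesis
        using norm_add_scaleR_sq[of "a \<omega>" "- \<eta>" "g \<omega> + n \<omega>"]
        by (simp add: inner_add_right distrib_left)
    qed
    ultimately show ?thesis by (simp only: distrib_left distrib_right mult_1_left)
  qed
  have py_le: "(norm (py \<omega>))\<^sup>2 \<le> (norm (b \<omega>))\<^sup>2 + 2 * \<eta> * (b \<omega> \<bullet> h \<omega>) + \<eta>\<^sup>2 * (norm (h \<omega>))\<^sup>2" for \<omega>
  proof -
    have "norm (py \<omega>) \<le> norm (v \<omega> + \<eta> *\<^sub>R h \<omega> - ymax (prx (c \<omega>)))"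
      unfolding py_def by (rule projection_nonexpansive[OF ymax_in])
    also have "v \<omega> + \<eta> *\<^sub>R h \<omega> - ymax (prx (c \<omega>)) = b \<omega> + \<eta> *\<^sub>R h \<omega>" by (simp add: b_def)
    finally have "(norm (py \<omega>))\<^sup>2 \<le> (norm (b \<omega> + \<eta> *\<^sub>R h \<omega>))\<^sup>2" by (intro power_mono) auto
    also have "\<dots> = (norm (b \<omega>))\<^sup>2 + 2 * \<eta> * (b \<omega> \<bullet> h \<omega>) + \<eta>\<^sup>2 * (norm (h \<omega>))\<^sup>2"
      by (rule norm_add_scaleR_sq)
    finally show ?thesis .
  qed
  have sqpx: "square_integrable P px"
    unfolding px_def
    by (intro square_integrable_diff square_integrable_scaleR square_integrable_add square_integrable_prx
        p c P sqg(1))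
  have sqpy: "square_integrable P py"
    unfolding py_def
    by (intro square_integrable_diff square_integrable_in_Y P ymax_measurable prx_measurable
        projection_measurable measP[OF meas(3)] ymax_in projection_in_Y
        square_integrable_measurable[OF square_integrable_add[OF sqv square_integrable_scaleR[OF sqh(1)]]])

  let ?E = expectation
  have "?E (\<lambda>\<omega>. (norm (px \<omega>))\<^sup>2) \<le> ?E (\<lambda>\<omega>. (1 + \<eta> * (1 / \<gamma> - \<delta>)) * (norm (a \<omega>))\<^sup>2 - 2 * \<eta> * (a \<omega> \<bullet> g \<omega>)
      - 2 * \<eta> * (a \<omega> \<bullet> n \<omega>) + \<eta>\<^sup>2 * (4 * (norm (g \<omega>))\<^sup>2 + 4 * M\<^sup>2))"
    by (intro integral_mono px_le square_integrable_norm_sq[OF sqpx] Bochner_Integration.integrable_add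
          Bochner_Integration.integrable_diff integrable_mult_right int integrable_const)
  also have "\<dots> = (1 + \<eta> * (1 / \<gamma> - \<delta>)) * ?E (\<lambda>\<omega>. (norm (a \<omega>))\<^sup>2) - 2 * \<eta> * ?E (\<lambda>\<omega>. a \<omega> \<bullet> g \<omega>)
      - 2 * \<eta> * ?E (\<lambda>\<omega>. a \<omega> \<bullet> n \<omega>) + \<eta>\<^sup>2 * (4 * ?E (\<lambda>\<omega>. (norm (g \<omega>))\<^sup>2) + 4 * M\<^sup>2)"
    by (simp add: int prob_space)
  finally have X: "?E (\<lambda>\<omega>. (norm (px \<omega>))\<^sup>2) \<le> \<dots>" .
  have "?E (\<lambda>\<omega>. (norm (py \<omega>))\<^sup>2) \<le> ?E (\<lambda>\<omega>. (norm (b \<omega>))\<^sup>2 + 2 * \<eta> * (b \<omega> \<bullet> h \<omega>) + \<eta>\<^sup>2 * (norm (h \<omega>))\<^sup>2)"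
    by (intro integral_mono py_le square_integrable_norm_sq[OF sqpy] Bochner_Integration.integrable_add
          Bochner_Integration.integrable_diff integrable_mult_right int integrable_const)
  also have "\<dots> = ?E (\<lambda>\<omega>. (norm (b \<omega>))\<^sup>2) + 2 * \<eta> * ?E (\<lambda>\<omega>. b \<omega> \<bullet> h \<omega>) + \<eta>\<^sup>2 * ?E (\<lambda>\<omega>. (norm (h \<omega>))\<^sup>2)"
    by (simp add: int)
  finally have Y: "?E (\<lambda>\<omega>. (norm (py \<omega>))\<^sup>2) \<le> \<dots>" .
  have "\<eta>\<^sup>2 * (4 * ?E (\<lambda>\<omega>. (norm (g \<omega>))\<^sup>2) + 4 * M\<^sup>2) + \<eta>\<^sup>2 * ?E (\<lambda>\<omega>. (norm (h \<omega>))\<^sup>2) \<le> \<eta>\<^sup>2 * (8 * M\<^sup>2) + \<eta>\<^sup>2 * M\<^sup>2"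
    using sqg(2) sqh(2) by (intro add_mono mult_left_mono) auto
  also have "\<dots> = 9 * \<eta>\<^sup>2 * M\<^sup>2" by simp
  finally have noise: "\<eta>\<^sup>2 * (4 * ?E (\<lambda>\<omega>. (norm (g \<omega>))\<^sup>2) + 4 * M\<^sup>2) + \<eta>\<^sup>2 * ?E (\<lambda>\<omega>. (norm (h \<omega>))\<^sup>2) \<le> 9 * \<eta>\<^sup>2 * M\<^sup>2" .
  have gap2: "2 * \<eta> * ((1 / \<gamma> - \<delta>) * ?E (\<lambda>\<omega>. (norm (a \<omega>))\<^sup>2) + \<mu> * ?E (\<lambda>\<omega>. (norm (b \<omega>))\<^sup>2))
      \<le> 2 * \<eta> * (?E (\<lambda>\<omega>. a \<omega> \<bullet> g \<omega>) + ?E (\<lambda>\<omega>. a \<omega> \<bullet> n \<omega>) - ?E (\<lambda>\<omega>. b \<omega> \<bullet> h \<omega>))"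
    using gap \<eta>(1) by (intro mult_left_mono) auto
  have combine: "x + y \<le> (1 - \<eta> * l) * A + (1 - 2 * \<eta> * \<mu>) * B + N"
    if "2 * \<eta> * (l * A + \<mu> * B) \<le> 2 * \<eta> * (ag + an - bh)"
      "x \<le> (1 + \<eta> * l) * A - 2 * \<eta> * ag - 2 * \<eta> * an + N1" "y \<le> B + 2 * \<eta> * bh + N2" "N1 + N2 \<le> N"
    for l A B ag an bh x y N1 N2 N
    using that by (simp add: algebra_simps)
  have "?E (\<lambda>\<omega>. (norm (px \<omega>))\<^sup>2) + ?E (\<lambda>\<omega>. (norm (py \<omega>))\<^sup>2)
      \<le> (1 - \<eta> * (1 / \<gamma> - \<delta>)) * ?E (\<lambda>\<omega>. (norm (a \<omega>))\<^sup>2)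
        + (1 - 2 * \<eta> * \<mu>) * ?E (\<lambda>\<omega>. (norm (b \<omega>))\<^sup>2) + 9 * \<eta>\<^sup>2 * M\<^sup>2"
    by (rule combine[OF gap2 X Y noise])
  then show ?thesis unfolding px_def py_def a_def b_def .
qed

text \<open>
Young's inequality with weight \<open>\<alpha> \<eta>\<close> replaces the saddle point at the current centre \<open>c\<close> by the one at
the previous centre \<open>c0\<close>; it uses up half of the
contraction, which goes from \<open>1 - 2 \<alpha> \<eta>\<close> to \<open>1 - \<alpha> \<eta>\<close>.
\<close>

lemma tracking_step:
  assumes P: "prob_space P" and F: "subalgebra P F"
    and meas: "p \<in> borel_measurable F" "v \<in> borel_measurable F" "c \<in> borel_measurable F"
    and p: "square_integrable P p" and c: "square_integrable P c" and c0: "square_integrable P c0"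
    and v: "\<And>\<omega>. \<omega> \<in> space P \<Longrightarrow> v \<omega> \<in> Y"
    and g: "cond_unbiased_estimator P F (M\<^sup>2) (\<lambda>\<omega>. subdifferential (\<lambda>u. \<phi> u (v \<omega>)) (p \<omega>)) g"
    and h: "cond_unbiased_estimator P F (M\<^sup>2) (\<lambda>\<omega>. {gradient (\<phi> (p \<omega>)) (v \<omega>)}) h"
    and \<eta>: "0 < \<eta>" "\<eta> \<le> \<gamma>\<^sup>2 * (1 / \<gamma> - \<delta>) / 2"
    and \<alpha>: "0 < \<alpha>" "4 * \<alpha> \<le> 1 / \<gamma> - \<delta>" "\<alpha> \<le> \<mu>"
  shows "(\<integral>\<omega>. (norm (p \<omega> - \<eta> *\<^sub>R (g \<omega> + (1 / \<gamma>) *\<^sub>R (p \<omega> - c \<omega>)) - prx (c \<omega>)))\<^sup>2 \<partial>P)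
      + (\<integral>\<omega>. (norm (closest_point Y (v \<omega> + \<eta> *\<^sub>R h \<omega>) - ymax (prx (c \<omega>))))\<^sup>2 \<partial>P)
      \<le> (1 - \<alpha> * \<eta>) * ((\<integral>\<omega>. (norm (p \<omega> - prx (c0 \<omega>)))\<^sup>2 \<partial>P)
          + (\<integral>\<omega>. (norm (v \<omega> - ymax (prx (c0 \<omega>))))\<^sup>2 \<partial>P))
        + (\<integral>\<omega>. (norm (c \<omega> - c0 \<omega>))\<^sup>2 \<partial>P) / (12 * \<alpha>^3 * \<eta> * \<gamma>\<^sup>2) + 9 * \<eta>\<^sup>2 * M\<^sup>2"
proof -
  interpret prob_space P by fact
  let ?E = expectation
  define A where "A = ?E (\<lambda>\<omega>. (norm (p \<omega> - prx (c \<omega>)))\<^sup>2)"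
  define B where "B = ?E (\<lambda>\<omega>. (norm (v \<omega> - ymax (prx (c \<omega>))))\<^sup>2)"
  define A0 where "A0 = ?E (\<lambda>\<omega>. (norm (p \<omega> - prx (c0 \<omega>)))\<^sup>2)"
  define B0 where "B0 = ?E (\<lambda>\<omega>. (norm (v \<omega> - ymax (prx (c0 \<omega>))))\<^sup>2)"
  define d where "d = ?E (\<lambda>\<omega>. (norm (c \<omega> - c0 \<omega>))\<^sup>2)"
  define s where "s = \<alpha> * \<eta>"
  have s0: "0 < s" using \<eta> \<alpha> by (simp add: s_def)
  have s_half: "2 * s \<le> 1"
  proof -
    have "4 * \<alpha> \<le> 1 / \<gamma>" using \<alpha> constants by linarith
    then have "\<alpha> \<le> 1 / (4 * \<gamma>)" using constants(3) by (simp add: field_simps)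
    moreover have "\<eta> \<le> \<gamma> / 2"
    proof -
      have "\<gamma>\<^sup>2 * (1 / \<gamma> - \<delta>) \<le> \<gamma>\<^sup>2 * (1 / \<gamma>)" using constants by (intro mult_left_mono) auto
      also have "\<dots> = \<gamma>" using constants by (simp add: power2_eq_square)
      finally have "\<gamma>\<^sup>2 * (1 / \<gamma> - \<delta>) / 2 \<le> \<gamma> / 2" by (rule divide_right_mono) simp
      with \<eta>(2) show ?thesis by (rule order_trans)
    qed
    ultimately have "\<alpha> * \<eta> \<le> 1 / (4 * \<gamma>) * (\<gamma> / 2)"
      using \<eta>(1) constants by (intro mult_mono) auto
    then show ?thesis using constants by (simp add: s_def)
  qed
  have sqv: "square_integrable P v"
    using P measurable_from_subalg[OF F meas(2)] v by (rule square_integrable_in_Y)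
  have sqy: "square_integrable P (\<lambda>\<omega>. ymax (prx (X \<omega>)))" if "square_integrable P X" for X
    using that
    by (intro square_integrable_in_Y P ymax_measurable prx_measurable square_integrable_measurable ymax_in)
  note sq = square_integrable_norm_sq[OF square_integrable_diff]
  note int = sq[OF p square_integrable_prx[OF P c]] sq[OF p square_integrable_prx[OF P c0]]
    sq[OF sqv sqy[OF c]] sq[OF sqv sqy[OF c0]] sq[OF c c0]
  have "A + B = ?E (\<lambda>\<omega>. (norm (p \<omega> - prx (c \<omega>)))\<^sup>2 + (norm (v \<omega> - ymax (prx (c \<omega>))))\<^sup>2)"
    unfolding A_def B_def by (simp add: int)
  also have "\<dots> \<le> ?E (\<lambda>\<omega>. (1 + s) * ((norm (p \<omega> - prx (c0 \<omega>)))\<^sup>2 + (norm (v \<omega> - ymax (prx (c0 \<omega>))))\<^sup>2)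
      + (1 + 1 / s) * ((norm (c \<omega> - c0 \<omega>))\<^sup>2 / (12 * \<alpha>\<^sup>2 * \<gamma>\<^sup>2)))"
  proof (rule integral_mono)
    fix \<omega>
    let ?a = "p \<omega> - prx (c0 \<omega>)" and ?da = "prx (c0 \<omega>) - prx (c \<omega>)"
    let ?b = "v \<omega> - ymax (prx (c0 \<omega>))" and ?db = "ymax (prx (c0 \<omega>)) - ymax (prx (c \<omega>))"
    have "(norm (p \<omega> - prx (c \<omega>)))\<^sup>2 \<le> (1 + s) * (norm ?a)\<^sup>2 + (1 + 1 / s) * (norm ?da)\<^sup>2"
      using young_sq[OF s0, of ?a ?da] by simp
    moreover have "(norm (v \<omega> - ymax (prx (c \<omega>))))\<^sup>2 \<le> (1 + s) * (norm ?b)\<^sup>2 + (1 + 1 / s) * (norm ?db)\<^sup>2"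
      using young_sq[OF s0, of ?b ?db] by simp
    moreover have "(1 + 1 / s) * ((norm ?da)\<^sup>2 + (norm ?db)\<^sup>2)
        \<le> (1 + 1 / s) * ((norm (c \<omega> - c0 \<omega>))\<^sup>2 / (12 * \<alpha>\<^sup>2 * \<gamma>\<^sup>2))"
      using saddle_map_drift[OF \<alpha>, of "c0 \<omega>" "c \<omega>"] s0
      by (intro mult_left_mono) (auto simp: norm_minus_commute)
    ultimately show "(norm (p \<omega> - prx (c \<omega>)))\<^sup>2 + (norm (v \<omega> - ymax (prx (c \<omega>))))\<^sup>2
      \<le> (1 + s) * ((norm ?a)\<^sup>2 + (norm ?b)\<^sup>2) + (1 + 1 / s) * ((norm (c \<omega> - c0 \<omega>))\<^sup>2 / (12 * \<alpha>\<^sup>2 * \<gamma>\<^sup>2))"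
      by (simp only: distrib_left)
  qed (auto intro!: int Bochner_Integration.integrable_add integrable_mult_right)
  also have "\<dots> = (1 + s) * (A0 + B0) + (1 + 1 / s) * (d / (12 * \<alpha>\<^sup>2 * \<gamma>\<^sup>2))"
    unfolding A0_def B0_def d_def by (simp add: int)
  finally have moved: "A + B \<le> \<dots>" .
  have nonneg: "0 \<le> A" "0 \<le> B" "0 \<le> A0 + B0" "0 \<le> d / (12 * \<alpha>\<^sup>2 * \<gamma>\<^sup>2)"
    unfolding A_def B_def A0_def B0_def d_def by auto
  have "(1 - \<eta> * (1 / \<gamma> - \<delta>)) * A + (1 - 2 * \<eta> * \<mu>) * B \<le> (1 - 2 * s) * A + (1 - 2 * s) * B"
  proof (intro add_mono mult_right_mono nonneg)
    have "\<eta> * (2 * \<alpha>) \<le> \<eta> * (1 / \<gamma> - \<delta>)" "\<eta> * \<alpha> \<le> \<eta> * \<mu>"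
      using \<eta> \<alpha> by (intro mult_left_mono; linarith)+
    then show "1 - \<eta> * (1 / \<gamma> - \<delta>) \<le> 1 - 2 * s" "1 - 2 * \<eta> * \<mu> \<le> 1 - 2 * s"
      by (simp_all add: s_def mult_ac)
  qed
  also have "\<dots> = (1 - 2 * s) * (A + B)" by (simp add: distrib_left)
  also have "\<dots> \<le> (1 - 2 * s) * ((1 + s) * (A0 + B0) + (1 + 1 / s) * (d / (12 * \<alpha>\<^sup>2 * \<gamma>\<^sup>2)))"
    using moved s_half by (intro mult_left_mono) auto
  also have "\<dots> = ((1 - 2 * s) * (1 + s)) * (A0 + B0) + ((1 - 2 * s) * (1 + 1 / s)) * (d / (12 * \<alpha>\<^sup>2 * \<gamma>\<^sup>2))"
    by (simp add: distrib_left[of "1 - 2 * s" "(1 + s) * (A0 + B0)"])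
  also have "\<dots> \<le> (1 - s) * (A0 + B0) + 1 / s * (d / (12 * \<alpha>\<^sup>2 * \<gamma>\<^sup>2))"
  proof (intro add_mono mult_right_mono nonneg)
    show "(1 - 2 * s) * (1 + s) \<le> 1 - s" by (simp add: algebra_simps)
    show "(1 - 2 * s) * (1 + 1 / s) \<le> 1 / s" using s0 by (simp add: field_simps)
  qed
  also have "1 / s * (d / (12 * \<alpha>\<^sup>2 * \<gamma>\<^sup>2)) = d / (12 * \<alpha>^3 * \<eta> * \<gamma>\<^sup>2)"
    by (simp add: s_def power2_eq_square power3_eq_cube)
  finally have "(1 - \<eta> * (1 / \<gamma> - \<delta>)) * A + (1 - 2 * \<eta> * \<mu>) * B
      \<le> (1 - s) * (A0 + B0) + d / (12 * \<alpha>^3 * \<eta> * \<gamma>\<^sup>2)" .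
  with gradient_step_expectation[OF P F meas p c v g h \<eta>] show ?thesis
    unfolding A_def B_def A0_def B0_def d_def s_def by linarith
qed

end

section \<open>The difference of two Moreau envelopes\<close>

locale difference_of_max =
  A: strongly_concave_max Y \<phi> \<delta>\<phi> \<mu>\<phi> \<gamma> M + B: strongly_concave_max Z \<psi> \<delta>\<psi> \<mu>\<psi> \<gamma> M
  for Y :: "'y::euclidean_space set" and \<phi> :: "'x::euclidean_space \<Rightarrow> 'y \<Rightarrow> real" and \<delta>\<phi> \<mu>\<phi>
    and Z :: "'z::euclidean_space set" and \<psi> :: "'x \<Rightarrow> 'z \<Rightarrow> real" and \<delta>\<psi> \<mu>\<psi> and \<gamma> M
begin

abbreviation "F u \<equiv> moreau_env \<gamma> A.\<Phi> u - moreau_env \<gamma> B.\<Phi> u"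
abbreviation "gradF u \<equiv> (1 / \<gamma>) *\<^sub>R (B.prx u - A.prx u)"

text \<open>
The curvature of \<open>F\<close> from above is that of the first envelope plus the concave curvature of the
negated second one; the term \<open>1/(2\<gamma>)\<close> cancels.
\<close>

lemma F_upper:
  "F u' \<le> F u + gradF u \<bullet> (u' - u) + 1 / (\<gamma>\<^sup>2 * (1 / \<gamma> - \<delta>\<psi>)) * (norm (u' - u))\<^sup>2"
proof -
  have "gradF u \<bullet> (u' - u) = ((1 / \<gamma>) *\<^sub>R (u - A.prx u)) \<bullet> (u' - u) - ((1 / \<gamma>) *\<^sub>R (u - B.prx u)) \<bullet> (u' - u)"
    by (simp add: inner_diff_left algebra_simps)
  then show ?thesis
    using A.moreau_env_upper[of u' u] B.moreau_env_lower[of u u'] unfolding left_diff_distrib by linarith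
qed

lemma F_lower:
  "F u' \<ge> F u + gradF u \<bullet> (u' - u) - 1 / (\<gamma>\<^sup>2 * (1 / \<gamma> - \<delta>\<phi>)) * (norm (u' - u))\<^sup>2"
proof -
  have "gradF u \<bullet> (u' - u) = ((1 / \<gamma>) *\<^sub>R (u - A.prx u)) \<bullet> (u' - u) - ((1 / \<gamma>) *\<^sub>R (u - B.prx u)) \<bullet> (u' - u)"
    by (simp add: inner_diff_left algebra_simps)
  then show ?thesis
    using B.moreau_env_upper[of u' u] A.moreau_env_lower[of u u'] unfolding left_diff_distrib by linarith
qed

lemma F_quadratic_error:
  "\<bar>F u' - F u - gradF u \<bullet> (u' - u)\<bar>
    \<le> (1 / (\<gamma>\<^sup>2 * (1 / \<gamma> - \<delta>\<phi>)) + 1 / (\<gamma>\<^sup>2 * (1 / \<gamma> - \<delta>\<psi>))) * (norm (u' - u))\<^sup>2"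
proof -
  have "0 \<le> 1 / (\<gamma>\<^sup>2 * (1 / \<gamma> - \<delta>\<phi>)) * (norm (u' - u))\<^sup>2" "0 \<le> 1 / (\<gamma>\<^sup>2 * (1 / \<gamma> - \<delta>\<psi>)) * (norm (u' - u))\<^sup>2"
    using A.modulus_pos B.modulus_pos by (intro mult_nonneg_nonneg; simp)+
  then show ?thesis using F_upper[of u' u] F_lower[of u u'] unfolding distrib_right by linarith
qed

lemma F_GDERIV: "GDERIV F u :> gradF u"
  using F_quadratic_error by (rule quadratic_error_imp_GDERIV)

lemma square_integrable_gradF:
  assumes "prob_space P" "square_integrable P X"
  shows "square_integrable P (\<lambda>\<omega>. gradF (X \<omega>))"
  by (intro square_integrable_scaleR square_integrable_diff A.square_integrable_prx B.square_integrable_prx assms)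

lemma integrable_F:
  assumes "prob_space P" "square_integrable P X"
  shows "integrable P (\<lambda>\<omega>. F (X \<omega>))"
proof -
  interpret prob_space P by fact
  define K where "K = 1 / (\<gamma>\<^sup>2 * (1 / \<gamma> - \<delta>\<phi>)) + 1 / (\<gamma>\<^sup>2 * (1 / \<gamma> - \<delta>\<psi>))"
  have "continuous_on UNIV F"
    using F_GDERIV unfolding gderiv_def
    by (intro continuous_at_imp_continuous_on ballI) (metis has_derivative_continuous)
  then have meas: "(\<lambda>\<omega>. F (X \<omega>)) \<in> borel_measurable P"
    using square_integrable_measurable[OF assms(2)] by (rule borel_measurable_continuous_on)
  have "integrable P (\<lambda>\<omega>. \<bar>F 0\<bar> + (\<bar>gradF 0 \<bullet> X \<omega>\<bar> + K * (norm (X \<omega>))\<^sup>2))"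
    using assms(2)
    by (intro Bochner_Integration.integrable_add integrable_mult_right square_integrable_norm_sq
        integrable_abs square_integrable_inner[OF square_integrable_const] integrable_const)
  then show ?thesis
  proof (rule Bochner_Integration.integrable_bound[OF _ meas], intro AE_I2)
    fix \<omega>
    have "\<bar>F (X \<omega>) - F 0 - gradF 0 \<bullet> X \<omega>\<bar> \<le> K * (norm (X \<omega>))\<^sup>2"
      using F_quadratic_error[of "X \<omega>" 0] by (simp only: K_def diff_0_right)
    then show "norm (F (X \<omega>)) \<le> norm (\<bar>F 0\<bar> + (\<bar>gradF 0 \<bullet> X \<omega>\<bar> + K * (norm (X \<omega>))\<^sup>2))"
      unfolding real_norm_def by linarith
  qed
qed

text \<open>
With \<open>-2 \<langle>\<nabla>F, G\<rangle> = \<bar>\<nabla>F - G\<bar>\<^sup>2 - \<bar>\<nabla>F\<bar>\<^sup>2 - \<bar>G\<bar>\<^sup>2\<close>, half of the term in \<open>\<bar>G\<bar>\<^sup>2\<close> absorbs the second-order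
term; the other half is kept, since it pays for the drift of the saddle points.
\<close>

lemma descent_step:
  fixes p q u :: 'x
  defines "G \<equiv> (1 / \<gamma>) *\<^sub>R (q - p)"
  assumes "0 < \<eta>" and small: "\<eta> / (\<gamma>\<^sup>2 * (1 / \<gamma> - \<delta>\<psi>)) \<le> 1 / 4"
  shows "F (u - \<eta> *\<^sub>R G) \<le> F u - \<eta> / 2 * (norm (gradF u))\<^sup>2 - \<eta> / 4 * (norm G)\<^sup>2
      + \<eta> / \<gamma>\<^sup>2 * ((norm (p - A.prx u))\<^sup>2 + (norm (q - B.prx u))\<^sup>2)"
proof -
  let ?g = "gradF u"
  have upper: "F (u - \<eta> *\<^sub>R G) \<le> F u + ?g \<bullet> (- \<eta> *\<^sub>R G) + 1 / (\<gamma>\<^sup>2 * (1 / \<gamma> - \<delta>\<psi>)) * (norm (- \<eta> *\<^sub>R G))\<^sup>2"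
    using F_upper[of "u - \<eta> *\<^sub>R G" u] by simp
  have curvature: "1 / (\<gamma>\<^sup>2 * (1 / \<gamma> - \<delta>\<psi>)) * (norm (- \<eta> *\<^sub>R G))\<^sup>2 \<le> \<eta> / 4 * (norm G)\<^sup>2"
  proof -
    have "\<eta> * (\<eta> / (\<gamma>\<^sup>2 * (1 / \<gamma> - \<delta>\<psi>))) * (norm G)\<^sup>2 \<le> \<eta> * (1 / 4) * (norm G)\<^sup>2"
      using small assms(2) by (intro mult_right_mono mult_left_mono) auto
    then show ?thesis by (simp add: power_mult_distrib power2_eq_square mult_ac)
  qed
  have polarization: "?g \<bullet> (- \<eta> *\<^sub>R G) = \<eta> / 2 * (norm (?g - G))\<^sup>2 - \<eta> / 2 * (norm ?g)\<^sup>2 - \<eta> / 2 * (norm G)\<^sup>2"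
  proof -
    have "a \<bullet> (- \<eta> *\<^sub>R b) = \<eta> / 2 * (norm (a - b))\<^sup>2 - \<eta> / 2 * (norm a)\<^sup>2 - \<eta> / 2 * (norm b)\<^sup>2"
      for a b :: 'x
      unfolding power2_norm_eq_inner
      by (simp add: inner_diff_left inner_diff_right inner_commute[of b a] field_simps)
    then show ?thesis .
  qed
  have error: "\<eta> / 2 * (norm (?g - G))\<^sup>2 \<le> \<eta> / \<gamma>\<^sup>2 * ((norm (p - A.prx u))\<^sup>2 + (norm (q - B.prx u))\<^sup>2)"
  proof -
    have "?g - G = (1 / \<gamma>) *\<^sub>R ((p - A.prx u) + (B.prx u - q))"
      by (simp add: G_def algebra_simps)
    then have "(norm (?g - G))\<^sup>2 = 1 / \<gamma>\<^sup>2 * (norm ((p - A.prx u) + (B.prx u - q)))\<^sup>2"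
      by (simp add: power_mult_distrib power_divide)
    also have "\<dots> \<le> 1 / \<gamma>\<^sup>2 * (2 * (norm (p - A.prx u))\<^sup>2 + 2 * (norm (B.prx u - q))\<^sup>2)"
      by (intro mult_left_mono norm_add_sq_le) auto
    finally have "\<eta> / 2 * (norm (?g - G))\<^sup>2
        \<le> \<eta> / 2 * (1 / \<gamma>\<^sup>2 * (2 * (norm (p - A.prx u))\<^sup>2 + 2 * (norm (B.prx u - q))\<^sup>2))"
      using assms(2) by (intro mult_left_mono) auto
    also have "\<dots> = \<eta> / \<gamma>\<^sup>2 * ((norm (p - A.prx u))\<^sup>2 + (norm (q - B.prx u))\<^sup>2)"
      using A.constants(3) by (simp add: norm_minus_commute[of q] field_simps)
    finally show ?thesis .
  qed
  have "x \<le> f - a / 2 * n - a / 4 * m + d"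
    if "x \<le> f + i + q" "q \<le> a / 4 * m" "i = e - a / 2 * n - a / 2 * m" "e \<le> d"
    for x f i q e a n m d :: real
  proof -
    have "a / 2 * m = 2 * (a / 4 * m)" by simp
    with that show ?thesis by linarith
  qed
  from this[OF upper curvature polarization error] show ?thesis .
qed

text \<open>
The gradient of \<open>F\<close> is the difference of the subgradients at the two proximal points of the centre.
First moments are bounded by second moments.
\<close>

lemma nearly_criticalI:
  assumes Q: "prob_space Q" and \<epsilon>: "0 \<le> \<epsilon>" and X: "square_integrable Q X" and c: "square_integrable Q c"
    and le: "(\<integral>\<omega>. (norm (gradF (c \<omega>)))\<^sup>2 \<partial>Q) \<le> \<epsilon>\<^sup>2" "(\<integral>\<omega>. (norm (X \<omega> - A.prx (c \<omega>)))\<^sup>2 \<partial>Q) \<le> \<epsilon>\<^sup>2"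
      "(\<integral>\<omega>. (norm (X \<omega> - B.prx (c \<omega>)))\<^sup>2 \<partial>Q) \<le> \<epsilon>\<^sup>2"
  shows "nearly_critical Q A.\<Phi> B.\<Phi> \<epsilon> X"
proof -
  interpret prob_space Q by fact
  note sqA = A.square_integrable_prx[OF Q c] and sqB = B.square_integrable_prx[OF Q c]
  note sq = square_integrable_gradF[OF Q c] square_integrable_diff[OF X sqA] square_integrable_diff[OF X sqB]
  have small: "expectation (\<lambda>\<omega>. norm (W \<omega>)) \<le> \<epsilon>"
    if "square_integrable Q W" "expectation (\<lambda>\<omega>. (norm (W \<omega>))\<^sup>2) \<le> \<epsilon>\<^sup>2" for W :: "_ \<Rightarrow> 'x"
    by (rule power2_le_imp_le[OF order_trans[OF expectation_norm_sq_le[OF that(1)] that(2)] \<epsilon>])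
  have "gradF u \<in> {a - b | a b. a \<in> subdifferential A.\<Phi> (A.prx u) \<and> b \<in> subdifferential B.\<Phi> (B.prx u)}" for u
  proof -
    have "gradF u = (1 / \<gamma>) *\<^sub>R (u - A.prx u) - (1 / \<gamma>) *\<^sub>R (u - B.prx u)" by (simp add: algebra_simps)
    then show ?thesis using A.prx_subgradient[of u] B.prx_subgradient[of u] by blast
  qed
  then show ?thesis
    unfolding nearly_critical_def
    using small[OF sq(1) le(1)] small[OF sq(2) le(2)] small[OF sq(3) le(3)]
    by (intro conjI exI[of _ "\<lambda>\<omega>. gradF (c \<omega>)"] exI[of _ "\<lambda>\<omega>. A.prx (c \<omega>)"] exI[of _ "\<lambda>\<omega>. B.prx (c \<omega>)"]
        AE_I2 integrable_norm integrable_square_integrable sq square_integrable_measurable X sqA sqB) auto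
qed

end

section \<open>Combining the recursions\<close>

text \<open>
The potential \<open>f + c D\<close> telescopes up to the last index only: no bound for \<open>D T\<close> is available, since
the iterates stop at time \<open>T\<close>.  In the last step the remaining \<open>c D\<close> covers both the error in the descent
of \<open>f\<close> and the last summand.
\<close>

lemma coupled_descent_telescope:
  fixes f g h D :: "nat \<Rightarrow> real"
  assumes descent: "\<And>t. t < T \<Longrightarrow> f (t + 1) \<le> f t - 2 * e * g t - e * h t + k * D t"
    and tracking: "\<And>t. t + 1 < T \<Longrightarrow> c * D (t + 1) \<le> c * D t - 2 * k * D t + e * h t + N"
    and nonneg: "\<And>t. t < T \<Longrightarrow> 0 \<le> h t" "\<And>t. t < T \<Longrightarrow> 0 \<le> D t" "0 \<le> e" "0 \<le> N"
    and c: "2 * k \<le> c" and T: "1 \<le> T"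
  shows "(\<Sum>t<T. 2 * e * g t + k * D t) \<le> f 0 + c * D 0 - f T + real T * N"
proof -
  have "f n + c * D n + (\<Sum>t<n. 2 * e * g t + k * D t) \<le> f 0 + c * D 0 + real n * N" if "n < T" for n
    using that
  proof (induction n)
    case (Suc n)
    then show ?case using descent[of n] tracking[of n] by (simp add: algebra_simps)
  qed simp
  from this[of "T - 1"] T
  have "f (T - 1) + c * D (T - 1) + (\<Sum>t<T - 1. 2 * e * g t + k * D t) \<le> f 0 + c * D 0 + real (T - 1) * N"
    by simp
  moreover have "f T \<le> f (T - 1) - 2 * e * g (T - 1) - e * h (T - 1) + k * D (T - 1)"
    using descent[of "T - 1"] T by simp
  moreover have "(\<Sum>t<T. 2 * e * g t + k * D t)
      = (\<Sum>t<T - 1. 2 * e * g t + k * D t) + (2 * e * g (T - 1) + k * D (T - 1))"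
    using T by (cases T) simp_all
  moreover have "2 * k * D (T - 1) \<le> c * D (T - 1)"
    using c nonneg(2)[of "T - 1"] T by (intro mult_right_mono) auto
  moreover have "0 \<le> e * h (T - 1)" using nonneg(1)[of "T - 1"] nonneg(3) T by simp
  moreover have "real (T - 1) * N \<le> real T * N" using nonneg(4) by (intro mult_right_mono) auto
  ultimately show ?thesis by linarith
qed

text \<open>
The choice of parameters.  The factor \<open>max 2 \<gamma>\<^sup>2\<close> comes from passing from
\<open>\<bar>\<nabla>F\<bar>\<^sup>2 / 2 + D / \<gamma>\<^sup>2\<close> to \<open>\<bar>\<nabla>F\<bar>\<^sup>2 + D\<close>, and \<open>min \<alpha> \<tau>\<close> and \<open>\<nu>\<close> are made so that its product with
them is at most \<open>2 \<tau>\<close>.  The initial gap and the noise then contribute at most \<open>m \<epsilon>\<^sup>2 / 8\<close> each.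
\<close>

lemma averaged_bound:
  fixes \<gamma> \<alpha> \<tau> \<nu> \<eta> M \<epsilon> \<Delta> S m \<beta> :: real
  defines "m \<equiv> min 1 (1 / \<gamma>\<^sup>2)" and "\<beta> \<equiv> min \<alpha> \<tau>"
  assumes pos: "0 < \<gamma>" "0 < \<alpha>" "0 < \<tau>" "0 < \<eta>" "0 < M" "0 < \<epsilon>"
    and \<nu>: "\<nu> = min 1 (2 * \<tau> / (\<gamma>\<^sup>2 * \<alpha>))"
    and \<eta>: "\<eta> \<le> min 1 (\<gamma>\<^sup>2) * \<beta> * \<nu> * \<alpha> / (768 * \<tau> * M\<^sup>2) * \<epsilon>\<^sup>2"
    and T: "real T \<ge> 16 * \<Delta> / (m * \<beta> * \<nu> * \<epsilon>\<^sup>2) * R" and R: "1 / \<eta> \<le> R" and \<Delta>: "0 \<le> \<Delta>" and T1: "1 \<le> T"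
    and S: "\<tau> * \<eta> * S \<le> max 2 (\<gamma>\<^sup>2) * (\<Delta> + real T * (36 * \<tau> * \<eta>\<^sup>2 * M\<^sup>2 / (\<gamma>\<^sup>2 * \<alpha>)))"
  shows "1 / real T * S \<le> m * \<epsilon>\<^sup>2 / 4"
proof -
  define \<kappa> where "\<kappa> = max 2 (\<gamma>\<^sup>2)"
  define K where "K = m * \<beta> * \<nu> * \<epsilon>\<^sup>2"
  have \<nu>0: "0 < \<nu>" and \<beta>0: "0 < \<beta>" and m0: "0 < m" and \<kappa>0: "0 < \<kappa>"
    using pos by (auto simp: \<nu> \<beta>_def m_def \<kappa>_def)
  have K0: "0 < K" using pos \<nu>0 \<beta>0 m0 by (simp add: K_def)
  have \<kappa>\<nu>: "\<kappa> * \<beta> * \<nu> \<le> 2 * \<tau>"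
  proof (cases "\<gamma>\<^sup>2 \<le> 2")
    case True
    then have "\<kappa> * \<beta> * \<nu> \<le> 2 * \<tau> * 1"
      using pos \<nu>0 \<beta>0 unfolding \<kappa>_def by (intro mult_mono) (auto simp: \<beta>_def \<nu>)
    then show ?thesis by simp
  next
    case False
    then have "\<kappa> * \<beta> * \<nu> \<le> \<gamma>\<^sup>2 * \<alpha> * (2 * \<tau> / (\<gamma>\<^sup>2 * \<alpha>))"
      using pos \<nu>0 \<beta>0 unfolding \<kappa>_def by (intro mult_mono) (auto simp: \<beta>_def \<nu>)
    then show ?thesis using pos by simp
  qed
  have "16 * \<Delta> / K * (1 / \<eta>) \<le> real T"
  proof -
    have "16 * \<Delta> / K * (1 / \<eta>) \<le> 16 * \<Delta> / K * R"
      using R \<Delta> K0 by (intro mult_left_mono) auto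
    also have "\<dots> \<le> real T" using T unfolding K_def .
    finally show ?thesis .
  qed
  then have "\<Delta> \<le> real T * (\<eta> * K / 16)"
    using K0 pos by (simp add: field_simps)
  then have "\<kappa> * \<Delta> \<le> \<kappa> * (real T * (\<eta> * K / 16))" using \<kappa>0 by (intro mult_left_mono) auto
  also have "\<dots> = real T * \<eta> * m * \<epsilon>\<^sup>2 / 16 * (\<kappa> * \<beta> * \<nu>)" by (simp add: K_def)
  also have "\<dots> \<le> real T * \<eta> * m * \<epsilon>\<^sup>2 / 16 * (2 * \<tau>)"
    using \<kappa>\<nu> pos m0 by (intro mult_left_mono) auto
  finally have initial: "\<kappa> * \<Delta> \<le> \<tau> * \<eta> * (real T * (m * \<epsilon>\<^sup>2 / 8))" by (simp add: algebra_simps)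
  have m_eq: "min 1 (\<gamma>\<^sup>2) = m * \<gamma>\<^sup>2"
    using pos by (auto simp: m_def min_def field_simps)
  have "\<eta> * (768 * \<tau> * M\<^sup>2) \<le> m * \<gamma>\<^sup>2 * \<beta> * \<nu> * \<alpha> * \<epsilon>\<^sup>2"
    using \<eta> pos unfolding m_eq by (simp add: field_simps)
  then have "\<kappa> * (\<eta> * (768 * \<tau> * M\<^sup>2)) \<le> \<kappa> * (m * \<gamma>\<^sup>2 * \<beta> * \<nu> * \<alpha> * \<epsilon>\<^sup>2)"
    using \<kappa>0 by (intro mult_left_mono) auto
  also have "\<dots> = m * \<gamma>\<^sup>2 * \<alpha> * \<epsilon>\<^sup>2 * (\<kappa> * \<beta> * \<nu>)" by simp
  also have "\<dots> \<le> m * \<gamma>\<^sup>2 * \<alpha> * \<epsilon>\<^sup>2 * (2 * \<tau>)"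
    using \<kappa>\<nu> pos m0 by (intro mult_left_mono) auto
  finally have "\<tau> * (\<kappa> * \<eta> * 384 * M\<^sup>2) \<le> \<tau> * (m * \<gamma>\<^sup>2 * \<alpha> * \<epsilon>\<^sup>2)" by (simp add: algebra_simps)
  then have "\<kappa> * \<eta> * 384 * M\<^sup>2 \<le> m * \<gamma>\<^sup>2 * \<alpha> * \<epsilon>\<^sup>2" using pos by simp
  then have "\<kappa> * \<eta> * M\<^sup>2 / (\<gamma>\<^sup>2 * \<alpha>) \<le> m * \<epsilon>\<^sup>2 / 384"
    using pos by (simp add: field_simps)
  then have "\<tau> * \<eta> * real T * 36 * (\<kappa> * \<eta> * M\<^sup>2 / (\<gamma>\<^sup>2 * \<alpha>)) \<le> \<tau> * \<eta> * real T * 36 * (m * \<epsilon>\<^sup>2 / 384)"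
    using pos by (intro mult_left_mono) auto
  also have "\<dots> \<le> \<tau> * \<eta> * (real T * (m * \<epsilon>\<^sup>2 / 8))"
    using pos m0 by simp
  finally have noise: "\<kappa> * (real T * (36 * \<tau> * \<eta>\<^sup>2 * M\<^sup>2 / (\<gamma>\<^sup>2 * \<alpha>))) \<le> \<tau> * \<eta> * (real T * (m * \<epsilon>\<^sup>2 / 8))"
    by (simp add: power2_eq_square mult_ac)
  have "\<tau> * \<eta> * S \<le> \<tau> * \<eta> * (real T * (m * \<epsilon>\<^sup>2 / 8)) + \<tau> * \<eta> * (real T * (m * \<epsilon>\<^sup>2 / 8))"
    using S initial noise unfolding \<kappa>_def[symmetric] distrib_left by linarith
  also have "\<dots> = \<tau> * \<eta> * (real T * (m * \<epsilon>\<^sup>2 / 4))" by simp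
  finally have "S \<le> real T * (m * \<epsilon>\<^sup>2 / 4)" using pos by simp
  then show ?thesis using T1 by (simp add: field_simps)
qed

section \<open>Sampling a uniformly distributed iteration\<close>

lemma
  fixes X :: "nat \<Rightarrow> 'w \<Rightarrow> 'a::euclidean_space"
  assumes P: "prob_space P" and T: "1 \<le> T" and X: "\<And>t. t \<in> {1..T} \<Longrightarrow> square_integrable P (X t)"
  defines "Q \<equiv> P \<Otimes>\<^sub>M uniform_count_measure {1..T}"
  shows square_integrable_uniform_time: "square_integrable Q (\<lambda>(\<omega>, t). X t \<omega>)"
    and uniform_time_second_moment:
      "(\<integral>p. (norm (case p of (\<omega>, t) \<Rightarrow> X t \<omega>))\<^sup>2 \<partial>Q) = 1 / real T * (\<Sum>t\<in>{1..T}. \<integral>\<omega>. (norm (X t \<omega>))\<^sup>2 \<partial>P)"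
proof -
  let ?U = "uniform_count_measure {1..T}"
  interpret P: prob_space P by fact
  interpret U: prob_space ?U using T by (intro prob_space_uniform_count_measure) auto
  interpret pair_sigma_finite P ?U ..
  have meas: "(\<lambda>(\<omega>, t). X t \<omega>) \<in> borel_measurable Q"
  proof -
    have "snd \<in> Q \<rightarrow>\<^sub>M ?U" unfolding Q_def by (rule measurable_snd)
    also have "Q \<rightarrow>\<^sub>M ?U = Q \<rightarrow>\<^sub>M count_space {1..T}"
      by (rule measurable_cong_sets) (simp_all add: sets_uniform_count_measure)
    finally have snd: "snd \<in> Q \<rightarrow>\<^sub>M count_space {1..T}" .
    have "(\<lambda>p. X t (fst p)) \<in> borel_measurable Q" if "t \<in> {1..T}" for t
      unfolding Q_def
      by (rule measurable_compose[OF measurable_fst square_integrable_measurable[OF X[OF that]]])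
    from measurable_compose_countable'[where f = "\<lambda>t p. X t (fst p)", OF this snd]
    have "(\<lambda>p. X (snd p) (fst p)) \<in> borel_measurable Q" by simp
    then show ?thesis by (simp add: case_prod_beta')
  qed
  define N where "N = (\<lambda>p. (norm (case p of (\<omega>, t) \<Rightarrow> X t \<omega>))\<^sup>2)"
  have N: "N (\<omega>, t) = (norm (X t \<omega>))\<^sup>2" for \<omega> t by (simp add: N_def)
  have Umean: "(\<integral>t. h t \<partial>?U) = (\<Sum>t\<in>{1..T}. h t) / real T" for h :: "nat \<Rightarrow> real"
    using integral_uniform_count_measure[of "{1..T}" h] by simp
  have int: "integrable Q N"
    unfolding Q_def
  proof (rule Fubini_integrable)
    show "N \<in> borel_measurable (P \<Otimes>\<^sub>M ?U)"
      unfolding N_def Q_def[symmetric] by (rule borel_measurable_power[OF measurable_compose[OF meas borel_measurable_norm]])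
    show "integrable P (\<lambda>\<omega>. \<integral>t. norm (N (\<omega>, t)) \<partial>?U)"
      unfolding Umean
      by (intro integrable_divide_zero Bochner_Integration.integrable_sum) (simp add: N X square_integrable_norm_sq)
    show "AE \<omega> in P. integrable ?U (\<lambda>t. N (\<omega>, t))"
      unfolding uniform_count_measure_def by (intro AE_I2 integrable_point_measure_finite) simp
  qed
  with meas show "square_integrable Q (\<lambda>(\<omega>, t). X t \<omega>)"
    unfolding square_integrable_def N_def by (rule conjI)
  have "(\<integral>p. (norm (case p of (\<omega>, t) \<Rightarrow> X t \<omega>))\<^sup>2 \<partial>Q) = integral\<^sup>L Q N"
    by (simp only: N_def)
  also have "\<dots> = (\<integral>t. (\<integral>\<omega>. N (\<omega>, t) \<partial>P) \<partial>?U)"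
    using integral_snd[of "\<lambda>\<omega> t. N (\<omega>, t)", unfolded case_prod_eta, OF int[unfolded Q_def]]
    by (simp only: Q_def)
  also have "\<dots> = 1 / real T * (\<Sum>t\<in>{1..T}. \<integral>\<omega>. (norm (X t \<omega>))\<^sup>2 \<partial>P)"
    unfolding Umean by (simp add: N)
  finally show "(\<integral>p. (norm (case p of (\<omega>, t) \<Rightarrow> X t \<omega>))\<^sup>2 \<partial>Q)
      = 1 / real T * (\<Sum>t\<in>{1..T}. \<integral>\<omega>. (norm (X t \<omega>))\<^sup>2 \<partial>P)" .
qed

section \<open>The iterates of SMAG\<close>

text \<open>
A run of the algorithm, with the estimators already evaluated at the current iterates, hence as
random vectors indexed by time.
\<close>

locale smag_run = difference_of_max Y \<phi> \<delta>\<phi> \<mu>\<phi> Z \<psi> \<delta>\<psi> \<mu>\<psi> \<gamma> M + prob_space P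
  for Y :: "'y::euclidean_space set" and \<phi> :: "'x::euclidean_space \<Rightarrow> 'y \<Rightarrow> real" and \<delta>\<phi> \<mu>\<phi>
    and Z :: "'z::euclidean_space set" and \<psi> :: "'x \<Rightarrow> 'z \<Rightarrow> real" and \<delta>\<psi> \<mu>\<psi> and \<gamma> M
    and P :: "'w measure" +
  fixes \<F> :: "nat \<Rightarrow> 'w measure" and T :: nat and \<eta>\<^sub>0 \<eta>\<^sub>1 :: real
    and gx hx :: "nat \<Rightarrow> 'w \<Rightarrow> 'x" and gy :: "nat \<Rightarrow> 'w \<Rightarrow> 'y" and hz :: "nat \<Rightarrow> 'w \<Rightarrow> 'z"
    and x\<phi> x\<psi> x :: "nat \<Rightarrow> 'w \<Rightarrow> 'x" and y :: "nat \<Rightarrow> 'w \<Rightarrow> 'y" and z :: "nat \<Rightarrow> 'w \<Rightarrow> 'z"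
    and x\<phi>0 x\<psi>0 x0 :: 'x and y0 :: 'y and z0 :: 'z
  assumes subalg: "subalgebra P (\<F> t)" and \<F>_mono: "sets (\<F> t) \<subseteq> sets (\<F> (t + 1))"
    and adapted: "t < T \<Longrightarrow> gx t \<in> borel_measurable (\<F> (t + 1))" "t < T \<Longrightarrow> gy t \<in> borel_measurable (\<F> (t + 1))"
      "t < T \<Longrightarrow> hx t \<in> borel_measurable (\<F> (t + 1))" "t < T \<Longrightarrow> hz t \<in> borel_measurable (\<F> (t + 1))"
    and estimators:
      "t < T \<Longrightarrow> cond_unbiased_estimator P (\<F> t) (M\<^sup>2) (\<lambda>\<omega>. subdifferential (\<lambda>u. \<phi> u (y t \<omega>)) (x\<phi> t \<omega>)) (gx t)"
      "t < T \<Longrightarrow> cond_unbiased_estimator P (\<F> t) (M\<^sup>2) (\<lambda>\<omega>. {gradient (\<phi> (x\<phi> t \<omega>)) (y t \<omega>)}) (gy t)"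
      "t < T \<Longrightarrow> cond_unbiased_estimator P (\<F> t) (M\<^sup>2) (\<lambda>\<omega>. subdifferential (\<lambda>u. \<psi> u (z t \<omega>)) (x\<psi> t \<omega>)) (hx t)"
      "t < T \<Longrightarrow> cond_unbiased_estimator P (\<F> t) (M\<^sup>2) (\<lambda>\<omega>. {gradient (\<psi> (x\<psi> t \<omega>)) (z t \<omega>)}) (hz t)"
    and init: "\<omega> \<in> space P \<Longrightarrow> x\<phi> 0 \<omega> = x\<phi>0" "\<omega> \<in> space P \<Longrightarrow> y 0 \<omega> = y0" "\<omega> \<in> space P \<Longrightarrow> x\<psi> 0 \<omega> = x\<psi>0"
      "\<omega> \<in> space P \<Longrightarrow> z 0 \<omega> = z0" "\<omega> \<in> space P \<Longrightarrow> x 0 \<omega> = x0" "y0 \<in> Y" "z0 \<in> Z"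
    and update:
      "t < T \<Longrightarrow> \<omega> \<in> space P \<Longrightarrow> x\<phi> (t + 1) \<omega> = x\<phi> t \<omega> - \<eta>\<^sub>1 *\<^sub>R (gx t \<omega> + (1 / \<gamma>) *\<^sub>R (x\<phi> t \<omega> - x t \<omega>))"
      "t < T \<Longrightarrow> \<omega> \<in> space P \<Longrightarrow> y (t + 1) \<omega> = closest_point Y (y t \<omega> + \<eta>\<^sub>1 *\<^sub>R gy t \<omega>)"
      "t < T \<Longrightarrow> \<omega> \<in> space P \<Longrightarrow> x\<psi> (t + 1) \<omega> = x\<psi> t \<omega> - \<eta>\<^sub>1 *\<^sub>R (hx t \<omega> + (1 / \<gamma>) *\<^sub>R (x\<psi> t \<omega> - x t \<omega>))"
      "t < T \<Longrightarrow> \<omega> \<in> space P \<Longrightarrow> z (t + 1) \<omega> = closest_point Z (z t \<omega> + \<eta>\<^sub>1 *\<^sub>R hz t \<omega>)"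
      "t < T \<Longrightarrow> \<omega> \<in> space P \<Longrightarrow> x (t + 1) \<omega> = x t \<omega> - \<eta>\<^sub>0 *\<^sub>R ((1 / \<gamma>) *\<^sub>R (x\<psi> (t + 1) \<omega> - x\<phi> (t + 1) \<omega>))"
begin

lemma space_\<F>: "space (\<F> t) = space P"
  using subalg[of t] by (simp add: subalgebra_def)

lemma measurable_\<F>_Suc: "X \<in> borel_measurable (\<F> t) \<Longrightarrow> X \<in> borel_measurable (\<F> (t + 1))"
  using measurable_from_subalg[of "\<F> (t + 1)" "\<F> t" X borel] \<F>_mono[of t]
  by (simp add: subalgebra_def space_\<F>)

lemma iterates_measurable:
  assumes "t \<le> T"
  shows "x\<phi> t \<in> borel_measurable (\<F> t) \<and> y t \<in> borel_measurable (\<F> t) \<and> x\<psi> t \<in> borel_measurable (\<F> t)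
    \<and> z t \<in> borel_measurable (\<F> t) \<and> x t \<in> borel_measurable (\<F> t)"
  using assms
proof (induction t)
  case 0
  have const: "X \<in> borel_measurable (\<F> 0)" if "\<And>\<omega>. \<omega> \<in> space P \<Longrightarrow> X \<omega> = c" for X :: "'w \<Rightarrow> 'a::euclidean_space" and c
    using that measurable_cong[of "\<F> 0" X "\<lambda>_. c" borel] by (simp add: space_\<F>)
  show ?case
    by (intro conjI; rule const; erule init)
next
  case (Suc t)
  then have t: "t < T" by simp
  have cong: "X \<in> borel_measurable (\<F> (t + 1))"
    if "\<And>\<omega>. \<omega> \<in> space P \<Longrightarrow> X \<omega> = X' \<omega>" "X' \<in> borel_measurable (\<F> (t + 1))" for X X' :: "'w \<Rightarrow> 'a::euclidean_space"
    using that measurable_cong[of "\<F> (t + 1)" X X' borel] by (simp add: space_\<F>)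
  have past: "x\<phi> t \<in> borel_measurable (\<F> (t + 1))" "y t \<in> borel_measurable (\<F> (t + 1))" "x\<psi> t \<in> borel_measurable (\<F> (t + 1))"
    "z t \<in> borel_measurable (\<F> (t + 1))" "x t \<in> borel_measurable (\<F> (t + 1))"
    using Suc.IH t by (intro measurable_\<F>_Suc; simp)+
  note intros = borel_measurable_diff borel_measurable_add borel_measurable_scaleR borel_measurable_const past adapted[OF t]
  have \<phi>: "x\<phi> (t + 1) \<in> borel_measurable (\<F> (t + 1))"
    by (rule cong, erule update(1)[OF t]) (intro intros)
  have \<psi>: "x\<psi> (t + 1) \<in> borel_measurable (\<F> (t + 1))"
    by (rule cong, erule update(3)[OF t]) (intro intros)
  have yt: "y (t + 1) \<in> borel_measurable (\<F> (t + 1))"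
    by (rule cong, erule update(2)[OF t]) (intro A.projection_measurable intros)
  have zt: "z (t + 1) \<in> borel_measurable (\<F> (t + 1))"
    by (rule cong, erule update(4)[OF t]) (intro B.projection_measurable intros)
  have "x (t + 1) \<in> borel_measurable (\<F> (t + 1))"
    by (rule cong, erule update(5)[OF t]) (intro intros \<phi> \<psi>)
  with \<phi> \<psi> yt zt show ?case by simp
qed

lemma y_in_Y: "t \<le> T \<Longrightarrow> \<omega> \<in> space P \<Longrightarrow> y t \<omega> \<in> Y"
  using init(2,6) update(2)[of "t - 1" \<omega>] by (cases t) (auto simp: A.projection_in_Y)

lemma z_in_Z: "t \<le> T \<Longrightarrow> \<omega> \<in> space P \<Longrightarrow> z t \<omega> \<in> Z"
  using init(4,7) update(4)[of "t - 1" \<omega>] by (cases t) (auto simp: B.projection_in_Y)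

lemma iterates_square_integrable:
  assumes "t \<le> T"
  shows "square_integrable P (x\<phi> t) \<and> square_integrable P (x\<psi> t) \<and> square_integrable P (x t)"
  using assms
proof (induction t)
  case 0
  show ?case
    by (intro conjI; rule square_integrable_cong[OF square_integrable_const]; erule init)
next
  case (Suc t)
  then have t: "t < T" by simp
  note sq = square_integrable_diff square_integrable_add square_integrable_scaleR
  have past: "square_integrable P (x\<phi> t)" "square_integrable P (x\<psi> t)" "square_integrable P (x t)"
    using Suc by auto
  note est = cond_unbiased_estimator_second_moment(1)[OF prob_space_axioms subalg]
  have \<phi>: "square_integrable P (x\<phi> (t + 1))"
    by (rule square_integrable_cong[rotated], erule update(1)[OF t]) (intro sq past est[OF estimators(1)[OF t]])
  have \<psi>: "square_integrable P (x\<psi> (t + 1))"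
    by (rule square_integrable_cong[rotated], erule update(3)[OF t]) (intro sq past est[OF estimators(3)[OF t]])
  have "square_integrable P (x (t + 1))"
    by (rule square_integrable_cong[rotated], erule update(5)[OF t]) (intro sq past \<phi> \<psi>)
  with \<phi> \<psi> show ?case by simp
qed

text \<open>
Expected squared distance of the iterates at time \<open>t + 1\<close> from the two saddle points for the centre
at time \<open>t\<close>.  The shift matches the algorithm, in which \<open>x\<^sub>t\<^sub>+\<^sub>1\<close> is formed from the iterates at time
\<open>t + 1\<close>.
\<close>

definition "tracking_error t =
    expectation (\<lambda>\<omega>. (norm (x\<phi> (t + 1) \<omega> - A.prx (x t \<omega>)))\<^sup>2)
  + expectation (\<lambda>\<omega>. (norm (y (t + 1) \<omega> - A.ymax (A.prx (x t \<omega>))))\<^sup>2)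
  + expectation (\<lambda>\<omega>. (norm (x\<psi> (t + 1) \<omega> - B.prx (x t \<omega>)))\<^sup>2)
  + expectation (\<lambda>\<omega>. (norm (z (t + 1) \<omega> - B.ymax (B.prx (x t \<omega>))))\<^sup>2)"

definition "direction t \<omega> = (1 / \<gamma>) *\<^sub>R (x\<psi> (t + 1) \<omega> - x\<phi> (t + 1) \<omega>)"

lemma tracking_error_recursion:
  assumes t: "t + 1 < T"
    and \<eta>: "0 < \<eta>\<^sub>1" "\<eta>\<^sub>1 \<le> \<gamma>\<^sup>2 * (1 / \<gamma> - \<delta>\<phi>) / 2" "\<eta>\<^sub>1 \<le> \<gamma>\<^sup>2 * (1 / \<gamma> - \<delta>\<psi>) / 2"
    and \<alpha>: "0 < \<alpha>" "4 * \<alpha> \<le> 1 / \<gamma> - \<delta>\<phi>" "4 * \<alpha> \<le> 1 / \<gamma> - \<delta>\<psi>" "\<alpha> \<le> \<mu>\<phi>" "\<alpha> \<le> \<mu>\<psi>"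
  shows "tracking_error (t + 1) \<le> (1 - \<alpha> * \<eta>\<^sub>1) * tracking_error t
      + \<eta>\<^sub>0\<^sup>2 * expectation (\<lambda>\<omega>. (norm (direction t \<omega>))\<^sup>2) / (6 * \<alpha>^3 * \<eta>\<^sub>1 * \<gamma>\<^sup>2) + 18 * \<eta>\<^sub>1\<^sup>2 * M\<^sup>2"
proof -
  have t': "t < T" "t \<le> T" "t + 1 \<le> T" using t by auto
  note meas = iterates_measurable[OF t'(3)] and sq = iterates_square_integrable[OF t'(3)]
    and sq0 = iterates_square_integrable[OF t'(2)]
  have step: "expectation (\<lambda>\<omega>. (norm (x (t + 1) \<omega> - x t \<omega>))\<^sup>2) = \<eta>\<^sub>0\<^sup>2 * expectation (\<lambda>\<omega>. (norm (direction t \<omega>))\<^sup>2)"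
  proof -
    have "expectation (\<lambda>\<omega>. (norm (x (t + 1) \<omega> - x t \<omega>))\<^sup>2) = expectation (\<lambda>\<omega>. \<eta>\<^sub>0\<^sup>2 * (norm (direction t \<omega>))\<^sup>2)"
    proof (rule Bochner_Integration.integral_cong)
      fix \<omega> assume "\<omega> \<in> space P"
      then have "x (t + 1) \<omega> - x t \<omega> = - (\<eta>\<^sub>0 *\<^sub>R direction t \<omega>)"
        using update(5)[OF t'(1)] by (simp add: direction_def)
      then show "(norm (x (t + 1) \<omega> - x t \<omega>))\<^sup>2 = \<eta>\<^sub>0\<^sup>2 * (norm (direction t \<omega>))\<^sup>2"
        by (simp only: norm_minus_cancel norm_scaleR power_mult_distrib power2_abs)
    qed simp
    then show ?thesis by simp
  qed
  have cong: "expectation (\<lambda>\<omega>. (norm (X \<omega> - W \<omega>))\<^sup>2) = expectation (\<lambda>\<omega>. (norm (X' \<omega> - W \<omega>))\<^sup>2)"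
    if "\<And>\<omega>. \<omega> \<in> space P \<Longrightarrow> X \<omega> = X' \<omega>" for X X' W :: "'w \<Rightarrow> 'a::euclidean_space"
    using that by (intro Bochner_Integration.integral_cong) auto
  note A = A.tracking_step[OF prob_space_axioms subalg _ _ _ _ _ _ y_in_Y[OF t'(3)] estimators(1,2)[OF t] \<eta>(1,2) \<alpha>(1,2,4),
      of "x (t + 1)" "x t"]
  note B = B.tracking_step[OF prob_space_axioms subalg _ _ _ _ _ _ z_in_Z[OF t'(3)] estimators(3,4)[OF t] \<eta>(1,3) \<alpha>(1,3,5),
      of "x (t + 1)" "x t"]
  have AB: "a + b + c + d \<le> (1 - \<alpha> * \<eta>\<^sub>1) * (a' + b' + c' + d') + S / (6 * \<alpha>^3 * \<eta>\<^sub>1 * \<gamma>\<^sup>2) + 18 * \<eta>\<^sub>1\<^sup>2 * M\<^sup>2"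
    if "a + b \<le> (1 - \<alpha> * \<eta>\<^sub>1) * (a' + b') + S / (12 * \<alpha>^3 * \<eta>\<^sub>1 * \<gamma>\<^sup>2) + 9 * \<eta>\<^sub>1\<^sup>2 * M\<^sup>2"
      "c + d \<le> (1 - \<alpha> * \<eta>\<^sub>1) * (c' + d') + S / (12 * \<alpha>^3 * \<eta>\<^sub>1 * \<gamma>\<^sup>2) + 9 * \<eta>\<^sub>1\<^sup>2 * M\<^sup>2"
    for a b c d a' b' c' d' S
  proof -
    have "S / (6 * \<alpha>^3 * \<eta>\<^sub>1 * \<gamma>\<^sup>2) = S / (12 * \<alpha>^3 * \<eta>\<^sub>1 * \<gamma>\<^sup>2) + S / (12 * \<alpha>^3 * \<eta>\<^sub>1 * \<gamma>\<^sup>2)" by simp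
    with that show ?thesis by (simp add: distrib_left)
  qed
  have eqs:
    "expectation (\<lambda>\<omega>. (norm (x\<phi> (t + 1 + 1) \<omega> - A.prx (x (t + 1) \<omega>)))\<^sup>2) = expectation (\<lambda>\<omega>.
      (norm (x\<phi> (t + 1) \<omega> - \<eta>\<^sub>1 *\<^sub>R (gx (t + 1) \<omega> + (1 / \<gamma>) *\<^sub>R (x\<phi> (t + 1) \<omega> - x (t + 1) \<omega>)) - A.prx (x (t + 1) \<omega>)))\<^sup>2)"
    "expectation (\<lambda>\<omega>. (norm (y (t + 1 + 1) \<omega> - A.ymax (A.prx (x (t + 1) \<omega>))))\<^sup>2) = expectation (\<lambda>\<omega>.
      (norm (closest_point Y (y (t + 1) \<omega> + \<eta>\<^sub>1 *\<^sub>R gy (t + 1) \<omega>) - A.ymax (A.prx (x (t + 1) \<omega>))))\<^sup>2)"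
    "expectation (\<lambda>\<omega>. (norm (x\<psi> (t + 1 + 1) \<omega> - B.prx (x (t + 1) \<omega>)))\<^sup>2) = expectation (\<lambda>\<omega>.
      (norm (x\<psi> (t + 1) \<omega> - \<eta>\<^sub>1 *\<^sub>R (hx (t + 1) \<omega> + (1 / \<gamma>) *\<^sub>R (x\<psi> (t + 1) \<omega> - x (t + 1) \<omega>)) - B.prx (x (t + 1) \<omega>)))\<^sup>2)"
    "expectation (\<lambda>\<omega>. (norm (z (t + 1 + 1) \<omega> - B.ymax (B.prx (x (t + 1) \<omega>))))\<^sup>2) = expectation (\<lambda>\<omega>.
      (norm (closest_point Z (z (t + 1) \<omega> + \<eta>\<^sub>1 *\<^sub>R hz (t + 1) \<omega>) - B.ymax (B.prx (x (t + 1) \<omega>))))\<^sup>2)"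
    by (rule cong, erule update[OF t])+
  show ?thesis
    unfolding tracking_error_def step[symmetric] eqs
    by (intro AB A B) (use meas sq sq0 in auto)
qed

lemma moreau_descent:
  assumes t: "t < T" and \<eta>: "0 < \<eta>\<^sub>0" "\<eta>\<^sub>0 / (\<gamma>\<^sup>2 * (1 / \<gamma> - \<delta>\<psi>)) \<le> 1 / 4"
  shows "expectation (\<lambda>\<omega>. F (x (t + 1) \<omega>)) \<le> expectation (\<lambda>\<omega>. F (x t \<omega>))
      - \<eta>\<^sub>0 / 2 * expectation (\<lambda>\<omega>. (norm (gradF (x t \<omega>)))\<^sup>2)
      - \<eta>\<^sub>0 / 4 * expectation (\<lambda>\<omega>. (norm (direction t \<omega>))\<^sup>2) + \<eta>\<^sub>0 / \<gamma>\<^sup>2 * tracking_error t"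
proof -
  have t': "t \<le> T" "t + 1 \<le> T" using t by auto
  have sq: "square_integrable P (x\<phi> (t + 1))" "square_integrable P (x\<psi> (t + 1))" "square_integrable P (x (t + 1))"
    "square_integrable P (x t)"
    using iterates_square_integrable[OF t'(1)] iterates_square_integrable[OF t'(2)] by auto
  note P = prob_space_axioms
  have sqdir: "square_integrable P (direction t)"
    unfolding direction_def by (intro square_integrable_scaleR square_integrable_diff sq)
  note int = integrable_F[OF P sq(4)] square_integrable_norm_sq[OF square_integrable_gradF[OF P sq(4)]]
    square_integrable_norm_sq[OF sqdir]
    square_integrable_norm_sq[OF square_integrable_diff[OF sq(1) A.square_integrable_prx[OF P sq(4)]]]
    square_integrable_norm_sq[OF square_integrable_diff[OF sq(2) B.square_integrable_prx[OF P sq(4)]]]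
  let ?E = expectation
  let ?rhs = "\<lambda>\<omega>. F (x t \<omega>) - \<eta>\<^sub>0 / 2 * (norm (gradF (x t \<omega>)))\<^sup>2 - \<eta>\<^sub>0 / 4 * (norm (direction t \<omega>))\<^sup>2
      + \<eta>\<^sub>0 / \<gamma>\<^sup>2 * ((norm (x\<phi> (t + 1) \<omega> - A.prx (x t \<omega>)))\<^sup>2 + (norm (x\<psi> (t + 1) \<omega> - B.prx (x t \<omega>)))\<^sup>2)"
  have "?E (\<lambda>\<omega>. F (x (t + 1) \<omega>)) \<le> ?E ?rhs"
  proof (rule integral_mono)
    show "integrable P (\<lambda>\<omega>. F (x (t + 1) \<omega>))" by (rule integrable_F[OF P sq(3)])
    show "integrable P ?rhs"
      by (intro Bochner_Integration.integrable_add Bochner_Integration.integrable_diff integrable_mult_right int)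
    show "F (x (t + 1) \<omega>) \<le> ?rhs \<omega>" if "\<omega> \<in> space P" for \<omega>
      unfolding update(5)[OF t that] direction_def by (rule descent_step[OF \<eta>])
  qed
  also have "?E ?rhs = ?E (\<lambda>\<omega>. F (x t \<omega>)) - \<eta>\<^sub>0 / 2 * ?E (\<lambda>\<omega>. (norm (gradF (x t \<omega>)))\<^sup>2)
      - \<eta>\<^sub>0 / 4 * ?E (\<lambda>\<omega>. (norm (direction t \<omega>))\<^sup>2)
      + \<eta>\<^sub>0 / \<gamma>\<^sup>2 * (?E (\<lambda>\<omega>. (norm (x\<phi> (t + 1) \<omega> - A.prx (x t \<omega>)))\<^sup>2)
        + ?E (\<lambda>\<omega>. (norm (x\<psi> (t + 1) \<omega> - B.prx (x t \<omega>)))\<^sup>2))"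
  proof -
    have "?E (\<lambda>\<omega>. f \<omega> - a * g \<omega> - b * h \<omega> + c * (u \<omega> + v \<omega>)) = ?E f - a * ?E g - b * ?E h + c * (?E u + ?E v)"
      if "integrable P f" "integrable P g" "integrable P h" "integrable P u" "integrable P v"
      for f g h u v :: "'w \<Rightarrow> real" and a b c
      using that by simp
    from this[OF int] show ?thesis .
  qed
  also have "\<dots> \<le> ?E (\<lambda>\<omega>. F (x t \<omega>)) - \<eta>\<^sub>0 / 2 * ?E (\<lambda>\<omega>. (norm (gradF (x t \<omega>)))\<^sup>2)
      - \<eta>\<^sub>0 / 4 * ?E (\<lambda>\<omega>. (norm (direction t \<omega>))\<^sup>2) + \<eta>\<^sub>0 / \<gamma>\<^sup>2 * tracking_error t"
    unfolding tracking_error_def using \<eta>(1) by (intro add_left_mono mult_left_mono) auto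
  finally show ?thesis .
qed

definition "criticality_gap t =
    expectation (\<lambda>\<omega>. (norm (x\<phi> (t + 1) \<omega> - A.prx (x t \<omega>)))\<^sup>2)
  + expectation (\<lambda>\<omega>. (norm (x\<psi> (t + 1) \<omega> - B.prx (x t \<omega>)))\<^sup>2)
  + expectation (\<lambda>\<omega>. (norm (gradF (x t \<omega>)))\<^sup>2)"

text \<open>
The weight \<open>2 \<tau> / (\<gamma>\<^sup>2 \<alpha>)\<close> of the tracking error is chosen so that the contraction is worth twice the
error term in the descent of \<open>F\<close>.  The bound on \<open>\<tau>\<close> makes the drift of the saddle points smaller than
the decrease gained from the squared direction; with the bound on \<open>\<eta>\<^sub>1\<close> it also keeps \<open>\<eta>\<^sub>0\<close> below the
inverse curvature of \<open>F\<close>.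
\<close>

lemma sum_criticality_gap_le:
  assumes T: "1 \<le> T" and lower: "\<And>u. Fstar \<le> F u"
    and \<alpha>: "0 < \<alpha>" "4 * \<alpha> \<le> 1 / \<gamma> - \<delta>\<phi>" "4 * \<alpha> \<le> 1 / \<gamma> - \<delta>\<psi>" "\<alpha> \<le> \<mu>\<phi>" "\<alpha> \<le> \<mu>\<psi>"
    and \<eta>: "0 < \<eta>\<^sub>1" "\<eta>\<^sub>1 \<le> \<gamma>\<^sup>2 * (1 / \<gamma> - \<delta>\<phi>) / 2" "\<eta>\<^sub>1 \<le> \<gamma>\<^sup>2 * (1 / \<gamma> - \<delta>\<psi>) / 2"
    and \<tau>: "0 < \<tau>" "\<tau> \<le> \<gamma>\<^sup>2 * \<alpha>\<^sup>2 / 4" and \<eta>\<^sub>0: "\<eta>\<^sub>0 = \<tau> * \<eta>\<^sub>1"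
  shows "\<tau> * \<eta>\<^sub>1 * (\<Sum>t<T. criticality_gap t)
    \<le> max 2 (\<gamma>\<^sup>2) * (F x0 - Fstar + 2 * \<tau> / (\<gamma>\<^sup>2 * \<alpha>) * tracking_error 0
        + real T * (36 * \<tau> * \<eta>\<^sub>1\<^sup>2 * M\<^sup>2 / (\<gamma>\<^sup>2 * \<alpha>)))"
proof -
  let ?E = expectation
  define f where "f = (\<lambda>t. ?E (\<lambda>\<omega>. F (x t \<omega>)))"
  define g where "g = (\<lambda>t. ?E (\<lambda>\<omega>. (norm (gradF (x t \<omega>)))\<^sup>2))"
  define h where "h = (\<lambda>t. ?E (\<lambda>\<omega>. (norm (direction t \<omega>))\<^sup>2))"
  define k where "k = \<eta>\<^sub>0 / \<gamma>\<^sup>2"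
  define c where "c = 2 * \<tau> / (\<gamma>\<^sup>2 * \<alpha>)"
  define N where "N = 36 * \<tau> * \<eta>\<^sub>1\<^sup>2 * M\<^sup>2 / (\<gamma>\<^sup>2 * \<alpha>)"
  note pos = A.constants(3) \<alpha>(1) \<tau>(1) \<eta>(1)
  have \<eta>\<^sub>0_pos: "0 < \<eta>\<^sub>0" using pos by (simp add: \<eta>\<^sub>0)
  have c_pos: "0 < c" using pos by (simp add: c_def)
  have \<gamma>\<alpha>: "\<gamma> * \<alpha> \<le> 1 / 4"
  proof -
    have "4 * \<alpha> \<le> 1 / \<gamma>" using \<alpha>(2) A.constants(1) by linarith
    then show ?thesis using pos by (simp add: field_simps)
  qed
  have \<eta>\<alpha>: "\<alpha> * \<eta>\<^sub>1 \<le> 1"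
  proof -
    have "\<gamma>\<^sup>2 * (1 / \<gamma> - \<delta>\<phi>) \<le> \<gamma>\<^sup>2 * (1 / \<gamma>)" using A.constants by (intro mult_left_mono) auto
    also have "\<dots> = \<gamma>" using pos by (simp add: power2_eq_square)
    finally have "\<gamma>\<^sup>2 * (1 / \<gamma> - \<delta>\<phi>) / 2 \<le> \<gamma> / 2" by (rule divide_right_mono) simp
    with \<eta>(2) have "\<eta>\<^sub>1 \<le> \<gamma> / 2" by (rule order_trans)
    then have "\<alpha> * \<eta>\<^sub>1 \<le> \<alpha> * (\<gamma> / 2)" using pos by (intro mult_left_mono) auto
    then show ?thesis using \<gamma>\<alpha> by (simp add: mult.commute)
  qed
  have small: "\<eta>\<^sub>0 / (\<gamma>\<^sup>2 * (1 / \<gamma> - \<delta>\<psi>)) \<le> 1 / 4"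
  proof -
    have "(\<gamma> * \<alpha>)\<^sup>2 \<le> 1\<^sup>2" using \<gamma>\<alpha> pos by (intro power_mono) auto
    then have "\<tau> \<le> 1 / 4" using \<tau>(2) by (simp add: power_mult_distrib)
    then have "\<tau> * \<eta>\<^sub>1 \<le> 1 / 4 * (\<gamma>\<^sup>2 * (1 / \<gamma> - \<delta>\<psi>) / 2)" using \<eta>(1,3) \<tau>(1) by (intro mult_mono) auto
    also have "\<dots> \<le> 1 / 4 * (\<gamma>\<^sup>2 * (1 / \<gamma> - \<delta>\<psi>))" using B.modulus_pos by simp
    finally show ?thesis using B.modulus_pos pos by (simp add: \<eta>\<^sub>0 pos_divide_le_eq)
  qed
  \<comment> \<open>The drift constant of both saddle points, weighted by \<open>c\<close>, against the coefficient of the squared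
    direction in the descent inequality.\<close>
  have drift: "c * (\<eta>\<^sub>0\<^sup>2 / (6 * \<alpha>^3 * \<eta>\<^sub>1 * \<gamma>\<^sup>2)) \<le> \<eta>\<^sub>0 / 4"
  proof -
    have "\<tau> / (\<gamma>\<^sup>2 * \<alpha>\<^sup>2) \<le> 1 / 4" using \<tau>(2) pos by (simp add: divide_le_eq)
    then have "(\<tau> / (\<gamma>\<^sup>2 * \<alpha>\<^sup>2))\<^sup>2 \<le> (1 / 4)\<^sup>2" using pos by (intro power_mono) auto
    then have "\<eta>\<^sub>0 / 3 * (\<tau> / (\<gamma>\<^sup>2 * \<alpha>\<^sup>2))\<^sup>2 \<le> \<eta>\<^sub>0 / 3 * (1 / 4)\<^sup>2" using \<eta>\<^sub>0_pos by (intro mult_left_mono) auto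
    also have "\<dots> \<le> \<eta>\<^sub>0 / 4" using \<eta>\<^sub>0_pos by (simp add: power2_eq_square)
    finally have "\<eta>\<^sub>0 / 3 * (\<tau> / (\<gamma>\<^sup>2 * \<alpha>\<^sup>2))\<^sup>2 \<le> \<eta>\<^sub>0 / 4" .
    moreover have "c * (\<eta>\<^sub>0\<^sup>2 / (6 * \<alpha>^3 * \<eta>\<^sub>1 * \<gamma>\<^sup>2)) = \<eta>\<^sub>0 / 3 * (\<tau> / (\<gamma>\<^sup>2 * \<alpha>\<^sup>2))\<^sup>2"
      using pos by (simp add: c_def \<eta>\<^sub>0 field_simps power2_eq_square power3_eq_cube)
    ultimately show ?thesis by simp
  qed
  have h_nonneg: "0 \<le> h t" and g_nonneg: "0 \<le> g t" and D_nonneg: "0 \<le> tracking_error t" for t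
    by (simp_all add: h_def g_def tracking_error_def)

  have "(\<Sum>t<T. 2 * (\<eta>\<^sub>0 / 4) * g t + k * tracking_error t) \<le> f 0 + c * tracking_error 0 - f T + real T * N"
  proof (rule coupled_descent_telescope[where h = h])
    show "f (t + 1) \<le> f t - 2 * (\<eta>\<^sub>0 / 4) * g t - \<eta>\<^sub>0 / 4 * h t + k * tracking_error t" if "t < T" for t
      using moreau_descent[OF that \<eta>\<^sub>0_pos small] by (simp add: f_def g_def h_def k_def)
    show "c * tracking_error (t + 1) \<le> c * tracking_error t - 2 * k * tracking_error t + \<eta>\<^sub>0 / 4 * h t + N"
      if "t + 1 < T" for t
    proof -
      have "c * tracking_error (t + 1) \<le> c * ((1 - \<alpha> * \<eta>\<^sub>1) * tracking_error t
          + \<eta>\<^sub>0\<^sup>2 * h t / (6 * \<alpha>^3 * \<eta>\<^sub>1 * \<gamma>\<^sup>2) + 18 * \<eta>\<^sub>1\<^sup>2 * M\<^sup>2)"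
        unfolding h_def using tracking_error_recursion[OF that \<eta> \<alpha>] c_pos by (intro mult_left_mono) auto
      also have "\<dots> = c * tracking_error t - c * \<alpha> * \<eta>\<^sub>1 * tracking_error t
          + c * (\<eta>\<^sub>0\<^sup>2 / (6 * \<alpha>^3 * \<eta>\<^sub>1 * \<gamma>\<^sup>2)) * h t + c * (18 * \<eta>\<^sub>1\<^sup>2 * M\<^sup>2)"
        by (simp add: algebra_simps)
      also have "c * \<alpha> * \<eta>\<^sub>1 = 2 * k" using pos by (simp add: c_def k_def \<eta>\<^sub>0)
      also have "c * (18 * \<eta>\<^sub>1\<^sup>2 * M\<^sup>2) = N" by (simp add: c_def N_def)
      also have "c * tracking_error t - 2 * k * tracking_error t + c * (\<eta>\<^sub>0\<^sup>2 / (6 * \<alpha>^3 * \<eta>\<^sub>1 * \<gamma>\<^sup>2)) * h t + N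
          \<le> c * tracking_error t - 2 * k * tracking_error t + \<eta>\<^sub>0 / 4 * h t + N"
        by (intro add_mono order_refl mult_right_mono drift h_nonneg)
      finally show ?thesis .
    qed
    show "2 * k \<le> c"
    proof -
      have "2 * k = c * (\<alpha> * \<eta>\<^sub>1)" using pos by (simp add: c_def k_def \<eta>\<^sub>0)
      also have "\<dots> \<le> c * 1" using \<eta>\<alpha> c_pos by (intro mult_left_mono) auto
      finally show ?thesis by simp
    qed
    show "0 \<le> N" using pos by (simp add: N_def)
  qed (use h_nonneg D_nonneg \<eta>\<^sub>0_pos T in auto)
  moreover have "Fstar \<le> f T"
    unfolding f_def
    using iterates_square_integrable[of T] by (intro integral_ge_const integrable_F prob_space_axioms) (auto simp: lower)
  moreover have "f 0 = F x0"
  proof -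
    have "f 0 = ?E (\<lambda>\<omega>. F x0)"
      unfolding f_def by (intro Bochner_Integration.integral_cong) (simp_all add: init(5))
    then show ?thesis by (simp add: prob_space)
  qed
  ultimately have total: "(\<Sum>t<T. 2 * (\<eta>\<^sub>0 / 4) * g t + k * tracking_error t)
      \<le> F x0 - Fstar + c * tracking_error 0 + real T * N" by linarith
  have termwise: "\<tau> * \<eta>\<^sub>1 * criticality_gap t \<le> max 2 (\<gamma>\<^sup>2) * (2 * (\<eta>\<^sub>0 / 4) * g t + k * tracking_error t)" for t
  proof -
    have gap: "criticality_gap t \<le> tracking_error t + g t"
      by (simp add: criticality_gap_def tracking_error_def g_def)
    have "\<eta>\<^sub>0 * g t \<le> max 2 (\<gamma>\<^sup>2) * (1 / 2) * (\<eta>\<^sub>0 * g t)"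
      using mult_right_mono[of 1 "max 2 (\<gamma>\<^sup>2) * (1 / 2)" "\<eta>\<^sub>0 * g t"] \<eta>\<^sub>0_pos g_nonneg[of t] by simp
    moreover have "\<eta>\<^sub>0 * tracking_error t \<le> max 2 (\<gamma>\<^sup>2) * (1 / \<gamma>\<^sup>2) * (\<eta>\<^sub>0 * tracking_error t)"
    proof -
      have "1 \<le> max 2 (\<gamma>\<^sup>2) * (1 / \<gamma>\<^sup>2)" using pos by (simp add: pos_le_divide_eq)
      from mult_right_mono[OF this, of "\<eta>\<^sub>0 * tracking_error t"] \<eta>\<^sub>0_pos D_nonneg[of t] show ?thesis by simp
    qed
    moreover have "\<eta>\<^sub>0 * criticality_gap t \<le> \<eta>\<^sub>0 * tracking_error t + \<eta>\<^sub>0 * g t"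
      using mult_left_mono[OF gap, of \<eta>\<^sub>0] \<eta>\<^sub>0_pos by (simp add: distrib_left)
    moreover have "max 2 (\<gamma>\<^sup>2) * (2 * (\<eta>\<^sub>0 / 4) * g t + k * tracking_error t)
        = max 2 (\<gamma>\<^sup>2) * (1 / 2) * (\<eta>\<^sub>0 * g t) + max 2 (\<gamma>\<^sup>2) * (1 / \<gamma>\<^sup>2) * (\<eta>\<^sub>0 * tracking_error t)"
      by (simp add: k_def distrib_left)
    ultimately show ?thesis unfolding \<eta>\<^sub>0[symmetric] by linarith
  qed
  have "\<tau> * \<eta>\<^sub>1 * (\<Sum>t<T. criticality_gap t)
      \<le> max 2 (\<gamma>\<^sup>2) * (\<Sum>t<T. 2 * (\<eta>\<^sub>0 / 4) * g t + k * tracking_error t)"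
    unfolding sum_distrib_left by (rule sum_mono) (use termwise in simp)
  also have "\<dots> \<le> max 2 (\<gamma>\<^sup>2) * (F x0 - Fstar + c * tracking_error 0 + real T * N)"
    using total by (intro mult_left_mono) auto
  finally show ?thesis by (simp only: c_def N_def)
qed

text \<open>
Both outputs are compared with the proximal points of the centre one step earlier.  The distance of
\<open>x\<^sub>\<phi>\<close> from the proximal point of the other function is the sum of its own tracking error and
\<open>\<gamma> \<bar>\<nabla>F\<bar>\<close>, because the gradient of \<open>F\<close> is the difference of the two proximal points over \<open>\<gamma>\<close>.
\<close>

lemma nearly_critical_outputs:
  assumes T: "1 \<le> T" and \<epsilon>: "0 \<le> \<epsilon>"
    and bound: "1 / real T * (\<Sum>t<T. criticality_gap t) \<le> min 1 (1 / \<gamma>\<^sup>2) * \<epsilon>\<^sup>2 / 4"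
  defines "Q \<equiv> P \<Otimes>\<^sub>M uniform_count_measure {1..T}"
  shows "nearly_critical Q A.\<Phi> B.\<Phi> \<epsilon> (\<lambda>(\<omega>, t). x\<phi> t \<omega>)"
    and "nearly_critical Q A.\<Phi> B.\<Phi> \<epsilon> (\<lambda>(\<omega>, t). x\<psi> t \<omega>)"
proof -
  interpret U: prob_space "uniform_count_measure {1..T}" using T by (intro prob_space_uniform_count_measure) auto
  interpret PU: pair_prob_space P "uniform_count_measure {1..T}" ..
  have Q: "prob_space Q" unfolding Q_def by (rule PU.prob_space_axioms)
  interpret Q: prob_space Q by (rule Q)
  note time = square_integrable_uniform_time[OF prob_space_axioms T, folded Q_def, unfolded case_prod_beta]
    uniform_time_second_moment[OF prob_space_axioms T, folded Q_def, unfolded case_prod_beta]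
  define X\<phi> where "X\<phi> = (\<lambda>p. x\<phi> (snd p) (fst p))"
  define X\<psi> where "X\<psi> = (\<lambda>p. x\<psi> (snd p) (fst p))"
  define C where "C = (\<lambda>p. x (snd p - 1) (fst p))"
  have sq: "square_integrable P (x\<phi> t)" "square_integrable P (x\<psi> t)" "square_integrable P (x (t - 1))"
    if "t \<in> {1..T}" for t
    using that iterates_square_integrable[of t] iterates_square_integrable[of "t - 1"] by auto
  have sqQ: "square_integrable Q X\<phi>" "square_integrable Q X\<psi>" "square_integrable Q C"
    unfolding X\<phi>_def X\<psi>_def C_def by (rule time(1), erule sq)+
  have shift: "(\<Sum>t\<in>{1..T}. h t) = (\<Sum>t<T. h (t + 1))" for h :: "nat \<Rightarrow> real"
    by (rule sum.reindex_bij_witness[of _ "\<lambda>t. t + 1" "\<lambda>t. t - 1"]) auto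
  have mean: "Q.expectation (\<lambda>p. (norm (W (snd p) (fst p)))\<^sup>2)
      = 1 / real T * (\<Sum>t<T. expectation (\<lambda>\<omega>. (norm (W (t + 1) \<omega>))\<^sup>2))"
    if "\<And>t. t \<in> {1..T} \<Longrightarrow> square_integrable P (W t)" for W :: "nat \<Rightarrow> 'w \<Rightarrow> 'x"
    using time(2)[of W, OF that] unfolding shift .
  define a where "a = Q.expectation (\<lambda>p. (norm (X\<phi> p - A.prx (C p)))\<^sup>2)"
  define b where "b = Q.expectation (\<lambda>p. (norm (X\<psi> p - B.prx (C p)))\<^sup>2)"
  define g where "g = Q.expectation (\<lambda>p. (norm (gradF (C p)))\<^sup>2)"
  have a: "a = 1 / real T * (\<Sum>t<T. expectation (\<lambda>\<omega>. (norm (x\<phi> (t + 1) \<omega> - A.prx (x t \<omega>)))\<^sup>2))"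
    unfolding a_def X\<phi>_def C_def
    by (rule mean[of "\<lambda>t \<omega>. x\<phi> t \<omega> - A.prx (x (t - 1) \<omega>)", unfolded add_diff_cancel_right'],
        rule square_integrable_diff[OF sq(1) A.square_integrable_prx[OF prob_space_axioms sq(3)]])
  have b: "b = 1 / real T * (\<Sum>t<T. expectation (\<lambda>\<omega>. (norm (x\<psi> (t + 1) \<omega> - B.prx (x t \<omega>)))\<^sup>2))"
    unfolding b_def X\<psi>_def C_def
    by (rule mean[of "\<lambda>t \<omega>. x\<psi> t \<omega> - B.prx (x (t - 1) \<omega>)", unfolded add_diff_cancel_right'],
        rule square_integrable_diff[OF sq(2) B.square_integrable_prx[OF prob_space_axioms sq(3)]])
  have g: "g = 1 / real T * (\<Sum>t<T. expectation (\<lambda>\<omega>. (norm (gradF (x t \<omega>)))\<^sup>2))"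
    unfolding g_def C_def
    by (rule mean[of "\<lambda>t \<omega>. gradF (x (t - 1) \<omega>)", unfolded add_diff_cancel_right'],
        rule square_integrable_gradF[OF prob_space_axioms sq(3)])
  have nonneg: "0 \<le> a" "0 \<le> b" "0 \<le> g" by (simp_all add: a_def b_def g_def)
  have "a + b + g = 1 / real T * (\<Sum>t<T. criticality_gap t)"
    unfolding a b g criticality_gap_def by (simp only: sum.distrib distrib_left)
  with bound have total: "a + b + g \<le> min 1 (1 / \<gamma>\<^sup>2) * (\<epsilon>\<^sup>2 / 4)" by simp
  have "min 1 (1 / \<gamma>\<^sup>2) * (\<epsilon>\<^sup>2 / 4) \<le> 1 * (\<epsilon>\<^sup>2 / 4)"
    by (intro mult_right_mono) auto
  with total have quarter: "a + b + g \<le> \<epsilon>\<^sup>2 / 4" by linarith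
  have scaled: "\<gamma>\<^sup>2 * (a + b + g) \<le> \<epsilon>\<^sup>2 / 4"
  proof -
    have "min 1 (1 / \<gamma>\<^sup>2) * (\<epsilon>\<^sup>2 / 4) \<le> 1 / \<gamma>\<^sup>2 * (\<epsilon>\<^sup>2 / 4)"
      by (intro mult_right_mono) auto
    with total have "a + b + g \<le> 1 / \<gamma>\<^sup>2 * (\<epsilon>\<^sup>2 / 4)" by linarith
    then have "\<gamma>\<^sup>2 * (a + b + g) \<le> \<gamma>\<^sup>2 * (1 / \<gamma>\<^sup>2 * (\<epsilon>\<^sup>2 / 4))" by (rule mult_left_mono) simp
    then show ?thesis using A.constants(3) by simp
  qed
  have cross: "Q.expectation (\<lambda>p. (norm (W p + r *\<^sub>R gradF (C p)))\<^sup>2) \<le> \<epsilon>\<^sup>2"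
    if W: "square_integrable Q W" and le: "Q.expectation (\<lambda>p. (norm (W p))\<^sup>2) \<le> a + b" and r: "r\<^sup>2 = \<gamma>\<^sup>2" for W r
  proof -
    note sqg = square_integrable_gradF[OF Q sqQ(3)]
    note int = square_integrable_norm_sq[OF W] square_integrable_norm_sq[OF sqg]
    have "Q.expectation (\<lambda>p. (norm (W p + r *\<^sub>R gradF (C p)))\<^sup>2)
        \<le> Q.expectation (\<lambda>p. 2 * (norm (W p))\<^sup>2 + 2 * \<gamma>\<^sup>2 * (norm (gradF (C p)))\<^sup>2)"
    proof (rule integral_mono)
      show "integrable Q (\<lambda>p. (norm (W p + r *\<^sub>R gradF (C p)))\<^sup>2)"
        by (intro square_integrable_norm_sq square_integrable_add square_integrable_scaleR[of Q "\<lambda>p. gradF (C p)"] W sqg)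
      show "integrable Q (\<lambda>p. 2 * (norm (W p))\<^sup>2 + 2 * \<gamma>\<^sup>2 * (norm (gradF (C p)))\<^sup>2)"
        by (intro Bochner_Integration.integrable_add integrable_mult_right int)
      show "(norm (W p + r *\<^sub>R gradF (C p)))\<^sup>2 \<le> 2 * (norm (W p))\<^sup>2 + 2 * \<gamma>\<^sup>2 * (norm (gradF (C p)))\<^sup>2" for p
        using norm_add_sq_le[of "W p" "r *\<^sub>R gradF (C p)"]
        by (simp only: norm_scaleR[of r] power_mult_distrib[of "\<bar>r\<bar>"] power2_abs r mult.assoc)
    qed
    also have "\<dots> = 2 * Q.expectation (\<lambda>p. (norm (W p))\<^sup>2) + 2 * \<gamma>\<^sup>2 * g"
    proof -
      have "Q.expectation (\<lambda>p. 2 * u p + 2 * \<gamma>\<^sup>2 * v p) = 2 * Q.expectation u + 2 * \<gamma>\<^sup>2 * Q.expectation v"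
        if "integrable Q u" "integrable Q v" for u v using that by simp
      from this[OF int] show ?thesis by (simp only: g_def)
    qed
    also have "\<dots> \<le> 2 * (a + b) + 2 * \<gamma>\<^sup>2 * g" using le by simp
    also have "\<dots> \<le> 2 * (a + b) + 2 * (\<gamma>\<^sup>2 * (a + b + g))"
      using nonneg by (simp add: mult_left_mono)
    also have "2 * (a + b) + 2 * (\<gamma>\<^sup>2 * (a + b + g)) \<le> 2 * (\<epsilon>\<^sup>2 / 4) + 2 * (\<epsilon>\<^sup>2 / 4)"
      using quarter scaled nonneg by (intro add_mono mult_left_mono) linarith+
    finally show ?thesis by simp
  qed
  have own: "a \<le> \<epsilon>\<^sup>2" "b \<le> \<epsilon>\<^sup>2" "g \<le> \<epsilon>\<^sup>2" using quarter nonneg zero_le_power2[of \<epsilon>] by linarith+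
  have sqA: "square_integrable Q (\<lambda>p. X\<phi> p - A.prx (C p))" and sqB: "square_integrable Q (\<lambda>p. X\<psi> p - B.prx (C p))"
    by (intro square_integrable_diff sqQ A.square_integrable_prx B.square_integrable_prx Q)+
  have "nearly_critical Q A.\<Phi> B.\<Phi> \<epsilon> X\<phi>"
  proof (rule nearly_criticalI[OF Q \<epsilon> sqQ(1,3)])
    have "X\<phi> p - B.prx (C p) = (X\<phi> p - A.prx (C p)) + (- \<gamma>) *\<^sub>R gradF (C p)" for p
      using A.constants(3) by (simp add: algebra_simps)
    then show "Q.expectation (\<lambda>p. (norm (X\<phi> p - B.prx (C p)))\<^sup>2) \<le> \<epsilon>\<^sup>2"
      using cross[OF sqA, of "- \<gamma>"] nonneg by (simp only: a_def[symmetric]) simp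
  qed (use own in \<open>simp_all only: a_def g_def\<close>)
  then show "nearly_critical Q A.\<Phi> B.\<Phi> \<epsilon> (\<lambda>(\<omega>, t). x\<phi> t \<omega>)"
    by (simp only: X\<phi>_def case_prod_beta')
  have "nearly_critical Q A.\<Phi> B.\<Phi> \<epsilon> X\<psi>"
  proof (rule nearly_criticalI[OF Q \<epsilon> sqQ(2,3)])
    have "X\<psi> p - A.prx (C p) = (X\<psi> p - B.prx (C p)) + \<gamma> *\<^sub>R gradF (C p)" for p
      using A.constants(3) by (simp add: algebra_simps)
    then show "Q.expectation (\<lambda>p. (norm (X\<psi> p - A.prx (C p)))\<^sup>2) \<le> \<epsilon>\<^sup>2"
      using cross[OF sqB, of \<gamma>] nonneg by (simp only: b_def[symmetric])
  qed (use own in \<open>simp_all only: b_def g_def\<close>)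
  then show "nearly_critical Q A.\<Phi> B.\<Phi> \<epsilon> (\<lambda>(\<omega>, t). x\<psi> t \<omega>)"
    by (simp only: X\<psi>_def case_prod_beta')
qed

end

section \<open>Convergence of SMAG\<close>

theorem theoremA2:
  fixes Y :: "'y::euclidean_space set" and Z :: "'z::euclidean_space set"
    and \<phi> :: "'x::euclidean_space \<Rightarrow> 'y \<Rightarrow> real" and \<psi> :: "'x \<Rightarrow> 'z \<Rightarrow> real"
    and \<Phi> \<Psi> F\<gamma> :: "'x \<Rightarrow> real"
    and D\<xi> :: "'s measure" and \<phi>s :: "'x \<Rightarrow> 'y \<Rightarrow> 's \<Rightarrow> real"
    and D\<zeta> :: "'r measure" and \<psi>s :: "'x \<Rightarrow> 'z \<Rightarrow> 'r \<Rightarrow> real"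
    and P :: "'w measure" and \<F> :: "nat \<Rightarrow> 'w measure"
    and gx :: "nat \<Rightarrow> 'x \<Rightarrow> 'y \<Rightarrow> 'w \<Rightarrow> 'x" and gy :: "nat \<Rightarrow> 'x \<Rightarrow> 'y \<Rightarrow> 'w \<Rightarrow> 'y"
    and hx :: "nat \<Rightarrow> 'x \<Rightarrow> 'z \<Rightarrow> 'w \<Rightarrow> 'x" and hz :: "nat \<Rightarrow> 'x \<Rightarrow> 'z \<Rightarrow> 'w \<Rightarrow> 'z"
    and x\<phi>0 x\<psi>0 x0 :: 'x and y0 :: 'y and z0 :: 'z
    and x\<phi> x\<psi> x :: "nat \<Rightarrow> 'w \<Rightarrow> 'x" and y :: "nat \<Rightarrow> 'w \<Rightarrow> 'y" and z :: "nat \<Rightarrow> 'w \<Rightarrow> 'z"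
    and \<delta>\<phi> \<delta>\<psi> \<mu>\<phi> \<mu>\<psi> L\<phi> L\<psi> M Fstar \<epsilon> :: real
    and \<gamma> \<alpha> \<tau> \<nu> LF \<eta>\<^sub>0 \<eta>\<^sub>1 P\<^sub>0 :: real
    and T :: nat
  assumes Y: "convex Y" "compact Y" and Z: "convex Z" "compact Z"
    (* the objective functions *)
    and D\<xi>: "prob_space D\<xi>" and D\<zeta>: "prob_space D\<zeta>"
    and \<phi>: "\<And>u v. v \<in> Y \<Longrightarrow> integrable D\<xi> (\<phi>s u v) \<and> \<phi> u v = (\<integral>s. \<phi>s u v s \<partial>D\<xi>)"
    and \<psi>: "\<And>u v. v \<in> Z \<Longrightarrow> integrable D\<zeta> (\<psi>s u v) \<and> \<psi> u v = (\<integral>s. \<psi>s u v s \<partial>D\<zeta>)"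
    and \<Phi>: "\<Phi> = max_over Y \<phi>" and \<Psi>: "\<Psi> = max_over Z \<psi>"
    and F\<gamma>: "F\<gamma> = (\<lambda>u. moreau_env \<gamma> \<Phi> u - moreau_env \<gamma> \<Psi> u)"
    and constants_pos: "\<delta>\<phi> > 0" "\<delta>\<psi> > 0" "\<mu>\<phi> > 0" "\<mu>\<psi> > 0" "L\<phi> > 0" "L\<psi> > 0" "M > 0"
    (* (i) *)
    and weakly_convex: "\<And>v. v \<in> Y \<Longrightarrow> weakly_convex \<delta>\<phi> (\<lambda>u. \<phi> u v)"
                       "\<And>v. v \<in> Z \<Longrightarrow> weakly_convex \<delta>\<psi> (\<lambda>u. \<psi> u v)"
    (* (ii) *)
    and strongly_concave: "\<And>u. strongly_concave_on \<mu>\<phi> Y (\<phi> u)"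
                          "\<And>u. strongly_concave_on \<mu>\<psi> Z (\<psi> u)"
    (* (iii) *)
    and differentiable: "\<And>u v. v \<in> Y \<Longrightarrow> \<phi> u differentiable (at v)"
                        "\<And>u v. v \<in> Z \<Longrightarrow> \<psi> u differentiable (at v)"
    and Lipschitz: "\<And>v. v \<in> Y \<Longrightarrow> L\<phi>-lipschitz_on UNIV (\<lambda>u. gradient (\<phi> u) v)"
                   "\<And>v. v \<in> Z \<Longrightarrow> L\<psi>-lipschitz_on UNIV (\<lambda>u. gradient (\<psi> u) v)"
    (* (iv) *)
    and lower_bound: "\<And>u. Fstar \<le> F\<gamma> u"
    (* (v) *)
    and P: "prob_space P"
    and estimators:
      "\<And>t u v. t < T \<Longrightarrow> v \<in> Y \<Longrightarrow>
         unbiased_estimator P (M\<^sup>2) (subdifferential (\<lambda>u'. \<phi> u' v) u) (gx t u v)"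
      "\<And>t u v. t < T \<Longrightarrow> v \<in> Y \<Longrightarrow> unbiased_estimator P (M\<^sup>2) {gradient (\<phi> u) v} (gy t u v)"
      "\<And>t u v. t < T \<Longrightarrow> v \<in> Z \<Longrightarrow>
         unbiased_estimator P (M\<^sup>2) (subdifferential (\<lambda>u'. \<psi> u' v) u) (hx t u v)"
      "\<And>t u v. t < T \<Longrightarrow> v \<in> Z \<Longrightarrow> unbiased_estimator P (M\<^sup>2) {gradient (\<psi> u) v} (hz t u v)"
    (* the algorithm *)
    and initial: "y0 \<in> Y" "z0 \<in> Z"
    and smag: "\<And>\<omega>. \<omega> \<in> space P \<Longrightarrow>
      smag_path Y Z \<gamma> \<eta>\<^sub>0 \<eta>\<^sub>1 T gx gy hx hz x\<phi>0 y0 x\<psi>0 z0 x0 x\<phi> y x\<psi> z x \<omega>"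
    (* the estimates used at iteration t, conditionally on the past *)
    and filtration: "filtration (space P) \<F>" "\<And>t. subalgebra P (\<F> t)"
    and adapted: "\<And>t. t < T \<Longrightarrow> (\<lambda>\<omega>. gx t (x\<phi> t \<omega>) (y t \<omega>) \<omega>) \<in> borel_measurable (\<F> (t + 1))"
                 "\<And>t. t < T \<Longrightarrow> (\<lambda>\<omega>. gy t (x\<phi> t \<omega>) (y t \<omega>) \<omega>) \<in> borel_measurable (\<F> (t + 1))"
                 "\<And>t. t < T \<Longrightarrow> (\<lambda>\<omega>. hx t (x\<psi> t \<omega>) (z t \<omega>) \<omega>) \<in> borel_measurable (\<F> (t + 1))"
                 "\<And>t. t < T \<Longrightarrow> (\<lambda>\<omega>. hz t (x\<psi> t \<omega>) (z t \<omega>) \<omega>) \<in> borel_measurable (\<F> (t + 1))"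
    and cond_estimators:
      "\<And>t. t < T \<Longrightarrow> cond_unbiased_estimator P (\<F> t) (M\<^sup>2)
         (\<lambda>\<omega>. subdifferential (\<lambda>u. \<phi> u (y t \<omega>)) (x\<phi> t \<omega>)) (\<lambda>\<omega>. gx t (x\<phi> t \<omega>) (y t \<omega>) \<omega>)"
      "\<And>t. t < T \<Longrightarrow> cond_unbiased_estimator P (\<F> t) (M\<^sup>2)
         (\<lambda>\<omega>. {gradient (\<phi> (x\<phi> t \<omega>)) (y t \<omega>)}) (\<lambda>\<omega>. gy t (x\<phi> t \<omega>) (y t \<omega>) \<omega>)"
      "\<And>t. t < T \<Longrightarrow> cond_unbiased_estimator P (\<F> t) (M\<^sup>2)
         (\<lambda>\<omega>. subdifferential (\<lambda>u. \<psi> u (z t \<omega>)) (x\<psi> t \<omega>)) (\<lambda>\<omega>. hx t (x\<psi> t \<omega>) (z t \<omega>) \<omega>)"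
      "\<And>t. t < T \<Longrightarrow> cond_unbiased_estimator P (\<F> t) (M\<^sup>2)
         (\<lambda>\<omega>. {gradient (\<psi> (x\<psi> t \<omega>)) (z t \<omega>)}) (\<lambda>\<omega>. hz t (x\<psi> t \<omega>) (z t \<omega>) \<omega>)"
    (* the parameters *)
    and \<epsilon>: "\<epsilon> > 0"
    and \<gamma>: "0 < \<gamma>" "\<gamma> < min (inverse \<delta>\<phi>) (inverse \<delta>\<psi>)"
    and \<alpha>: "\<alpha> = Min {(1 / \<gamma> - \<delta>\<phi>) / 4, (1 / \<gamma> - \<delta>\<psi>) / 4, \<mu>\<phi>, \<mu>\<psi>}"
    and \<tau>: "\<tau> = Min {\<gamma>\<^sup>2 * \<alpha>\<^sup>2 / 4,
                      \<mu>\<phi> powr (3 / 2) * \<gamma>\<^sup>2 * \<alpha> powr (3 / 2) / (4 * L\<phi>),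
                      \<mu>\<psi> powr (3 / 2) * \<gamma>\<^sup>2 * \<alpha> powr (3 / 2) / (4 * L\<psi>)}"
    and \<nu>: "\<nu> = min 1 (2 * \<tau> / (\<gamma>\<^sup>2 * \<alpha>))"
    and LF: "LF = 2 / (\<gamma> - \<gamma>\<^sup>2 * min \<delta>\<psi> \<delta>\<phi>)"
    and \<eta>\<^sub>1: "\<eta>\<^sub>1 = Min {\<gamma>\<^sup>2 * (1 / \<gamma> - \<delta>\<phi>) / 2, \<gamma>\<^sup>2 * (1 / \<gamma> - \<delta>\<psi>) / 2, 1 / (2 * LF * \<tau>),
                        min 1 (\<gamma>\<^sup>2) * min \<alpha> \<tau> * \<nu> * \<alpha> / (768 * \<tau> * M\<^sup>2) * \<epsilon>\<^sup>2}"
    and \<eta>\<^sub>0: "\<eta>\<^sub>0 = \<tau> * \<eta>\<^sub>1"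
    and P\<^sub>0: "P\<^sub>0 = 2 * \<eta>\<^sub>0 / (\<eta>\<^sub>1 * \<gamma>\<^sup>2 * \<alpha>) *
          ((\<integral>\<omega>. (norm (x\<phi> 1 \<omega> - prox \<gamma> \<Phi> x0))\<^sup>2 \<partial>P)
         + (\<integral>\<omega>. (norm (y 1 \<omega> - argmax_over Y \<phi> (prox \<gamma> \<Phi> x0)))\<^sup>2 \<partial>P)
         + (\<integral>\<omega>. (norm (x\<psi> 1 \<omega> - prox \<gamma> \<Psi> x0))\<^sup>2 \<partial>P)
         + (\<integral>\<omega>. (norm (z 1 \<omega> - argmax_over Z \<psi> (prox \<gamma> \<Psi> x0)))\<^sup>2 \<partial>P))"
    and T_pos: "T \<ge> 1"
    and T: "real T \<ge> 16 * (F\<gamma> x0 - Fstar + P\<^sub>0) / (min 1 (1 / \<gamma>\<^sup>2) * min \<alpha> \<tau> * \<nu> * \<epsilon>\<^sup>2) *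
          Max {2 / (\<gamma>\<^sup>2 * (1 / \<gamma> - \<delta>\<phi>)), 2 / (\<gamma>\<^sup>2 * (1 / \<gamma> - \<delta>\<psi>)), 2 * LF * \<tau>,
               768 * \<tau> * M\<^sup>2 / (min 1 (\<gamma>\<^sup>2) * min \<alpha> \<tau> * \<nu> * \<alpha> * \<epsilon>\<^sup>2)}"
  shows
    "(\<forall>t<T. integrable P (\<lambda>\<omega>. (norm (x\<phi> (t + 1) \<omega> - prox \<gamma> \<Phi> (x t \<omega>)))\<^sup>2) \<and>
            integrable P (\<lambda>\<omega>. (norm (x\<psi> (t + 1) \<omega> - prox \<gamma> \<Psi> (x t \<omega>)))\<^sup>2) \<and>
            integrable P (\<lambda>\<omega>. (norm (gradient F\<gamma> (x t \<omega>)))\<^sup>2)) \<and>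
     1 / real T * (\<Sum>t<T. (\<integral>\<omega>. (norm (x\<phi> (t + 1) \<omega> - prox \<gamma> \<Phi> (x t \<omega>)))\<^sup>2 \<partial>P)
                        + (\<integral>\<omega>. (norm (x\<psi> (t + 1) \<omega> - prox \<gamma> \<Psi> (x t \<omega>)))\<^sup>2 \<partial>P)
                        + (\<integral>\<omega>. (norm (gradient F\<gamma> (x t \<omega>)))\<^sup>2 \<partial>P))
       \<le> min 1 (1 / \<gamma>\<^sup>2) * \<epsilon>\<^sup>2 / 4 \<and>
     nearly_critical (P \<Otimes>\<^sub>M uniform_count_measure {1..T}) \<Phi> \<Psi> \<epsilon> (\<lambda>(\<omega>, t). x\<phi> t \<omega>) \<and>
     nearly_critical (P \<Otimes>\<^sub>M uniform_count_measure {1..T}) \<Phi> \<Psi> \<epsilon> (\<lambda>(\<omega>, t). x\<psi> t \<omega>)"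
proof -
  have t0: "0 < T" using T_pos by simp
  have \<gamma>\<delta>: "\<gamma> * \<delta>\<phi> < 1" "\<gamma> * \<delta>\<psi> < 1"
    using \<gamma> constants_pos by (simp_all add: field_simps)
  interpret run: smag_run Y \<phi> \<delta>\<phi> \<mu>\<phi> Z \<psi> \<delta>\<psi> \<mu>\<psi> \<gamma> M P \<F> T \<eta>\<^sub>0 \<eta>\<^sub>1
    "\<lambda>t \<omega>. gx t (x\<phi> t \<omega>) (y t \<omega>) \<omega>" "\<lambda>t \<omega>. hx t (x\<psi> t \<omega>) (z t \<omega>) \<omega>"
    "\<lambda>t \<omega>. gy t (x\<phi> t \<omega>) (y t \<omega>) \<omega>" "\<lambda>t \<omega>. hz t (x\<psi> t \<omega>) (z t \<omega>) \<omega>"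
    x\<phi> x\<psi> x y z x\<phi>0 x\<psi>0 x0 y0 z0
  proof -
    \<comment> \<open>The mean of the unconditional estimator at time \<open>0\<close> is a subgradient of norm at most \<open>M\<close>.\<close>
    have A: "strongly_concave_max Y \<phi> \<delta>\<phi> \<mu>\<phi> \<gamma> M"
      by unfold_locales (use Y initial constants_pos \<gamma>(1) \<gamma>\<delta> weakly_convex strongly_concave differentiable
        unbiased_estimator_bound[OF P estimators(1)[OF t0]] in auto)
    have B: "strongly_concave_max Z \<psi> \<delta>\<psi> \<mu>\<psi> \<gamma> M"
      by unfold_locales (use Z initial constants_pos \<gamma>(1) \<gamma>\<delta> weakly_convex strongly_concave differentiable
        unbiased_estimator_bound[OF P estimators(3)[OF t0]] in auto)
    note path = smag[unfolded smag_path_def Let_def]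
    have G: "(1 / \<gamma>) *\<^sub>R (u - p) - (1 / \<gamma>) *\<^sub>R (u - q) = (1 / \<gamma>) *\<^sub>R (q - p)" for u p q :: 'x
      by (simp add: algebra_simps)
    have "smag_run_axioms Y \<phi> Z \<psi> \<gamma> M P \<F> T \<eta>\<^sub>0 \<eta>\<^sub>1
      (\<lambda>t \<omega>. gx t (x\<phi> t \<omega>) (y t \<omega>) \<omega>) (\<lambda>t \<omega>. hx t (x\<psi> t \<omega>) (z t \<omega>) \<omega>)
      (\<lambda>t \<omega>. gy t (x\<phi> t \<omega>) (y t \<omega>) \<omega>) (\<lambda>t \<omega>. hz t (x\<psi> t \<omega>) (z t \<omega>) \<omega>)
      x\<phi> x\<psi> x y z x\<phi>0 x\<psi>0 x0 y0 z0"
    proof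
      show "sets (\<F> t) \<subseteq> sets (\<F> (t + 1))" for t
        using filtration.sets_F_mono[OF filtration(1)] by simp
    qed (use filtration(2) adapted cond_estimators initial path G in \<open>simp_all add: G\<close>)
    then show "smag_run Y \<phi> \<delta>\<phi> \<mu>\<phi> Z \<psi> \<delta>\<psi> \<mu>\<psi> \<gamma> M P \<F> T \<eta>\<^sub>0 \<eta>\<^sub>1
      (\<lambda>t \<omega>. gx t (x\<phi> t \<omega>) (y t \<omega>) \<omega>) (\<lambda>t \<omega>. hx t (x\<psi> t \<omega>) (z t \<omega>) \<omega>)
      (\<lambda>t \<omega>. gy t (x\<phi> t \<omega>) (y t \<omega>) \<omega>) (\<lambda>t \<omega>. hz t (x\<psi> t \<omega>) (z t \<omega>) \<omega>)
      x\<phi> x\<psi> x y z x\<phi>0 x\<psi>0 x0 y0 z0"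
      by (intro smag_run.intro difference_of_max.intro A B P)
  qed
  note moduli = run.A.modulus_pos run.B.modulus_pos

  have \<alpha>_pos: "0 < \<alpha>" and \<alpha>_le: "4 * \<alpha> \<le> 1 / \<gamma> - \<delta>\<phi>" "4 * \<alpha> \<le> 1 / \<gamma> - \<delta>\<psi>" "\<alpha> \<le> \<mu>\<phi>" "\<alpha> \<le> \<mu>\<psi>"
    using moduli constants_pos by (auto simp: \<alpha> min_def)
  have \<tau>_pos: "0 < \<tau>" and \<tau>_le: "\<tau> \<le> \<gamma>\<^sup>2 * \<alpha>\<^sup>2 / 4"
    unfolding \<tau> using \<gamma>(1) \<alpha>_pos constants_pos by simp_all
  have \<nu>_pos: "0 < \<nu>" using \<gamma>(1) \<alpha>_pos \<tau>_pos by (simp add: \<nu>)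
  have LF_pos: "0 < LF"
  proof -
    have "\<gamma>\<^sup>2 * min \<delta>\<psi> \<delta>\<phi> \<le> \<gamma>\<^sup>2 * \<delta>\<phi>" by (intro mult_left_mono) auto
    also have "\<dots> = \<gamma> * (\<gamma> * \<delta>\<phi>)" by (simp add: power2_eq_square)
    also have "\<dots> < \<gamma> * 1" using \<gamma>(1) \<gamma>\<delta>(1) by (intro mult_strict_left_mono)
    finally show ?thesis by (simp add: LF)
  qed
  let ?c = "min 1 (\<gamma>\<^sup>2) * min \<alpha> \<tau> * \<nu> * \<alpha> / (768 * \<tau> * M\<^sup>2) * \<epsilon>\<^sup>2"
  have c_pos: "0 < ?c" using \<gamma>(1) \<alpha>_pos \<tau>_pos \<nu>_pos constants_pos \<epsilon> by simp
  have \<eta>\<^sub>1_pos: "0 < \<eta>\<^sub>1"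
    unfolding \<eta>\<^sub>1 using \<gamma>(1) \<tau>_pos LF_pos moduli c_pos by simp
  have \<eta>\<^sub>1_le: "\<eta>\<^sub>1 \<le> \<gamma>\<^sup>2 * (1 / \<gamma> - \<delta>\<phi>) / 2" "\<eta>\<^sub>1 \<le> \<gamma>\<^sup>2 * (1 / \<gamma> - \<delta>\<psi>) / 2" "\<eta>\<^sub>1 \<le> ?c"
    unfolding \<eta>\<^sub>1 by (intro Min_le; simp)+

  let ?R = "Max {2 / (\<gamma>\<^sup>2 * (1 / \<gamma> - \<delta>\<phi>)), 2 / (\<gamma>\<^sup>2 * (1 / \<gamma> - \<delta>\<psi>)), 2 * LF * \<tau>,
               768 * \<tau> * M\<^sup>2 / (min 1 (\<gamma>\<^sup>2) * min \<alpha> \<tau> * \<nu> * \<alpha> * \<epsilon>\<^sup>2)}"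
  \<comment> \<open>The entries of this maximum are the reciprocals of those of the minimum that defines \<open>\<eta>\<^sub>1\<close>.\<close>
  have R: "1 / \<eta>\<^sub>1 \<le> ?R"
  proof -
    have "\<eta>\<^sub>1 \<in> {\<gamma>\<^sup>2 * (1 / \<gamma> - \<delta>\<phi>) / 2, \<gamma>\<^sup>2 * (1 / \<gamma> - \<delta>\<psi>) / 2, 1 / (2 * LF * \<tau>), ?c}"
      unfolding \<eta>\<^sub>1 by (rule Min_in) auto
    from imageI[OF this, of "\<lambda>r. 1 / r"] have "1 / \<eta>\<^sub>1 \<in> {2 / (\<gamma>\<^sup>2 * (1 / \<gamma> - \<delta>\<phi>)), 2 / (\<gamma>\<^sup>2 * (1 / \<gamma> - \<delta>\<psi>)), 2 * LF * \<tau>,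
               768 * \<tau> * M\<^sup>2 / (min 1 (\<gamma>\<^sup>2) * min \<alpha> \<tau> * \<nu> * \<alpha> * \<epsilon>\<^sup>2)}"
      by simp
    then show ?thesis by (intro Max_ge) auto
  qed

  have F_eq: "F\<gamma> = (\<lambda>u. moreau_env \<gamma> (max_over Y \<phi>) u - moreau_env \<gamma> (max_over Z \<psi>) u)"
    by (simp only: F\<gamma> \<Phi> \<Psi>)
  have grad: "gradient F\<gamma> u = run.gradF u" for u
    unfolding F_eq by (rule GDERIV_imp_gradient[OF run.F_GDERIV])
  have lower: "Fstar \<le> moreau_env \<gamma> (max_over Y \<phi>) u - moreau_env \<gamma> (max_over Z \<psi>) u" for u
    using lower_bound[of u] by (simp only: F_eq)
  have P0: "P\<^sub>0 = 2 * \<tau> / (\<gamma>\<^sup>2 * \<alpha>) * run.tracking_error 0"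
  proof -
    have "run.tracking_error 0 = (\<integral>\<omega>. (norm (x\<phi> 1 \<omega> - prox \<gamma> \<Phi> x0))\<^sup>2 \<partial>P)
         + (\<integral>\<omega>. (norm (y 1 \<omega> - argmax_over Y \<phi> (prox \<gamma> \<Phi> x0)))\<^sup>2 \<partial>P)
         + (\<integral>\<omega>. (norm (x\<psi> 1 \<omega> - prox \<gamma> \<Psi> x0))\<^sup>2 \<partial>P)
         + (\<integral>\<omega>. (norm (z 1 \<omega> - argmax_over Z \<psi> (prox \<gamma> \<Psi> x0)))\<^sup>2 \<partial>P)"
      unfolding run.tracking_error_def \<Phi> \<Psi>
      by (intro arg_cong2[where f = "(+)"] Bochner_Integration.integral_cong) (simp_all add: run.init(5))
    moreover have "2 * \<eta>\<^sub>0 / (\<eta>\<^sub>1 * \<gamma>\<^sup>2 * \<alpha>) = 2 * \<tau> / (\<gamma>\<^sup>2 * \<alpha>)"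
      using \<eta>\<^sub>1_pos by (simp add: \<eta>\<^sub>0)
    ultimately show ?thesis by (simp only: P\<^sub>0)
  qed
  have gap_nonneg: "0 \<le> F\<gamma> x0 - Fstar + P\<^sub>0"
  proof -
    have "0 \<le> P\<^sub>0" unfolding P0 run.tracking_error_def using \<tau>_pos \<alpha>_pos by simp
    then show ?thesis using lower_bound[of x0] by simp
  qed
  have "\<tau> * \<eta>\<^sub>1 * (\<Sum>t<T. run.criticality_gap t)
    \<le> max 2 (\<gamma>\<^sup>2) * (F\<gamma> x0 - Fstar + P\<^sub>0 + real T * (36 * \<tau> * \<eta>\<^sub>1\<^sup>2 * M\<^sup>2 / (\<gamma>\<^sup>2 * \<alpha>)))"
    unfolding P0 F_eq
    by (rule run.sum_criticality_gap_le[OF T_pos lower \<alpha>_pos \<alpha>_le \<eta>\<^sub>1_pos \<eta>\<^sub>1_le(1,2) \<tau>_pos \<tau>_le \<eta>\<^sub>0])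
  then have bound: "1 / real T * (\<Sum>t<T. run.criticality_gap t) \<le> min 1 (1 / \<gamma>\<^sup>2) * \<epsilon>\<^sup>2 / 4"
    using constants_pos(7) \<eta>\<^sub>1_le(3) T
    by (intro averaged_bound[OF \<gamma>(1) \<alpha>_pos \<tau>_pos \<eta>\<^sub>1_pos _ \<epsilon> \<nu> _ _ R gap_nonneg T_pos])
  have integrable: "integrable P (\<lambda>\<omega>. (norm (x\<phi> (t + 1) \<omega> - prox \<gamma> \<Phi> (x t \<omega>)))\<^sup>2) \<and>
            integrable P (\<lambda>\<omega>. (norm (x\<psi> (t + 1) \<omega> - prox \<gamma> \<Psi> (x t \<omega>)))\<^sup>2) \<and>
            integrable P (\<lambda>\<omega>. (norm (gradient F\<gamma> (x t \<omega>)))\<^sup>2)" if "t < T" for t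
    unfolding grad unfolding \<Phi> \<Psi>
    using run.iterates_square_integrable[of t] run.iterates_square_integrable[of "t + 1"] that
    by (intro conjI square_integrable_norm_sq square_integrable_diff run.square_integrable_gradF
        run.A.square_integrable_prx run.B.square_integrable_prx P) auto
  show ?thesis
    using integrable bound run.nearly_critical_outputs[OF T_pos less_imp_le[OF \<epsilon>] bound]
    unfolding run.criticality_gap_def grad \<Phi> \<Psi> by blast
qed

end
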